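(* There is a one-to-one correspondence between anti-self-dual metrics with a constant real spinor, and anti-self-dual Einstein–Maxwell spaces for which the self-dual part of the Maxwell field is null and covariantly constant.
   Context: All considerations are local, on a four-manifold ${\cal M}$ with a metric $g$ of signature $(++--)$. There are two real rank-two spin bundles $S^A$ and $S^{A'}$ with parallel symplectic forms $\varepsilon_{AB}$, $\varepsilon_{A'B'}$ such that $T{\cal M}\cong S^A\otimes S^{A'}$ (a vector index $a$ corresponds to a pair $AA'$) and $g_{ab}=\varepsilon_{AB}\varepsilon_{A'B'}$. $\nabla_a=\nabla_{AA'}$ is the Levi-Civita connection, extended to spinors. A constant real spinor is a non-zero real section $\iota_{A'}$ of the primed spin bundle with $\nabla_{AA'}\iota_{B'}=0$. The Weyl tensor decomposes as $C_{abcd}=\varepsilon_{A'B'}\varepsilon_{C'D'}C_{ABCD}+\varepsilon_{AB}\varepsilon_{CD}C_{A'B'C'D'}$ with totally symmetric $C_{ABCD}$, $C_{A'B'C'D'}$; $g$ is anti-self-dual (ASD) if $C_{A'B'C'D'}=0$. The trace-free Ricci spinor $\Phi_{ABA'B'}$ is defined by $-2\Phi_{ABA'B'}=R_{ab}-\frac14Rg_{ab}$, with $R_{ab}$ the Ricci tensor and $R$ the scalar curvature. A two-form decomposes as $F_{ab}=F_{AB}\varepsilon_{A'B'}+\widetilde F_{A'B'}\varepsilon_{AB}$ with $F_{AB}$, $\widetilde F_{A'B'}$ symmetric; the first summand is its ASD part and the second its self-dual (SD) part. It is a Maxwell field if it is closed and co-closed, equivalently $\nabla^{AA'}F_{AB}=0$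 and $\nabla^{AA'}\widetilde F_{A'B'}=0$. A non-zero two-form $\Sigma$ is null if $\Sigma\wedge\Sigma=0$. An ASD Einstein–Maxwell space is an ASD metric $g$ together with a Maxwell field $F_{ab}$ such that the Einstein equations with electromagnetic stress-energy tensor hold: $R=0$ and $\Phi_{ABA'B'}=T_{ab}$, where $$T_{ab}=\tfrac12\Big(\tfrac14 g_{ab}F_{cd}F^{cd}-F_{ac}{F_b}^{c}\Big)=F_{AB}\widetilde F_{A'B'}.$$ In the correspondence the metric is the same on both sides; the ASD part of the Maxwell field is given by the Ricci form, and the SD part by the null-Kähler form $\iota_{A'}\iota_{B'}\varepsilon_{AB}$ determined by the spinor. That is, $F_{ab}=F_{AB}\varepsilon_{A'B'}+\iota_{A'}\iota_{B'}\varepsilon_{AB}$, where $F_{AB}$ is determined by $\Phi_{ABA'B'}=F_{AB}\iota_{A'}\iota_{B'}$.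
   Formalization: The constant spinor and the Maxwell field are each taken up to overall sign, since a spinor and its negative give the same Maxwell field, and the negative of a Maxwell field so obtained also qualifies but comes from no real spinor; the local domain is taken simply connected. *)

theory Defs
  imports "HOL-Analysis.Analysis"
begin

text \<open>
  Everything is local: the four-manifold is an open subset \<open>U\<close> of \<open>\<real>\<^sup>4\<close>, tensors are given by
  their coordinate components, and the two spin bundles are trivialised over \<open>U\<close>.  Tensor
  indices have type \<open>4\<close>, unprimed and primed spinor indices both have type \<open>2 = {0, 1}\<close>.
  Fields are only meaningful on \<open>U\<close>; they are normalised to be zero off \<open>U\<close>, so that
  equality of fields on \<open>U\<close> is equality of functions.
\<close>

type_synonym point = "real^4"
type_synonym tensor2 = "point \<Rightarrow> real^4^4"
type_synonym spinor = "point \<Rightarrow> real^2"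
type_synonym spin_frame = "point \<Rightarrow> real^4^2^2"

definition pd :: "4 \<Rightarrow> (point \<Rightarrow> 'b::real_normed_vector) \<Rightarrow> point \<Rightarrow> 'b" where
  "pd a f x = frechet_derivative f (at x) (axis a 1)"

primrec Ck_on :: "nat \<Rightarrow> (point \<Rightarrow> 'b::real_normed_vector) \<Rightarrow> point set \<Rightarrow> bool" where
  "Ck_on 0 f U \<longleftrightarrow> continuous_on U f"
| "Ck_on (Suc k) f U \<longleftrightarrow> f differentiable_on U \<and> (\<forall>a. Ck_on k (pd a f) U)"

definition smooth_field :: "point set \<Rightarrow> (point \<Rightarrow> 'b::real_normed_vector) \<Rightarrow> bool" where
  "smooth_field U f \<longleftrightarrow> (\<forall>k. Ck_on k f U) \<and> (\<forall>x. x \<notin> U \<longrightarrow> f x = 0)"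


section \<open>Metric, Levi-Civita connection and curvature\<close>

definition signature22 :: "real^4^4" where
  "signature22 = (\<chi> a b. if a \<noteq> b then 0 else if a = 0 \<or> a = 1 then 1 else -1)"

definition neutral_metric :: "point set \<Rightarrow> tensor2 \<Rightarrow> bool" where
  "neutral_metric U g \<longleftrightarrow> smooth_field U g \<and>
     (\<forall>x\<in>U. transpose (g x) = g x \<and>
        (\<exists>P. invertible P \<and> transpose P ** g x ** P = signature22))"

definition ginv :: "tensor2 \<Rightarrow> tensor2" where
  "ginv g x = matrix_inv (g x)"

text \<open>\<open>christoffel g x c a b\<close> is \<open>\<Gamma>\<^sup>c\<^sub>a\<^sub>b\<close>.\<close>

definition christoffel :: "tensor2 \<Rightarrow> point \<Rightarrow> 4 \<Rightarrow> 4 \<Rightarrow> 4 \<Rightarrow> real" where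
  "christoffel g x c a b = (1/2) * (\<Sum>d\<in>UNIV. ginv g x $ c $ d *
     (pd a (\<lambda>y. g y $ b $ d) x + pd b (\<lambda>y. g y $ a $ d) x - pd d (\<lambda>y. g y $ a $ b) x))"

text \<open>\<open>nabla_vector g V x a c\<close> is \<open>\<nabla>\<^sub>a V\<^sup>c\<close>, and \<open>nabla_tensor2 g T x a b c\<close> is \<open>\<nabla>\<^sub>a T\<^sub>b\<^sub>c\<close>.\<close>

definition nabla_vector :: "tensor2 \<Rightarrow> (point \<Rightarrow> real^4) \<Rightarrow> point \<Rightarrow> 4 \<Rightarrow> 4 \<Rightarrow> real" where
  "nabla_vector g V x a c =
     pd a (\<lambda>y. V y $ c) x + (\<Sum>b\<in>UNIV. christoffel g x c a b * V x $ b)"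

definition nabla_tensor2 :: "tensor2 \<Rightarrow> tensor2 \<Rightarrow> point \<Rightarrow> 4 \<Rightarrow> 4 \<Rightarrow> 4 \<Rightarrow> real" where
  "nabla_tensor2 g T x a b c = pd a (\<lambda>y. T y $ b $ c) x
     - (\<Sum>d\<in>UNIV. christoffel g x d a b * T x $ d $ c)
     - (\<Sum>d\<in>UNIV. christoffel g x d a c * T x $ b $ d)"

text \<open>
  Curvature conventions are those of Penrose and Rindler, which go with the sign in the
  definition of \<open>\<Phi>\<close> below:
  \<open>(\<nabla>\<^sub>a\<nabla>\<^sub>b - \<nabla>\<^sub>b\<nabla>\<^sub>a) V\<^sup>d = R\<^sub>a\<^sub>b\<^sub>c\<^sup>d V\<^sup>c\<close> and \<open>R\<^sub>a\<^sub>b = R\<^sub>a\<^sub>c\<^sub>b\<^sup>c\<close>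
  (so the Ricci tensor of a round sphere would be negative definite).
  \<open>riemann g x a b c d\<close> is \<open>R\<^sub>a\<^sub>b\<^sub>c\<^sup>d\<close>, \<open>riemann_low g x a b c d\<close> is \<open>R\<^sub>a\<^sub>b\<^sub>c\<^sub>d\<close>.
\<close>

definition riemann :: "tensor2 \<Rightarrow> point \<Rightarrow> 4 \<Rightarrow> 4 \<Rightarrow> 4 \<Rightarrow> 4 \<Rightarrow> real" where
  "riemann g x a b c d =
     pd a (\<lambda>y. christoffel g y d b c) x - pd b (\<lambda>y. christoffel g y d a c) x
     + (\<Sum>e\<in>UNIV. christoffel g x d a e * christoffel g x e b c
                  - christoffel g x d b e * christoffel g x e a c)"

definition riemann_low :: "tensor2 \<Rightarrow> point \<Rightarrow> 4 \<Rightarrow> 4 \<Rightarrow> 4 \<Rightarrow> 4 \<Rightarrow> real" where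
  "riemann_low g x a b c d = (\<Sum>e\<in>UNIV. riemann g x a b c e * g x $ e $ d)"

definition ricci :: "tensor2 \<Rightarrow> tensor2" where
  "ricci g x = (\<chi> a b. \<Sum>c\<in>UNIV. riemann g x a c b c)"

definition scalar_curv :: "tensor2 \<Rightarrow> point \<Rightarrow> real" where
  "scalar_curv g x = (\<Sum>a\<in>UNIV. \<Sum>b\<in>UNIV. ginv g x $ a $ b * ricci g x $ a $ b)"

definition weyl :: "tensor2 \<Rightarrow> point \<Rightarrow> 4 \<Rightarrow> 4 \<Rightarrow> 4 \<Rightarrow> 4 \<Rightarrow> real" where
  "weyl g x a b c d = riemann_low g x a b c d
     - (1/2) * (g x $ a $ c * ricci g x $ b $ d - g x $ a $ d * ricci g x $ b $ c
              - g x $ b $ c * ricci g x $ a $ d + g x $ b $ d * ricci g x $ a $ c)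
     + (1/6) * scalar_curv g x * (g x $ a $ c * g x $ b $ d - g x $ a $ d * g x $ b $ c)"

text \<open>The tensor \<open>\<Phi>\<^sub>a\<^sub>b\<close>, defined by \<open>-2 \<Phi>\<^sub>a\<^sub>b = R\<^sub>a\<^sub>b - R g\<^sub>a\<^sub>b / 4\<close>.\<close>

definition Phi :: "tensor2 \<Rightarrow> tensor2" where
  "Phi g x = (\<chi> a b. - (1/2) * (ricci g x $ a $ b - (1/4) * scalar_curv g x * g x $ a $ b))"


section \<open>Spinors\<close>

text \<open>
  Components of the symplectic form in a spin frame.  The same array gives
  \<open>\<epsilon>\<^sub>A\<^sub>B\<close>, \<open>\<epsilon>\<^sup>A\<^sup>B\<close> and their primed versions.
\<close>

definition eps :: "2 \<Rightarrow> 2 \<Rightarrow> real" where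
  "eps A B = (if A = 0 \<and> B = 1 then 1 else if A = 1 \<and> B = 0 then -1 else 0)"

text \<open>
  The isomorphism of the tangent bundle with \<open>S\<^sup>A \<otimes> S\<^sup>A\<^sup>'\<close> is given by the images
  \<open>e x $ A $ A'\<close> of the products of the basis spinors.  The condition on \<open>g\<close> is
  \<open>g\<^sub>a\<^sub>b = \<epsilon>\<^sub>A\<^sub>B \<epsilon>\<^sub>A\<^sub>'\<^sub>B\<^sub>'\<close>; it forces these four vectors to be a basis.
\<close>

definition is_spin_frame :: "point set \<Rightarrow> tensor2 \<Rightarrow> spin_frame \<Rightarrow> bool" where
  "is_spin_frame U g e \<longleftrightarrow> smooth_field U e \<and>
     (\<forall>x\<in>U. \<forall>A A' B B'. e x $ A $ A' \<bullet> (g x *v (e x $ B $ B')) = eps A B * eps A' B')"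

text \<open>\<open>coframe g e x A A' a\<close> is the dual basis \<open>\<theta>\<^sup>A\<^sup>A\<^sup>'\<^sub>a\<close>.\<close>

definition coframe :: "tensor2 \<Rightarrow> spin_frame \<Rightarrow> point \<Rightarrow> 2 \<Rightarrow> 2 \<Rightarrow> 4 \<Rightarrow> real" where
  "coframe g e x A A' a =
     (\<Sum>B\<in>UNIV. \<Sum>B'\<in>UNIV. eps A B * eps A' B' * (g x *v (e x $ B $ B')) $ a)"

definition spin_comp2 :: "spin_frame \<Rightarrow> tensor2 \<Rightarrow> point \<Rightarrow> 2 \<Rightarrow> 2 \<Rightarrow> 2 \<Rightarrow> 2 \<Rightarrow> real" where
  "spin_comp2 e T x A A' B B' = e x $ A $ A' \<bullet> (T x *v (e x $ B $ B'))"

text \<open>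
  The connection on the primed spin bundle.  The connections on the two spin bundles are the
  trace-free \<open>\<gamma>\<^sub>a\<^sub>B\<^sup>C\<close>, \<open>\<gamma>\<^sub>a\<^sub>B\<^sub>'\<^sup>C\<^sup>'\<close> (parallel symplectic forms) with
  \<open>\<nabla>\<^sub>a e\<^sub>B\<^sub>B\<^sub>' = \<gamma>\<^sub>a\<^sub>B\<^sup>C e\<^sub>C\<^sub>B\<^sub>' + \<gamma>\<^sub>a\<^sub>B\<^sub>'\<^sup>C\<^sup>' e\<^sub>B\<^sub>C\<^sub>'\<close> (the Levi-Civita connection is the
  tensor product connection); contracting the unprimed indices gives the formula.
  \<open>spin_conn g e x a B' C'\<close> is \<open>\<gamma>\<^sub>a\<^sub>B\<^sub>'\<^sup>C\<^sup>'\<close>.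
\<close>

definition spin_conn :: "tensor2 \<Rightarrow> spin_frame \<Rightarrow> point \<Rightarrow> 4 \<Rightarrow> 2 \<Rightarrow> 2 \<Rightarrow> real" where
  "spin_conn g e x a B' C' = (1/2) * (\<Sum>B\<in>UNIV. \<Sum>c\<in>UNIV.
     coframe g e x B C' c * nabla_vector g (\<lambda>y. e y $ B $ B') x a c)"

text \<open>\<open>nabla_spinor g e \<iota> x a B'\<close> is \<open>\<nabla>\<^sub>a \<iota>\<^sub>B\<^sub>'\<close>, for a primed spinor with lower index.\<close>

definition nabla_spinor :: "tensor2 \<Rightarrow> spin_frame \<Rightarrow> spinor \<Rightarrow> point \<Rightarrow> 4 \<Rightarrow> 2 \<Rightarrow> real" where
  "nabla_spinor g e \<iota> x a B' =
     pd a (\<lambda>y. \<iota> y $ B') x - (\<Sum>C'\<in>UNIV. spin_conn g e x a B' C' * \<iota> x $ C')"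

definition constant_spinor :: "point set \<Rightarrow> tensor2 \<Rightarrow> spin_frame \<Rightarrow> spinor \<Rightarrow> bool" where
  "constant_spinor U g e \<iota> \<longleftrightarrow> smooth_field U \<iota> \<and>
     (\<forall>x\<in>U. \<iota> x \<noteq> 0 \<and> (\<forall>a B'. nabla_spinor g e \<iota> x a B' = 0))"

definition tot_sym :: "(2 \<Rightarrow> 2 \<Rightarrow> 2 \<Rightarrow> 2 \<Rightarrow> real) \<Rightarrow> bool" where
  "tot_sym \<Psi> \<longleftrightarrow> (\<forall>A B C D. \<Psi> A B C D = \<Psi> B A C D \<and> \<Psi> A B C D = \<Psi> A C B D
                            \<and> \<Psi> A B C D = \<Psi> A B D C)"

text \<open>
  \<open>\<Psi>\<close> and \<open>\<Psi>'\<close> are the Weyl spinors \<open>C\<^sub>A\<^sub>B\<^sub>C\<^sub>D\<close> and \<open>C\<^sub>A\<^sub>'\<^sub>B\<^sub>'\<^sub>C\<^sub>'\<^sub>D\<^sub>'\<close> at \<open>x\<close>.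
\<close>

definition weyl_spinors ::
  "tensor2 \<Rightarrow> spin_frame \<Rightarrow> point \<Rightarrow> (2 \<Rightarrow> 2 \<Rightarrow> 2 \<Rightarrow> 2 \<Rightarrow> real) \<Rightarrow> (2 \<Rightarrow> 2 \<Rightarrow> 2 \<Rightarrow> 2 \<Rightarrow> real) \<Rightarrow> bool"
where
  "weyl_spinors g e x \<Psi> \<Psi>' \<longleftrightarrow> tot_sym \<Psi> \<and> tot_sym \<Psi>' \<and>
     (\<forall>A A' B B' C C' D D'.
        (\<Sum>a\<in>UNIV. \<Sum>b\<in>UNIV. \<Sum>c\<in>UNIV. \<Sum>d\<in>UNIV. weyl g x a b c d *
            e x $ A $ A' $ a * e x $ B $ B' $ b * e x $ C $ C' $ c * e x $ D $ D' $ d)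
        = eps A' B' * eps C' D' * \<Psi> A B C D + eps A B * eps C D * \<Psi>' A' B' C' D')"

definition asd_metric :: "point set \<Rightarrow> tensor2 \<Rightarrow> spin_frame \<Rightarrow> bool" where
  "asd_metric U g e \<longleftrightarrow> neutral_metric U g \<and> is_spin_frame U g e \<and>
     (\<forall>x\<in>U. \<exists>\<Psi>. weyl_spinors g e x \<Psi> (\<lambda>A' B' C' D'. 0))"


section \<open>Two-forms and Einstein--Maxwell spaces\<close>

definition two_form :: "point set \<Rightarrow> tensor2 \<Rightarrow> bool" where
  "two_form U F \<longleftrightarrow> smooth_field U F \<and> (\<forall>x\<in>U. transpose (F x) = - F x)"

text \<open>The two-form \<open>\<phi>\<^sub>A\<^sub>B \<epsilon>\<^sub>A\<^sub>'\<^sub>B\<^sub>' + \<psi>\<^sub>A\<^sub>'\<^sub>B\<^sub>' \<epsilon>\<^sub>A\<^sub>B\<close> at \<open>x\<close>, in coordinates.\<close>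

definition form_of_spinors ::
  "tensor2 \<Rightarrow> spin_frame \<Rightarrow> point \<Rightarrow> real^2^2 \<Rightarrow> real^2^2 \<Rightarrow> real^4^4" where
  "form_of_spinors g e x \<phi> \<psi> = (\<chi> a b.
     \<Sum>A\<in>UNIV. \<Sum>A'\<in>UNIV. \<Sum>B\<in>UNIV. \<Sum>B'\<in>UNIV.
       (\<phi> $ A $ B * eps A' B' + \<psi> $ A' $ B' * eps A B)
       * coframe g e x A A' a * coframe g e x B B' b)"

text \<open>
  Contracting \<open>F\<^sub>a\<^sub>b = F\<^sub>A\<^sub>B \<epsilon>\<^sub>A\<^sub>'\<^sub>B\<^sub>' + F\<^sub>A\<^sub>'\<^sub>B\<^sub>' \<epsilon>\<^sub>A\<^sub>B\<close> with \<open>\<epsilon>\<^sup>A\<^sup>B\<close> isolates twice the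
  self-dual spinor.
\<close>

definition sd_spinor :: "spin_frame \<Rightarrow> tensor2 \<Rightarrow> point \<Rightarrow> real^2^2" where
  "sd_spinor e F x =
     (\<chi> A' B'. (1/2) * (\<Sum>A\<in>UNIV. \<Sum>B\<in>UNIV. eps A B * spin_comp2 e F x A A' B B'))"

definition sd_part :: "tensor2 \<Rightarrow> spin_frame \<Rightarrow> tensor2 \<Rightarrow> tensor2" where
  "sd_part g e F x = form_of_spinors g e x 0 (sd_spinor e F x)"

text \<open>The second condition is \<open>\<Sigma> \<and> \<Sigma> = 0\<close> in components.\<close>

definition null_form :: "point set \<Rightarrow> tensor2 \<Rightarrow> bool" where
  "null_form U \<Sigma> \<longleftrightarrow> (\<forall>x\<in>U. \<Sigma> x \<noteq> 0 \<and>
     (\<forall>a b c d. \<Sigma> x $ a $ b * \<Sigma> x $ c $ d + \<Sigma> x $ a $ c * \<Sigma> x $ d $ b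
                + \<Sigma> x $ a $ d * \<Sigma> x $ b $ c = 0))"

definition covariantly_constant :: "point set \<Rightarrow> tensor2 \<Rightarrow> tensor2 \<Rightarrow> bool" where
  "covariantly_constant U g T \<longleftrightarrow> (\<forall>x\<in>U. \<forall>a b c. nabla_tensor2 g T x a b c = 0)"

text \<open>Closed, and co-closed in the form \<open>\<nabla>\<^sup>a F\<^sub>a\<^sub>b = 0\<close>.\<close>

definition maxwell_field :: "point set \<Rightarrow> tensor2 \<Rightarrow> tensor2 \<Rightarrow> bool" where
  "maxwell_field U g F \<longleftrightarrow> two_form U F \<and>
     (\<forall>x\<in>U. (\<forall>a b c. pd a (\<lambda>y. F y $ b $ c) x + pd b (\<lambda>y. F y $ c $ a) x
                     + pd c (\<lambda>y. F y $ a $ b) x = 0) \<and>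
            (\<forall>c. (\<Sum>a\<in>UNIV. \<Sum>b\<in>UNIV. ginv g x $ a $ b * nabla_tensor2 g F x a b c) = 0))"

text \<open>\<open>T\<^sub>a\<^sub>b = (g\<^sub>a\<^sub>b F\<^sub>c\<^sub>d F\<^sup>c\<^sup>d / 4 - F\<^sub>a\<^sub>c F\<^sub>b\<^sup>c) / 2\<close>.\<close>

definition stress_energy :: "tensor2 \<Rightarrow> tensor2 \<Rightarrow> tensor2" where
  "stress_energy g F x = (\<chi> a b. (1/2) *
     ((1/4) * g x $ a $ b *
        (\<Sum>c\<in>UNIV. \<Sum>d\<in>UNIV. \<Sum>p\<in>UNIV. \<Sum>q\<in>UNIV.
           ginv g x $ c $ p * ginv g x $ d $ q * F x $ c $ d * F x $ p $ q)
      - (\<Sum>c\<in>UNIV. \<Sum>d\<in>UNIV. F x $ a $ c * F x $ b $ d * ginv g x $ c $ d)))"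

definition asd_einstein_maxwell :: "point set \<Rightarrow> tensor2 \<Rightarrow> spin_frame \<Rightarrow> tensor2 \<Rightarrow> bool" where
  "asd_einstein_maxwell U g e F \<longleftrightarrow> asd_metric U g e \<and> maxwell_field U g F \<and>
     (\<forall>x\<in>U. scalar_curv g x = 0 \<and> Phi g x = stress_energy g F x)"


section \<open>The correspondence\<close>

text \<open>\<open>\<phi>\<close> is the spinor \<open>F\<^sub>A\<^sub>B\<close> at \<open>x\<close> with \<open>\<Phi>\<^sub>A\<^sub>B\<^sub>A\<^sub>'\<^sub>B\<^sub>' = F\<^sub>A\<^sub>B \<iota>\<^sub>A\<^sub>' \<iota>\<^sub>B\<^sub>'\<close>.\<close>

definition is_ricci_spinor ::
  "tensor2 \<Rightarrow> spin_frame \<Rightarrow> spinor \<Rightarrow> point \<Rightarrow> real^2^2 \<Rightarrow> bool" where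
  "is_ricci_spinor g e \<iota> x \<phi> \<longleftrightarrow> transpose \<phi> = \<phi> \<and>
     (\<forall>A A' B B'. spin_comp2 e (Phi g) x A A' B B' = \<phi> $ A $ B * \<iota> x $ A' * \<iota> x $ B')"

definition maxwell_of_spinor ::
  "point set \<Rightarrow> tensor2 \<Rightarrow> spin_frame \<Rightarrow> spinor \<Rightarrow> tensor2" where
  "maxwell_of_spinor U g e \<iota> = (\<lambda>x. if x \<in> U
     then form_of_spinors g e x (THE \<phi>. is_ricci_spinor g e \<iota> x \<phi>) (\<chi> A' B'. \<iota> x $ A' * \<iota> x $ B')
     else 0)"

text \<open>
  The spinors \<open>\<iota>\<close> and \<open>-\<iota>\<close> give the same Maxwell field, and the field equations are
  invariant under \<open>F \<mapsto> -F\<close>, while only one of \<open>F\<close>, \<open>-F\<close> has a self-dual part of the form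
  \<open>+ \<iota>\<^sub>A\<^sub>' \<iota>\<^sub>B\<^sub>' \<epsilon>\<^sub>A\<^sub>B\<close> with \<open>\<iota>\<close> real.  So spinors and Maxwell fields are both taken up to sign.
\<close>

definition up_to_sign :: "(point \<Rightarrow> 'b::real_normed_vector) \<Rightarrow> (point \<Rightarrow> 'b) set" where
  "up_to_sign f = {f, \<lambda>x. - f x}"

definition asd_spinor_spaces :: "point set \<Rightarrow> (tensor2 \<times> spin_frame \<times> spinor set) set" where
  "asd_spinor_spaces U =
     {(g, e, up_to_sign \<iota>) | g e \<iota>. asd_metric U g e \<and> constant_spinor U g e \<iota>}"

definition asd_em_spaces :: "point set \<Rightarrow> (tensor2 \<times> spin_frame \<times> tensor2 set) set" where
  "asd_em_spaces U =
     {(g, e, up_to_sign F) | g e F. asd_einstein_maxwell U g e F \<and>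
        null_form U (sd_part g e F) \<and> covariantly_constant U g (sd_part g e F)}"

definition em_space_of :: "point set \<Rightarrow>
    tensor2 \<times> spin_frame \<times> spinor set \<Rightarrow> tensor2 \<times> spin_frame \<times> tensor2 set" where
  "em_space_of U = (\<lambda>(g, e, s). (g, e, \<Union>\<iota>\<in>s. up_to_sign (maxwell_of_spinor U g e \<iota>)))"

end

theory Submission
  imports Defs
begin

text \<open>
  A constant spinor \<open>\<iota>\<close> makes the vector fields \<open>v\<^sub>A = e\<^sub>A\<^sub>A\<^sub>' \<iota>\<^sup>A\<^sup>'\<close> span a parallel null plane field; completed
  by \<open>w\<^sub>A\<close> built from a dual spinor they form a null frame whose remaining primed connection
  coefficient is a one-form, the potential \<open>\<langle>\<nabla>w\<^sub>0, w\<^sub>1\<rangle>\<close>.  The primed part of the curvature is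
  the exterior derivative of that potential times \<open>\<iota>\<^sub>C\<^sub>' \<iota>\<^sub>D\<^sub>'\<close>.  When the self-dual Weyl spinor vanishes,
  comparing with the Ricci part of the curvature gives \<open>R = 0\<close> and
  \<open>\<Phi>\<^sub>A\<^sub>B\<^sub>A\<^sub>'\<^sub>B\<^sub>' = \<phi>\<^sub>A\<^sub>B \<iota>\<^sub>A\<^sub>' \<iota>\<^sub>B\<^sub>'\<close>, and identifies \<open>\<phi>\<^sub>A\<^sub>B \<epsilon>\<^sub>A\<^sub>'\<^sub>B\<^sub>'\<close> with the exact form \<open>d\<close> of the potential;
  being anti-self-dual and closed it is co-closed.
  Conversely, a null self-dual part is \<open>\<plusminus>\<iota>\<^sub>A\<^sub>' \<iota>\<^sub>B\<^sub>' \<epsilon>\<^sub>A\<^sub>B\<close> for a continuous \<open>\<iota>\<close> because the domain is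
  simply connected; if it is parallel then \<open>\<nabla>\<iota> = 0\<close>, and this linear equation makes \<open>\<iota>\<close> smooth.
\<close>

section \<open>Smooth fields\<close>

text \<open>The forward direction rests on one algebraic fact. Without a self-dual Weyl spinor, the
  last index pair of the Weyl tensor enters only as a symmetric unprimed spinor times
  \<open>\<epsilon>\<^sub>C\<^sub>'\<^sub>D\<^sub>'\<close>, so the curvature acting on primed
  spinors is built from Ricci alone; a parallel spinor makes that part nilpotent. The unprimed spin
  connection is never introduced: all computations use products
  \<open>bil (g x) (cov a X x) Y\<close> of frame vectors, and a symmetry of these products stands
  for its trace-freeness. The field attached to a spinor is defined through \<open>THE\<close>, so
  its smoothness and closedness are reached only after it is rewritten as an exact form plus the
  null-Kaehler form. The obstacle in the converse is signs. Over the reals a null self-dual spinor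
  is a square only up to a factor \<sigma> = 1 or -1, and a square determines its root only up to
  sign. Simple connectedness gives a global root, connectedness makes each sign constant, and the
  quotients by \<open>up_to_sign\<close> absorb both ambiguities.\<close>

lemma pd_eq: "(f has_derivative f') (at x) \<Longrightarrow> pd a f x = f' (axis a 1)"
  unfolding pd_def using frechet_derivative_at by metis

lemma has_derivative_cong_open:
  assumes "open U" "x \<in> U" "\<And>y. y \<in> U \<Longrightarrow> f y = h y"
  shows "(f has_derivative D) (at x) \<longleftrightarrow> (h has_derivative D) (at x)"
  using assms has_derivative_transform_within_open [of f D x UNIV U h]
    has_derivative_transform_within_open [of h D x UNIV U f] by auto

text \<open>Holds for arbitrary functions: \<open>frechet_derivative\<close> is a choice from the
  derivatives at a point, and the set of these depends only on the values near the point.\<close>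

lemma pd_cong:
  assumes "open U" "x \<in> U" "\<And>y. y \<in> U \<Longrightarrow> f y = h y"
  shows "pd a f x = pd a h x"
  using has_derivative_cong_open [OF assms] unfolding pd_def frechet_derivative_def by simp

lemma has_derivative_pd:
  "f differentiable (at x) \<Longrightarrow> (f has_derivative frechet_derivative f (at x)) (at x)"
  by (simp add: frechet_derivative_works)

lemma pd_const [simp]: "pd a (\<lambda>y. c) x = 0"
  using pd_eq [OF has_derivative_const] .

lemma pd_linear:
  assumes "bounded_linear L" "f differentiable (at x)"
  shows "pd a (\<lambda>y. L (f y)) x = L (pd a f x)"
  using pd_eq [OF bounded_linear.has_derivative [OF assms(1) has_derivative_pd [OF assms(2)]]]
  by (simp add: pd_def)

lemma pd_bilinear:
  assumes "bounded_bilinear bp" "f differentiable (at x)" "h differentiable (at x)"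
  shows "pd a (\<lambda>y. bp (f y) (h y)) x = bp (pd a f x) (h x) + bp (f x) (pd a h x)"
proof -
  have "((\<lambda>y. bp (f y) (h y)) has_derivative
     (\<lambda>d. bp (f x) (frechet_derivative h (at x) d) + bp (frechet_derivative f (at x) d) (h x))) (at x)"
    using bounded_bilinear.FDERIV [OF assms(1) assms(2,3) [THEN has_derivative_pd]] .
  from pd_eq [OF this] show ?thesis by (simp add: pd_def)
qed

lemma differentiable_bilinear:
  assumes "bounded_bilinear bp" "f differentiable (at x)" "h differentiable (at x)"
  shows "(\<lambda>y. bp (f y) (h y)) differentiable (at x)"
  using assms bounded_bilinear.FDERIV unfolding differentiable_def by blast

lemma differentiable_linear:
  assumes "bounded_linear L" "f differentiable (at x)"
  shows "(\<lambda>y. L (f y)) differentiable (at x)"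
  using assms bounded_linear.has_derivative unfolding differentiable_def by blast

lemma pd_add:
  assumes "f differentiable (at x)" "h differentiable (at x)"
  shows "pd a (\<lambda>y. f y + h y) x = pd a f x + pd a h x"
  using pd_eq [OF has_derivative_add [OF assms [THEN has_derivative_pd]]] by (simp add: pd_def)

lemma pd_diff:
  assumes "f differentiable (at x)" "h differentiable (at x)"
  shows "pd a (\<lambda>y. f y - h y) x = pd a f x - pd a h x"
  using pd_eq [OF has_derivative_diff [OF assms [THEN has_derivative_pd]]] by (simp add: pd_def)

lemma pd_minus:
  assumes "f differentiable (at x)"
  shows "pd a (\<lambda>y. - f y) x = - pd a f x"
  using pd_linear [OF bounded_linear_minus [OF bounded_linear_ident] assms] by simp

lemma pd_mult:
  fixes f h :: "point \<Rightarrow> real"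
  assumes "f differentiable (at x)" "h differentiable (at x)"
  shows "pd a (\<lambda>y. f y * h y) x = pd a f x * h x + f x * pd a h x"
  using pd_bilinear [OF bounded_bilinear_mult assms] .

lemma pd_scaleR:
  assumes "f differentiable (at x)" "h differentiable (at x)"
  shows "pd a (\<lambda>y. f y *\<^sub>R h y) x = pd a f x *\<^sub>R h x + f x *\<^sub>R pd a h x"
  using pd_bilinear [OF bounded_bilinear_scaleR assms] .

lemma pd_nth:
  assumes "f differentiable (at x)"
  shows "pd a (\<lambda>y. f y $ i) x = pd a f x $ i"
  using pd_linear [OF bounded_linear_vec_nth assms] .

lemma differentiable_nth:
  "f differentiable (at x) \<Longrightarrow> (\<lambda>y. f y $ i) differentiable (at x)"
  by (rule differentiable_linear [OF bounded_linear_vec_nth])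

lemma bounded_bilinear_matrix_vector: "bounded_bilinear ((*v) :: real^'n^'m \<Rightarrow> real^'n \<Rightarrow> real^'m)"
  unfolding bilinear_conv_bounded_bilinear [symmetric]
  by (intro bilinear_def [THEN iffD2])
    (auto intro!: linearI simp: matrix_vector_right_distrib matrix_vector_mult_add_rdistrib
      scaleR_matrix_vector_assoc matrix_vector_mult_scaleR)

text \<open>Smoothness without the normalisation off \<open>U\<close>. Intermediate fields, such as
  constants or the inverse metric, need not vanish there.\<close>

definition smooth_in :: "point set \<Rightarrow> (point \<Rightarrow> 'b::real_normed_vector) \<Rightarrow> bool" where
  "smooth_in U f \<longleftrightarrow> (\<forall>k. Ck_on k f U)"

lemma smooth_field_iff: "smooth_field U f \<longleftrightarrow> smooth_in U f \<and> (\<forall>x. x \<notin> U \<longrightarrow> f x = 0)"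
  by (simp add: smooth_field_def smooth_in_def)

lemma Ck_on_cong:
  assumes "open U" "\<And>y. y \<in> U \<Longrightarrow> f y = h y"
  shows "Ck_on k f U \<longleftrightarrow> Ck_on k h U"
  using assms(2)
proof (induction k arbitrary: f h)
  case 0
  then show ?case by (simp cong: continuous_on_cong)
next
  case (Suc k)
  have "f differentiable_on U \<longleftrightarrow> h differentiable_on U"
    using has_derivative_cong_open [OF assms(1) _ Suc.prems]
    by (simp add: differentiable_on_eq_differentiable_at [OF assms(1)] differentiable_def)
  moreover have "Ck_on k (pd a f) U \<longleftrightarrow> Ck_on k (pd a h) U" for a
    using Suc.IH [of "pd a f" "pd a h"] pd_cong [OF assms(1)] Suc.prems by metis
  ultimately show ?case by simp
qed

lemma Ck_on_Suc_D: "Ck_on (Suc k) f U \<Longrightarrow> Ck_on k f U"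
proof (induction k arbitrary: f)
  case 0
  then show ?case by (auto intro: differentiable_imp_continuous_on)
next
  case (Suc k)
  then show ?case by (metis Ck_on.simps(2))
qed

lemma Ck_on_differentiable_at:
  assumes "open U" "Ck_on (Suc k) f U" "x \<in> U"
  shows "f differentiable (at x)"
  using assms by (auto simp: differentiable_on_eq_differentiable_at)

lemma Ck_on_const: "Ck_on k (\<lambda>y. c) U"
proof (induction k arbitrary: c)
  case (Suc k)
  have "pd a (\<lambda>y. c) = (\<lambda>y. 0)" for a by (rule ext) simp
  with Suc show ?case by simp
qed simp

lemma Ck_on_linear:
  assumes "open U" "bounded_linear L"
  shows "Ck_on k f U \<Longrightarrow> Ck_on k (\<lambda>y. L (f y)) U"
proof (induction k arbitrary: f)
  case 0
  then show ?case using assms(2) by (simp add: bounded_linear.continuous_on)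
next
  case (Suc k)
  note d = Ck_on_differentiable_at [OF assms(1) Suc.prems]
  have "Ck_on k (pd a (\<lambda>y. L (f y))) U" for a
    using Suc Ck_on_cong [OF assms(1), of "pd a (\<lambda>y. L (f y))" "\<lambda>y. L (pd a f y)"]
      pd_linear [OF assms(2) d] by simp
  with d show ?case
    by (simp add: differentiable_at_imp_differentiable_on differentiable_linear [OF assms(2)])
qed

lemma Ck_on_add:
  assumes "open U"
  shows "Ck_on k f U \<Longrightarrow> Ck_on k h U \<Longrightarrow> Ck_on k (\<lambda>y. f y + h y) U"
proof (induction k arbitrary: f h)
  case 0
  then show ?case by (simp add: continuous_on_add)
next
  case (Suc k)
  note d = Ck_on_differentiable_at [OF assms(1) Suc.prems(1)]
    Ck_on_differentiable_at [OF assms(1) Suc.prems(2)]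
  have "Ck_on k (pd a (\<lambda>y. f y + h y)) U" for a
    using Suc Ck_on_cong [OF assms(1), of "pd a (\<lambda>y. f y + h y)" "\<lambda>y. pd a f y + pd a h y"]
      pd_add [OF d] by simp
  with d show ?case
    by (simp add: differentiable_at_imp_differentiable_on)
qed

lemma Ck_on_bilinear:
  assumes "open U" "bounded_bilinear bp"
  shows "Ck_on k f U \<Longrightarrow> Ck_on k h U \<Longrightarrow> Ck_on k (\<lambda>y. bp (f y) (h y)) U"
proof (induction k arbitrary: f h)
  case 0
  then show ?case using assms(2) by (simp add: bounded_bilinear.continuous_on)
next
  case (Suc k)
  note d = Ck_on_differentiable_at [OF assms(1) Suc.prems(1)]
    Ck_on_differentiable_at [OF assms(1) Suc.prems(2)]
  have "Ck_on k (\<lambda>y. bp (pd a f y) (h y) + bp (f y) (pd a h y)) U" for a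
    using Suc Ck_on_Suc_D [OF Suc.prems(1)] Ck_on_Suc_D [OF Suc.prems(2)]
    by (intro Ck_on_add assms) auto
  then have "Ck_on k (pd a (\<lambda>y. bp (f y) (h y))) U" for a
    using Ck_on_cong [OF assms(1), of "pd a (\<lambda>y. bp (f y) (h y))"]
      pd_bilinear [OF assms(2) d] by simp
  with d show ?case
    by (simp add: differentiable_at_imp_differentiable_on differentiable_bilinear [OF assms(2)])
qed

lemma pd_inverse:
  fixes f :: "point \<Rightarrow> real"
  assumes "f differentiable (at x)" "f x \<noteq> 0"
  shows "pd a (\<lambda>y. inverse (f y)) x = - (pd a f x * (inverse (f x) * inverse (f x)))"
proof -
  have "((\<lambda>y. inverse (f y)) has_derivative
      (\<lambda>d. - (inverse (f x) * frechet_derivative f (at x) d * inverse (f x)))) (at x)"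
    by (rule Deriv.has_derivative_inverse [OF assms(2) has_derivative_pd [OF assms(1)]])
  from pd_eq [OF this] show ?thesis by (simp add: pd_def)
qed

text \<open>The derivative of the inverse is a polynomial in the inverse itself and the derivative
  of \<open>f\<close>, so the induction closes.\<close>

lemma Ck_on_inverse:
  fixes f :: "point \<Rightarrow> real"
  assumes "open U" "\<And>y. y \<in> U \<Longrightarrow> f y \<noteq> 0"
  shows "Ck_on k f U \<Longrightarrow> Ck_on k (\<lambda>y. inverse (f y)) U"
proof (induction k)
  case 0
  then show ?case using assms(2) by (simp add: continuous_on_inverse)
next
  case (Suc k)
  note d = Ck_on_differentiable_at [OF assms(1) Suc.prems]
  have "Ck_on k (\<lambda>y. - (pd a f y * (inverse (f y) * inverse (f y)))) U" for a
    using Suc Ck_on_Suc_D [OF Suc.prems]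
    by (intro Ck_on_linear [OF assms(1) bounded_linear_minus [OF bounded_linear_ident]]
        Ck_on_bilinear [OF assms(1) bounded_bilinear_mult]) auto
  then have "Ck_on k (pd a (\<lambda>y. inverse (f y))) U" for a
    using Ck_on_cong [OF assms(1), of "pd a (\<lambda>y. inverse (f y))"]
      pd_inverse [OF d assms(2)] by simp
  with d assms(2) show ?case
    by (simp add: differentiable_at_imp_differentiable_on differentiable_inverse)
qed

lemma smooth_in_differentiable:
  "open U \<Longrightarrow> smooth_in U f \<Longrightarrow> x \<in> U \<Longrightarrow> f differentiable (at x)"
  unfolding smooth_in_def by (metis Ck_on_differentiable_at)

lemma smooth_in_continuous_on: "smooth_in U f \<Longrightarrow> continuous_on U f"
  unfolding smooth_in_def by (metis Ck_on.simps(1))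

lemma smooth_in_pd: "smooth_in U f \<Longrightarrow> smooth_in U (pd a f)"
  unfolding smooth_in_def by (metis Ck_on.simps(2))

lemma smooth_in_cong:
  "open U \<Longrightarrow> (\<And>y. y \<in> U \<Longrightarrow> f y = h y) \<Longrightarrow> smooth_in U f \<longleftrightarrow> smooth_in U h"
  unfolding smooth_in_def by (metis Ck_on_cong)

lemma smooth_in_const: "smooth_in U (\<lambda>y. c)"
  by (simp add: smooth_in_def Ck_on_const)

lemma smooth_in_linear:
  "open U \<Longrightarrow> bounded_linear L \<Longrightarrow> smooth_in U f \<Longrightarrow> smooth_in U (\<lambda>y. L (f y))"
  by (simp add: smooth_in_def Ck_on_linear)

lemma smooth_in_bilinear:
  "open U \<Longrightarrow> bounded_bilinear bp \<Longrightarrow> smooth_in U f \<Longrightarrow> smooth_in U h \<Longrightarrow>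
    smooth_in U (\<lambda>y. bp (f y) (h y))"
  by (simp add: smooth_in_def Ck_on_bilinear)

lemma smooth_in_add:
  "open U \<Longrightarrow> smooth_in U f \<Longrightarrow> smooth_in U h \<Longrightarrow> smooth_in U (\<lambda>y. f y + h y)"
  by (simp add: smooth_in_def Ck_on_add)

lemma smooth_in_minus: "open U \<Longrightarrow> smooth_in U f \<Longrightarrow> smooth_in U (\<lambda>y. - f y)"
  using smooth_in_linear [OF _ bounded_linear_minus [OF bounded_linear_ident]] by auto

lemma smooth_in_diff:
  "open U \<Longrightarrow> smooth_in U f \<Longrightarrow> smooth_in U h \<Longrightarrow> smooth_in U (\<lambda>y. f y - h y)"
  using smooth_in_add [of U f "\<lambda>y. - h y"] smooth_in_minus [of U h] by simp

lemma smooth_in_sum: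
  assumes "open U" "\<And>i. i \<in> I \<Longrightarrow> smooth_in U (f i)"
  shows "smooth_in U (\<lambda>y. \<Sum>i\<in>I. f i y)"
  using assms(2)
  by (induction I rule: infinite_finite_induct)
    (auto intro: smooth_in_add assms(1) smooth_in_const)

lemma smooth_in_mult:
  fixes f h :: "point \<Rightarrow> real"
  shows "open U \<Longrightarrow> smooth_in U f \<Longrightarrow> smooth_in U h \<Longrightarrow> smooth_in U (\<lambda>y. f y * h y)"
  by (rule smooth_in_bilinear [OF _ bounded_bilinear_mult])

lemma smooth_in_scaleR:
  "open U \<Longrightarrow> smooth_in U f \<Longrightarrow> smooth_in U h \<Longrightarrow> smooth_in U (\<lambda>y. f y *\<^sub>R h y)"
  by (rule smooth_in_bilinear [OF _ bounded_bilinear_scaleR])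

lemma smooth_in_inner:
  "open U \<Longrightarrow> smooth_in U f \<Longrightarrow> smooth_in U h \<Longrightarrow> smooth_in U (\<lambda>y. f y \<bullet> h y)"
  by (rule smooth_in_bilinear [OF _ bounded_bilinear_inner])

lemma smooth_in_matrix_vector:
  fixes f :: "point \<Rightarrow> real^'n^'m"
  shows "open U \<Longrightarrow> smooth_in U f \<Longrightarrow> smooth_in U h \<Longrightarrow> smooth_in U (\<lambda>y. f y *v h y)"
  by (rule smooth_in_bilinear [OF _ bounded_bilinear_matrix_vector])

lemma smooth_in_inverse:
  fixes f :: "point \<Rightarrow> real"
  shows "open U \<Longrightarrow> (\<And>y. y \<in> U \<Longrightarrow> f y \<noteq> 0) \<Longrightarrow> smooth_in U f \<Longrightarrow> smooth_in U (\<lambda>y. inverse (f y))"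
  by (simp add: smooth_in_def Ck_on_inverse)

lemma smooth_in_nth: "open U \<Longrightarrow> smooth_in U f \<Longrightarrow> smooth_in U (\<lambda>y. f y $ i)"
  by (rule smooth_in_linear [OF _ bounded_linear_vec_nth])

text \<open>A vector is the finite sum of the images of its entries under the bounded linear maps
  \<open>axis i\<close>.\<close>

lemma smooth_in_vec_lambda:
  fixes f :: "'n::finite \<Rightarrow> point \<Rightarrow> 'b::real_normed_vector"
  assumes "open U" "\<And>i. smooth_in U (f i)"
  shows "smooth_in U (\<lambda>y. \<chi> i. f i y)"
proof -
  have "bounded_linear (\<lambda>b. axis i b :: 'b^'n)" for i
    by (rule bounded_linear_intro [where K = 1])
      (auto simp: axis_def vec_eq_iff norm_vec_def L2_set_def if_distrib [of norm]
        if_distrib [of "\<lambda>z. z ^ 2"] cong: if_cong)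
  then have "smooth_in U (\<lambda>y. \<Sum>i\<in>UNIV. axis i (f i y))"
    using assms by (intro smooth_in_sum smooth_in_linear [where L = "axis _"]) auto
  moreover have "(\<Sum>i\<in>UNIV. axis i (f i y)) = (\<chi> i. f i y)" for y
    by (simp add: vec_eq_iff axis_def)
  ultimately show ?thesis by simp
qed

lemmas smooth_in_open_intros = smooth_in_add smooth_in_minus smooth_in_diff
  smooth_in_sum smooth_in_mult smooth_in_scaleR smooth_in_inner smooth_in_matrix_vector
  smooth_in_nth smooth_in_vec_lambda

section \<open>Symmetry of second partial derivatives\<close>

lemma has_real_derivative_pd_line:
  fixes f :: "point \<Rightarrow> real"
  assumes "f differentiable (at (p + t *\<^sub>R axis a 1))"
  shows "((\<lambda>s. f (p + s *\<^sub>R axis a 1)) has_real_derivative pd a f (p + t *\<^sub>R axis a 1)) (at t)"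
proof -
  let ?F = "frechet_derivative f (at (p + t *\<^sub>R axis a 1))"
  have F: "(f has_derivative ?F) (at (p + t *\<^sub>R axis a 1))"
    by (rule has_derivative_pd [OF assms])
  have "((\<lambda>s. p + s *\<^sub>R axis a 1) has_derivative (\<lambda>h. h *\<^sub>R axis a 1)) (at t)"
    by (auto intro!: derivative_eq_intros)
  from has_derivative_compose [OF this, of f ?F] F
  have "((\<lambda>s. f (p + s *\<^sub>R axis a 1)) has_derivative (\<lambda>h. ?F (h *\<^sub>R axis a 1))) (at t)"
    by simp
  moreover have "?F (h *\<^sub>R axis a 1) = ?F (axis a 1) * h" for h
    using linear_cmul [OF has_derivative_linear [OF F], of h "axis a 1"] by simp
  ultimately show ?thesis
    by (simp add: has_field_derivative_def pd_def)
qed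

text \<open>The mean value theorem twice: in direction \<open>a\<close> for the difference of
  \<open>f\<close> along two parallel edges of the square, then in direction \<open>b\<close> for
  \<open>pd a f\<close>. The left side is symmetric in \<open>a\<close> and \<open>b\<close>, which
  is what the commutation of derivatives uses.\<close>

lemma second_difference_mvt:
  fixes f :: "point \<Rightarrow> real"
  assumes U: "open U" "smooth_in U f" and h: "0 < h"
    and box: "\<And>s t. 0 \<le> s \<Longrightarrow> s \<le> h \<Longrightarrow> 0 \<le> t \<Longrightarrow> t \<le> h \<Longrightarrow>
      x + s *\<^sub>R axis a 1 + t *\<^sub>R axis b 1 \<in> U"
  obtains s t where "0 < s" "s < h" "0 < t" "t < h"
    "f (x + h *\<^sub>R axis a 1 + h *\<^sub>R axis b 1) - f (x + h *\<^sub>R axis a 1) - f (x + h *\<^sub>R axis b 1) + f x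
       = h * h * pd b (pd a f) (x + s *\<^sub>R axis a 1 + t *\<^sub>R axis b 1)"
proof -
  let ?u = "axis a 1 :: point" and ?v = "axis b 1 :: point"
  have d: "f differentiable (at y)" if "y \<in> U" for y
    using smooth_in_differentiable [OF U that] .
  have d2: "pd a f differentiable (at y)" if "y \<in> U" for y
    using smooth_in_differentiable [OF U(1) smooth_in_pd [OF U(2)] that] .
  have "((\<lambda>s. f ((x + h *\<^sub>R ?v) + s *\<^sub>R ?u) - f (x + s *\<^sub>R ?u)) has_real_derivative
      (pd a f ((x + h *\<^sub>R ?v) + s *\<^sub>R ?u) - pd a f (x + s *\<^sub>R ?u))) (at s)" if "0 \<le> s" "s \<le> h" for s
    using box [of s 0] box [of s h] that h
    by (intro DERIV_diff has_real_derivative_pd_line d) (auto simp: ac_simps)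
  from MVT2 [OF h this] obtain s where s: "0 < s" "s < h" and
    1: "(f ((x + h *\<^sub>R ?v) + h *\<^sub>R ?u) - f (x + h *\<^sub>R ?u)) - (f (x + h *\<^sub>R ?v) - f x)
       = h * (pd a f ((x + h *\<^sub>R ?v) + s *\<^sub>R ?u) - pd a f (x + s *\<^sub>R ?u))"
    by auto
  have "((\<lambda>t. pd a f ((x + s *\<^sub>R ?u) + t *\<^sub>R ?v)) has_real_derivative
      pd b (pd a f) ((x + s *\<^sub>R ?u) + t *\<^sub>R ?v)) (at t)" if "0 \<le> t" "t \<le> h" for t
    using box [of s t] that s by (intro has_real_derivative_pd_line d2) auto
  from MVT2 [OF h this] obtain t where t: "0 < t" "t < h" and
    2: "pd a f ((x + s *\<^sub>R ?u) + h *\<^sub>R ?v) - pd a f (x + s *\<^sub>R ?u)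
      = h * pd b (pd a f) ((x + s *\<^sub>R ?u) + t *\<^sub>R ?v)"
    by auto
  have "(x + h *\<^sub>R ?v) + s *\<^sub>R ?u = (x + s *\<^sub>R ?u) + h *\<^sub>R ?v"
    "(x + h *\<^sub>R ?v) + h *\<^sub>R ?u = x + h *\<^sub>R ?u + h *\<^sub>R ?v" by (simp_all add: ac_simps)
  with 1 2 show ?thesis
    by (intro that [OF s t]) (simp add: algebra_simps)
qed

lemma pd_commute_real:
  fixes f :: "point \<Rightarrow> real"
  assumes U: "open U" "smooth_in U f" and x: "x \<in> U"
  shows "pd a (pd b f) x = pd b (pd a f) x"
proof (rule ccontr)
  assume "pd a (pd b f) x \<noteq> pd b (pd a f) x"
  define \<epsilon> where "\<epsilon> = \<bar>pd a (pd b f) x - pd b (pd a f) x\<bar> / 2"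
  have \<epsilon>: "\<epsilon> > 0" using \<open>_ \<noteq> _\<close> by (simp add: \<epsilon>_def)
  obtain r where r: "r > 0" "ball x r \<subseteq> U" using U(1) x openE by blast
  have near: "\<exists>d>0. \<forall>y\<in>U. dist y x < d \<longrightarrow> \<bar>pd i (pd j f) y - pd i (pd j f) x\<bar> < \<epsilon>" for i j
    using smooth_in_continuous_on [OF smooth_in_pd [OF smooth_in_pd [OF U(2)]]] x \<epsilon>
    unfolding continuous_on_iff dist_real_def by blast
  obtain d1 where d1: "d1 > 0" "\<And>y. y \<in> U \<Longrightarrow> dist y x < d1 \<Longrightarrow> \<bar>pd a (pd b f) y - pd a (pd b f) x\<bar> < \<epsilon>"
    using near [of a b] by auto
  obtain d2 where d2: "d2 > 0" "\<And>y. y \<in> U \<Longrightarrow> dist y x < d2 \<Longrightarrow> \<bar>pd b (pd a f) y - pd b (pd a f) x\<bar> < \<epsilon>"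
    using near [of b a] by auto
  \<comment> \<open>Every point of the square of side \<open>h\<close> lies within
    \<open>2 * h\<close> of \<open>x\<close>; a third of the smallest radius keeps that below all
    three.\<close>
  define h where "h = min r (min d1 d2) / 3"
  have h: "h > 0" "2 * h < r" "2 * h < d1" "2 * h < d2" using r d1 d2 by (auto simp: h_def)
  have dist: "dist (x + s *\<^sub>R axis i 1 + t *\<^sub>R axis j 1) x \<le> 2 * h"
    if "0 \<le> s" "s \<le> h" "0 \<le> t" "t \<le> h" for s t and i j :: 4
  proof -
    have "norm (s *\<^sub>R (axis i 1 :: point) + t *\<^sub>R axis j 1) \<le> s + t"
      using norm_triangle_ineq [of "s *\<^sub>R (axis i 1 :: point)" "t *\<^sub>R axis j 1"] that by simp
    with that show ?thesis by (simp add: dist_norm add.assoc)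
  qed
  have box: "x + s *\<^sub>R axis i 1 + t *\<^sub>R axis j 1 \<in> U"
    if "0 \<le> s" "s \<le> h" "0 \<le> t" "t \<le> h" for s t and i j :: 4
    using dist [OF that, of i j] h r(2) by (auto simp: dist_commute subset_iff)
  obtain s t where st: "0 < s" "s < h" "0 < t" "t < h" and
    1: "f (x + h *\<^sub>R axis a 1 + h *\<^sub>R axis b 1) - f (x + h *\<^sub>R axis a 1) - f (x + h *\<^sub>R axis b 1) + f x
       = h * h * pd b (pd a f) (x + s *\<^sub>R axis a 1 + t *\<^sub>R axis b 1)"
    using second_difference_mvt [OF U h(1), of x a b] box by metis
  obtain s' t' where st': "0 < s'" "s' < h" "0 < t'" "t' < h" and
    2: "f (x + h *\<^sub>R axis b 1 + h *\<^sub>R axis a 1) - f (x + h *\<^sub>R axis b 1) - f (x + h *\<^sub>R axis a 1) + f x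
       = h * h * pd a (pd b f) (x + s' *\<^sub>R axis b 1 + t' *\<^sub>R axis a 1)"
    using second_difference_mvt [OF U h(1), of x b a] box by metis
  have "h * h * pd b (pd a f) (x + s *\<^sub>R axis a 1 + t *\<^sub>R axis b 1)
      = h * h * pd a (pd b f) (x + s' *\<^sub>R axis b 1 + t' *\<^sub>R axis a 1)"
    using 1 2 by (simp add: algebra_simps)
  then have "pd b (pd a f) (x + s *\<^sub>R axis a 1 + t *\<^sub>R axis b 1)
      = pd a (pd b f) (x + s' *\<^sub>R axis b 1 + t' *\<^sub>R axis a 1)"
    using h(1) by simp
  moreover have "\<bar>pd b (pd a f) (x + s *\<^sub>R axis a 1 + t *\<^sub>R axis b 1) - pd b (pd a f) x\<bar> < \<epsilon>"
    using st h dist [of s t a b] by (intro d2 box) auto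
  moreover have "\<bar>pd a (pd b f) (x + s' *\<^sub>R axis b 1 + t' *\<^sub>R axis a 1) - pd a (pd b f) x\<bar> < \<epsilon>"
    using st' h dist [of s' t' b a] by (intro d1 box) auto
  moreover have "2 * \<epsilon> = \<bar>pd a (pd b f) x - pd b (pd a f) x\<bar>" by (simp add: \<epsilon>_def)
  ultimately show False by linarith
qed

lemma pd_commute:
  fixes f :: "point \<Rightarrow> real^'n"
  assumes U: "open U" "smooth_in U f" and x: "x \<in> U"
  shows "pd a (pd b f) x = pd b (pd a f) x"
proof -
  have nth: "pd i (pd j f) x $ k = pd i (pd j (\<lambda>y. f y $ k)) x" for i j k
  proof -
    have "pd i (pd j f) x $ k = pd i (\<lambda>y. pd j f y $ k) x"
      using smooth_in_differentiable [OF U(1) smooth_in_pd [OF U(2)] x] by (simp add: pd_nth)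
    also have "\<dots> = pd i (pd j (\<lambda>y. f y $ k)) x"
      using smooth_in_differentiable [OF U]
      by (intro pd_cong [OF U(1) x]) (simp add: pd_nth)
    finally show ?thesis .
  qed
  show ?thesis
    using pd_commute_real [OF U(1) smooth_in_nth [OF U] x]
    by (simp add: vec_eq_iff nth)
qed

section \<open>Rank-two tensors as bilinear forms\<close>

definition bil :: "real^'n^'n \<Rightarrow> real^'n \<Rightarrow> real^'n \<Rightarrow> real" where
  "bil T X Y = X \<bullet> (T *v Y)"

lemma bil_linear [simp]:
  "bil T (X + X') Y = bil T X Y + bil T X' Y"
  "bil T (X - X') Y = bil T X Y - bil T X' Y"
  "bil T (c *\<^sub>R X) Y = c * bil T X Y"
  "bil T (- X) Y = - bil T X Y"
  "bil T 0 Y = 0"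
  "bil T X (Y + Y') = bil T X Y + bil T X Y'"
  "bil T X (Y - Y') = bil T X Y - bil T X Y'"
  "bil T X (c *\<^sub>R Y) = c * bil T X Y"
  "bil T X (- Y) = - bil T X Y"
  "bil T X 0 = 0"
  "bil (T + S) X Y = bil T X Y + bil S X Y"
  "bil (T - S) X Y = bil T X Y - bil S X Y"
  "bil (c *\<^sub>R T) X Y = c * bil T X Y"
  "bil (- T) X Y = - bil T X Y"
  "bil 0 X Y = 0"
proof -
  have "(- T) *v Y = - (T *v Y)" "T *v (- Y) = - (T *v Y)"
    by (simp_all add: matrix_vector_mult_def vec_eq_iff sum_negf)
  then show "bil (- T) X Y = - bil T X Y" "bil T X (- Y) = - bil T X Y" by (simp_all add: bil_def)
qed (auto simp: bil_def inner_left_distrib inner_right_distrib inner_diff_left inner_diff_right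
   matrix_vector_right_distrib matrix_vector_mult_add_rdistrib matrix_vector_mult_diff_distrib
   matrix_vector_mult_diff_rdistrib matrix_vector_mult_scaleR scaleR_matrix_vector_assoc [symmetric])

lemma bil_eq_sum: "bil T X Y = (\<Sum>a\<in>UNIV. \<Sum>b\<in>UNIV. T $ a $ b * X $ a * Y $ b)"
  by (simp add: bil_def inner_vec_def matrix_vector_mult_def sum_distrib_left mult_ac)

lemma bil_axis [simp]: "bil T (axis a 1) (axis b 1) = T $ a $ b"
  by (simp add: bil_def inner_axis' matrix_vector_mul_component inner_axis)

lemma bil_transpose: "bil (transpose T) X Y = bil T Y X"
  unfolding bil_eq_sum transpose_def by (subst sum.swap) (simp add: mult_ac)

lemma bil_mult_sum:
  "bil T X Z * bil S Y W = (\<Sum>a\<in>UNIV. \<Sum>b\<in>UNIV. \<Sum>c\<in>UNIV. \<Sum>d\<in>UNIV.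
     (T $ a $ c * S $ b $ d) * X $ a * Y $ b * Z $ c * W $ d)"
  unfolding bil_eq_sum sum_product by (simp add: mult_ac)

lemma bil_mult_sum':
  "bil T X W * bil S Y Z = (\<Sum>a\<in>UNIV. \<Sum>b\<in>UNIV. \<Sum>c\<in>UNIV. \<Sum>d\<in>UNIV.
     (T $ a $ d * S $ b $ c) * X $ a * Y $ b * Z $ c * W $ d)"
  unfolding bil_eq_sum sum_product
  by (intro sum.cong refl, subst sum.swap) (simp add: mult_ac)

lemma matrix_eq_bil: "T = S \<longleftrightarrow> (\<forall>X Y. bil T X Y = bil S X Y)"
  by (metis bil_axis vec_eq_iff)

lemma matrix_inv_eqI:
  assumes "A ** B = mat 1" "B ** A = mat 1"
  shows "matrix_inv A = B"
proof -
  have "A ** matrix_inv A = mat 1 \<and> matrix_inv A ** A = mat 1"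
    unfolding matrix_inv_def by (rule someI [of _ B]) (simp add: assms)
  then have "matrix_inv A = (B ** A) ** matrix_inv A" "B ** (A ** matrix_inv A) = B"
    by (simp_all add: assms)
  then show ?thesis by (simp add: matrix_mul_assoc)
qed

section \<open>Null frames\<close>

text \<open>Two totally null planes in duality: \<open>bil h\<close> pairs \<open>v\<close>, with
  index A, and \<open>w\<close>, with index B, to \<open>eps A B\<close>. Such a frame comes from a
  pair of primed spinors with symplectic product one, and both the given spin frame and the frame
  adapted to \<iota> have this form.\<close>

definition null_frame :: "real^4^4 \<Rightarrow> real^4 \<Rightarrow> real^4 \<Rightarrow> real^4 \<Rightarrow> real^4 \<Rightarrow> bool" where
  "null_frame h v0 v1 w0 w1 \<longleftrightarrow> transpose h = h \<and>
     bil h v0 v0 = 0 \<and> bil h v0 v1 = 0 \<and> bil h v1 v1 = 0 \<and>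
     bil h w0 w0 = 0 \<and> bil h w0 w1 = 0 \<and> bil h w1 w1 = 0 \<and>
     bil h v0 w0 = 0 \<and> bil h v0 w1 = 1 \<and> bil h v1 w0 = -1 \<and> bil h v1 w1 = 0"

lemma bil_sym: "transpose h = h \<Longrightarrow> bil h X Y = bil h Y X"
  by (metis bil_transpose)

lemma null_frame_bil:
  assumes "null_frame h v0 v1 w0 w1"
  shows "bil h v0 v0 = 0" "bil h v0 v1 = 0" "bil h v1 v0 = 0" "bil h v1 v1 = 0"
    "bil h w0 w0 = 0" "bil h w0 w1 = 0" "bil h w1 w0 = 0" "bil h w1 w1 = 0"
    "bil h v0 w0 = 0" "bil h w0 v0 = 0" "bil h v0 w1 = 1" "bil h w1 v0 = 1"
    "bil h v1 w0 = -1" "bil h w0 v1 = -1" "bil h v1 w1 = 0" "bil h w1 v1 = 0"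
  using assms bil_sym [of h] by (auto simp: null_frame_def)

lemma null_frame_left_inverse:
  assumes "null_frame h v0 v1 w0 w1"
  defines "P \<equiv> (\<chi> a b. v0 $ a * w1 $ b + w1 $ a * v0 $ b - v1 $ a * w0 $ b - w0 $ a * v1 $ b)"
  shows "P ** h = mat 1"
proof -
  define R :: "real^4^4" where
    "R = (\<chi> i. if i = 1 then v0 else if i = 2 then v1 else if i = 3 then w0 else w1)"
  \<comment> \<open>\<open>J\<close> is the Gram matrix of the frame in the order of the rows of
    \<open>R\<close>, and it is its own inverse.\<close>
  define J :: "real^4^4" where
    "J = (\<chi> i j. if i = 1 \<and> j = 4 \<or> i = 4 \<and> j = 1 then 1
                else if i = 2 \<and> j = 3 \<or> i = 3 \<and> j = 2 then -1 else 0)"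
  have R: "R $ 1 = v0" "R $ 2 = v1" "R $ 3 = w0" "R $ 4 = w1"
    by (simp_all add: R_def)
  have entry: "(R ** h ** transpose R) $ i $ j = bil h (R $ i) (R $ j)" for i j
    unfolding bil_eq_sum
    by (subst sum.swap)
      (simp add: matrix_matrix_mult_def transpose_def sum_distrib_left sum_distrib_right mult_ac)
  have "(J ** M) $ 1 = M $ 4" "(J ** M) $ 2 = - M $ 3" "(J ** M) $ 3 = - M $ 2" "(J ** M) $ 4 = M $ 1"
    for M :: "real^4^4"
    by (simp_all add: vec_eq_iff matrix_matrix_mult_def sum_4 J_def)
  then have "J ** (R ** h ** transpose R) = mat 1"
    by (simp add: vec_eq_iff [where x = "J ** _"] vec_eq_iff forall_4 entry R
        null_frame_bil [OF assms(1)] mat_def)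
  then have "(J ** R ** h) ** transpose R = mat 1"
    by (simp add: matrix_mul_assoc)
  then have "transpose R ** (J ** R ** h) = mat 1"
    by (simp add: matrix_left_right_inverse)
  moreover have "transpose R ** (J ** R) = P"
    by (simp add: vec_eq_iff matrix_matrix_mult_def sum_4 J_def R P_def transpose_def algebra_simps)
  ultimately show ?thesis by (metis matrix_mul_assoc)
qed

lemma null_frame_expand:
  assumes "null_frame h v0 v1 w0 w1"
  shows "X = bil h X w1 *\<^sub>R v0 - bil h X w0 *\<^sub>R v1 - bil h X v1 *\<^sub>R w0 + bil h X v0 *\<^sub>R w1"
proof -
  let ?P = "\<chi> a b. v0 $ a * w1 $ b + w1 $ a * v0 $ b - v1 $ a * w0 $ b - w0 $ a * v1 $ b"
  have s: "bil h X Y = Y \<bullet> (h *v X)" for Y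
    using assms bil_sym [of h X Y] by (simp add: null_frame_def bil_def)
  have P: "?P *v Z = (w1 \<bullet> Z) *\<^sub>R v0 - (w0 \<bullet> Z) *\<^sub>R v1 - (v1 \<bullet> Z) *\<^sub>R w0 + (v0 \<bullet> Z) *\<^sub>R w1" for Z
    by (simp add: vec_eq_iff matrix_vector_mult_def inner_vec_def sum_4 algebra_simps)
  have "X = ?P *v (h *v X)"
    using null_frame_left_inverse [OF assms] by (simp add: matrix_vector_mul_assoc)
  then show ?thesis unfolding s P .
qed

lemma null_frame_matrix_inv:
  assumes "null_frame h v0 v1 w0 w1"
  shows "invertible h"
    "matrix_inv h $ a $ b = v0 $ a * w1 $ b + w1 $ a * v0 $ b - v1 $ a * w0 $ b - w0 $ a * v1 $ b"
proof -
  let ?P = "\<chi> a b. v0 $ a * w1 $ b + w1 $ a * v0 $ b - v1 $ a * w0 $ b - w0 $ a * v1 $ b"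
  have P: "?P ** h = mat 1" "h ** ?P = mat 1"
    using null_frame_left_inverse [OF assms] matrix_left_right_inverse by auto
  then show "invertible h" unfolding invertible_def by blast
  have "matrix_inv h = ?P" using matrix_inv_eqI [OF P(2,1)] .
  then show "matrix_inv h $ a $ b = v0 $ a * w1 $ b + w1 $ a * v0 $ b - v1 $ a * w0 $ b - w0 $ a * v1 $ b"
    by simp
qed

lemma bil_null_frame_expand:
  assumes "null_frame h v0 v1 w0 w1"
  shows "bil h X Y = bil h X w1 * bil h v0 Y - bil h X w0 * bil h v1 Y
    - bil h X v1 * bil h w0 Y + bil h X v0 * bil h w1 Y"
  by (subst null_frame_expand [OF assms, of X]) simp

lemma matrix_eq_on_null_frame:
  assumes "null_frame h v0 v1 w0 w1"
    and "\<And>X Y. X \<in> {v0, v1, w0, w1} \<Longrightarrow> Y \<in> {v0, v1, w0, w1} \<Longrightarrow> bil T X Y = bil S X Y"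
  shows "T = S"
  unfolding matrix_eq_bil
proof (intro allI)
  fix X Y
  have "bil T X Z = bil S X Z" if "Z \<in> {v0, v1, w0, w1}" for Z
    using assms(2) that
    by (subst (1 2) null_frame_expand [OF assms(1), of X]) simp
  then show "bil T X Y = bil S X Y"
    by (subst (1 2) null_frame_expand [OF assms(1), of Y]) simp
qed

text \<open>All metric traces below (scalar curvature, stress-energy, divergence, trace of the
  curvature endomorphism) are evaluated through this formula.\<close>

lemma sum_ginv_null_frame:
  assumes "null_frame h v0 v1 w0 w1"
  shows "(\<Sum>a\<in>UNIV. \<Sum>b\<in>UNIV. matrix_inv h $ a $ b * T $ a $ b)
    = bil T v0 w1 + bil T w1 v0 - bil T v1 w0 - bil T w0 v1"
  unfolding null_frame_matrix_inv [OF assms] bil_eq_sum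
  by (simp add: sum.distrib sum_subtractf algebra_simps)

section \<open>The Levi-Civita connection\<close>

locale spin_space =
  fixes U :: "point set" and g :: tensor2 and e :: spin_frame
  assumes U: "open U" and metric: "neutral_metric U g" and frame: "is_spin_frame U g e"
begin

lemma smooth_g: "smooth_in U g" and smooth_e: "smooth_in U e"
  using metric frame by (auto simp: neutral_metric_def is_spin_frame_def smooth_field_iff)

text \<open>Off \<open>U\<close> this is the normalisation \<open>g x = 0\<close>. Symmetry at every
  point lets mirrored components be exchanged as functions, hence under \<open>pd\<close>.\<close>

lemma transpose_g: "transpose (g x) = g x"
proof (cases "x \<in> U")
  case False
  then have "g x = 0" using metric by (auto simp: neutral_metric_def smooth_field_iff)
  then show ?thesis by (simp add: transpose_def vec_eq_iff)
qed (use metric in \<open>auto simp: neutral_metric_def\<close>)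

lemma g_sym: "g x $ a $ b = g x $ b $ a"
  using arg_cong [OF transpose_g [of x], of "\<lambda>h. h $ b $ a"] by (simp add: transpose_def)

lemma bil_g_sym: "bil (g x) X Y = bil (g x) Y X"
  using bil_sym [OF transpose_g] .

lemma bil_frame:
  "x \<in> U \<Longrightarrow> bil (g x) (e x $ A $ A') (e x $ B $ B') = eps A B * eps A' B'"
  using frame by (simp add: bil_def is_spin_frame_def)

lemma null_frame_e:
  "x \<in> U \<Longrightarrow> null_frame (g x) (e x $ 0 $ 0) (e x $ 1 $ 0) (e x $ 0 $ 1) (e x $ 1 $ 1)"
  by (simp add: null_frame_def transpose_g bil_frame eps_def)

lemma differentiable_in: "smooth_in U f \<Longrightarrow> x \<in> U \<Longrightarrow> f differentiable (at x)"
  by (rule smooth_in_differentiable [OF U])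

lemmas smooth_rules = smooth_in_const smooth_in_pd smooth_in_open_intros [OF U]

text \<open>In the spin frame the inverse metric is a quadratic polynomial in the frame components,
  so no determinant has to be divided by.\<close>

lemma smooth_ginv: "smooth_in U (\<lambda>y. ginv g y $ a $ b)"
proof -
  have "smooth_in U (\<lambda>y. e y $ 0 $ 0 $ a * e y $ 1 $ 1 $ b + e y $ 1 $ 1 $ a * e y $ 0 $ 0 $ b
     - e y $ 1 $ 0 $ a * e y $ 0 $ 1 $ b - e y $ 0 $ 1 $ a * e y $ 1 $ 0 $ b)"
    by (intro smooth_rules smooth_e)
  then show ?thesis
    using smooth_in_cong [OF U] null_frame_matrix_inv(2) [OF null_frame_e]
    by (smt (verit) ginv_def)
qed

definition Gam :: "4 \<Rightarrow> point \<Rightarrow> real^4^4" where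
  "Gam a x = (\<chi> c b. christoffel g x c a b)"

definition cov :: "4 \<Rightarrow> (point \<Rightarrow> real^4) \<Rightarrow> point \<Rightarrow> real^4" where
  "cov a V x = pd a V x + Gam a x *v V x"

definition nabla_matrix :: "4 \<Rightarrow> tensor2 \<Rightarrow> point \<Rightarrow> real^4^4" where
  "nabla_matrix a T x = (\<chi> b c. nabla_tensor2 g T x a b c)"

definition riemann_matrix :: "4 \<Rightarrow> 4 \<Rightarrow> point \<Rightarrow> real^4^4" where
  "riemann_matrix a b x = (\<chi> d c. riemann g x a b c d)"

lemma christoffel_sym: "christoffel g x c a b = christoffel g x c b a"
  unfolding christoffel_def by (subst (4) g_sym) (simp add: algebra_simps)

lemma smooth_christoffel: "smooth_in U (\<lambda>y. christoffel g y c a b)"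
proof -
  have "smooth_in U (\<lambda>y. (1/2) * (\<Sum>d\<in>UNIV. ginv g y $ c $ d *
     (pd a (\<lambda>y. g y $ b $ d) y + pd b (\<lambda>y. g y $ a $ d) y - pd d (\<lambda>y. g y $ a $ b) y)))"
    by (intro smooth_rules smooth_ginv smooth_g)
  then show ?thesis by (simp add: christoffel_def)
qed

lemma smooth_Gam: "smooth_in U (Gam a)"
  unfolding Gam_def [abs_def] by (intro smooth_rules smooth_christoffel)

lemma smooth_cov: "smooth_in U V \<Longrightarrow> smooth_in U (cov a V)"
  unfolding cov_def [abs_def] by (intro smooth_rules smooth_Gam)

lemma nabla_vector_cov:
  "V differentiable (at x) \<Longrightarrow> nabla_vector g V x a c = cov a V x $ c"
  by (simp add: nabla_vector_def cov_def Gam_def pd_nth matrix_vector_mult_def)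

text \<open>The Christoffel symbols of the first kind. Lowering the index cancels
  \<open>ginv\<close>, and two such symbols add up to a derivative of \<open>g\<close>, which is
  metricity.\<close>

lemma g_Gam:
  assumes "x \<in> U"
  shows "(g x ** Gam a x) $ f $ b = (1/2) * (pd a (\<lambda>y. g y $ b $ f) x + pd b (\<lambda>y. g y $ a $ f) x
     - pd f (\<lambda>y. g y $ a $ b) x)"
proof -
  define k where "k d = pd a (\<lambda>y. g y $ b $ d) x + pd b (\<lambda>y. g y $ a $ d) x - pd d (\<lambda>y. g y $ a $ b) x" for d
  have "g x ** ginv g x = mat 1"
    using null_frame_matrix_inv(1) [OF null_frame_e [OF assms]] matrix_inv_eqI
    unfolding ginv_def invertible_def by metis
  then have inv: "(\<Sum>c\<in>UNIV. g x $ f $ c * ginv g x $ c $ d) = (if f = d then 1 else 0)" for d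
    by (simp add: vec_eq_iff matrix_matrix_mult_def mat_def)
  have "(g x ** Gam a x) $ f $ b = (\<Sum>c\<in>UNIV. g x $ f $ c * ((1/2) * (\<Sum>d\<in>UNIV. ginv g x $ c $ d * k d)))"
    by (simp add: matrix_matrix_mult_def Gam_def christoffel_def k_def)
  also have "\<dots> = (\<Sum>c\<in>UNIV. \<Sum>d\<in>UNIV. (1/2) * (g x $ f $ c * ginv g x $ c $ d) * k d)"
    by (simp add: sum_distrib_left mult_ac)
  also have "\<dots> = (\<Sum>d\<in>UNIV. \<Sum>c\<in>UNIV. (1/2) * (g x $ f $ c * ginv g x $ c $ d) * k d)"
    by (rule sum.swap)
  also have "\<dots> = (\<Sum>d\<in>UNIV. (1/2) * (\<Sum>c\<in>UNIV. g x $ f $ c * ginv g x $ c $ d) * k d)"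
    by (simp add: sum_distrib_left sum_distrib_right mult_ac)
  also have "\<dots> = (\<Sum>d\<in>UNIV. if f = d then (1/2) * k d else 0)"
    by (intro sum.cong) (simp_all add: inv)
  also have "\<dots> = (1/2) * k f" by simp
  finally show ?thesis by (simp add: k_def)
qed

lemma nabla_matrix_eq:
  assumes "T differentiable (at x)"
  shows "nabla_matrix a T x = pd a T x - transpose (Gam a x) ** T x - T x ** Gam a x"
  using assms differentiable_nth [OF assms]
  by (simp add: nabla_matrix_def vec_eq_iff nabla_tensor2_def matrix_matrix_mult_def transpose_def Gam_def
      pd_nth mult.commute)

lemma bil_transpose_mult: "bil (transpose A ** T) X Y = bil T (A *v X) Y"
  using dot_lmul_matrix [of X "transpose A" "T *v Y"]
  by (simp add: bil_def matrix_vector_mul_assoc vector_transpose_matrix)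

lemma bil_mult: "bil (T ** A) X Y = bil T X (A *v Y)"
  by (simp add: bil_def matrix_vector_mul_assoc)

lemma pd_bil:
  assumes "T differentiable (at x)" "X differentiable (at x)" "Y differentiable (at x)"
  shows "pd a (\<lambda>y. bil (T y) (X y) (Y y)) x
    = bil (nabla_matrix a T x) (X x) (Y x) + bil (T x) (cov a X x) (Y x) + bil (T x) (X x) (cov a Y x)"
proof -
  have d: "(\<lambda>y. T y *v Y y) differentiable (at x)"
    using assms by (intro differentiable_bilinear [OF bounded_bilinear_matrix_vector])
  have "pd a (\<lambda>y. bil (T y) (X y) (Y y)) x
     = pd a X x \<bullet> (T x *v Y x) + X x \<bullet> pd a (\<lambda>y. T y *v Y y) x"
    unfolding bil_def by (rule pd_bilinear [OF bounded_bilinear_inner assms(2) d])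
  also have "pd a (\<lambda>y. T y *v Y y) x = pd a T x *v Y x + T x *v pd a Y x"
    by (rule pd_bilinear [OF bounded_bilinear_matrix_vector assms(1,3)])
  finally have "pd a (\<lambda>y. bil (T y) (X y) (Y y)) x
     = bil (pd a T x) (X x) (Y x) + bil (T x) (pd a X x) (Y x) + bil (T x) (X x) (pd a Y x)"
    by (simp add: bil_def inner_right_distrib)
  then show ?thesis
    by (simp add: nabla_matrix_eq [OF assms(1)] cov_def bil_transpose_mult bil_mult [of "T x"])
qed

lemma nabla_matrix_g:
  assumes "x \<in> U"
  shows "nabla_matrix a g x = 0"
proof -
  have d: "g differentiable (at x)" using differentiable_in [OF smooth_g assms] .
  have "(transpose (Gam a x) ** g x) $ b $ c = (g x ** Gam a x) $ c $ b" for b c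
    using g_sym by (simp add: matrix_matrix_mult_def transpose_def mult.commute)
  then have "nabla_matrix a g x $ b $ c = pd a g x $ b $ c - (g x ** Gam a x) $ c $ b - (g x ** Gam a x) $ b $ c" for b c
    by (simp add: nabla_matrix_eq [OF d])
  moreover have "pd i g x $ b $ c = pd i (\<lambda>y. g y $ b $ c) x" for i b c
    using differentiable_nth [OF d] by (simp add: pd_nth d)
  moreover have "pd i (\<lambda>y. g y $ b $ c) x = pd i (\<lambda>y. g y $ c $ b) x" for i b c
    using ext [where f = "\<lambda>y. g y $ b $ c" and g = "\<lambda>y. g y $ c $ b", OF g_sym] by simp
  ultimately show ?thesis
    by (simp add: vec_eq_iff g_Gam [OF assms] add_divide_distrib diff_divide_distrib)
qed

lemma pd_g:
  assumes "x \<in> U" "X differentiable (at x)" "Y differentiable (at x)"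
  shows "pd a (\<lambda>y. bil (g y) (X y) (Y y)) x
    = bil (g x) (cov a X x) (Y x) + bil (g x) (X x) (cov a Y x)"
  using pd_bil [OF differentiable_in [OF smooth_g assms(1)] assms(2,3)]
  by (simp add: nabla_matrix_g [OF assms(1)])

lemma cov_add:
  "V differentiable (at x) \<Longrightarrow> W differentiable (at x) \<Longrightarrow> cov a (\<lambda>y. V y + W y) x = cov a V x + cov a W x"
  by (simp add: cov_def pd_add matrix_vector_right_distrib)

lemma cov_scaleR:
  "f differentiable (at x) \<Longrightarrow> V differentiable (at x) \<Longrightarrow>
    cov a (\<lambda>y. f y *\<^sub>R V y) x = pd a f x *\<^sub>R V x + f x *\<^sub>R cov a V x"
  by (simp add: cov_def pd_scaleR matrix_vector_mult_scaleR algebra_simps)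

text \<open>The index of \<open>cov b V\<close> is a mere label, so no Christoffel term corrects it.
  Coordinate fields commute, and what is left is the curvature matrix
  \<open>pd a (Gam b) - pd b (Gam a)\<close> plus the commutator of \<open>Gam a\<close> and
  \<open>Gam b\<close>.\<close>

lemma ricci_identity:
  assumes "x \<in> U" "smooth_in U V"
  shows "cov a (cov b V) x - cov b (cov a V) x = riemann_matrix a b x *v V x"
proof -
  have dG: "Gam a differentiable (at x)" and dV: "V differentiable (at x)"
    and dP: "pd a V differentiable (at x)" for a
    using differentiable_in assms smooth_Gam smooth_in_pd by blast+
  have DD: "cov a (cov b V) x = pd a (pd b V) x + pd a (Gam b) x *v V x + Gam b x *v pd a V x
     + Gam a x *v pd b V x + Gam a x ** Gam b x *v V x" for a b
  proof -
    have "pd a (\<lambda>y. pd b V y + Gam b y *v V y) x = pd a (pd b V) x + (pd a (Gam b) x *v V x + Gam b x *v pd a V x)"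
      using pd_add [OF dP differentiable_bilinear [OF bounded_bilinear_matrix_vector dG dV]]
        pd_bilinear [OF bounded_bilinear_matrix_vector dG dV] by simp
    then show ?thesis
      by (simp add: cov_def [abs_def] matrix_vector_right_distrib matrix_vector_mul_assoc)
  qed
  have "riemann_matrix a b x = pd a (Gam b) x - pd b (Gam a) x + Gam a x ** Gam b x - Gam b x ** Gam a x"
  proof -
    have "pd a (\<lambda>y. christoffel g y d b c) x = pd a (Gam b) x $ d $ c" for a b c d
      using pd_nth [OF dG, of a b d] pd_nth [OF differentiable_nth [OF dG], of a b d c]
      by (simp add: Gam_def)
    then show ?thesis
      by (simp add: riemann_matrix_def riemann_def vec_eq_iff matrix_matrix_mult_def Gam_def sum_subtractf)
  qed
  then show ?thesis
    using pd_commute [OF U assms(2,1), of a b]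
    by (simp add: DD matrix_vector_mult_add_rdistrib matrix_vector_mult_diff_rdistrib)
qed

end

section \<open>Anti-self-dual curvature\<close>

lemma UNIV_two: "(UNIV :: 2 set) = {0, 1}"
proof -
  have "(2::2) = 0" by simp
  then show ?thesis using UNIV_2 by auto
qed

lemma sum_two: "sum f (UNIV :: 2 set) = f 0 + f 1"
  by (simp add: UNIV_two)

lemma forall_two: "(\<forall>i::2. P i) \<longleftrightarrow> P 0 \<and> P 1"
  using UNIV_two by (metis UNIV_I insertE singletonD)

lemma eps_simps [simp]: "eps 0 0 = 0" "eps 0 1 = 1" "eps 1 0 = -1" "eps 1 1 = 0"
  by (simp_all add: eps_def)

lemma sum4_linear:
  fixes X Y Z W :: "real^'n"
  defines "Q \<equiv> \<lambda>T X Y Z W. (\<Sum>a\<in>UNIV. \<Sum>b\<in>UNIV. \<Sum>c\<in>UNIV. \<Sum>d\<in>UNIV.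
     T a b c d * X $ a * Y $ b * Z $ c * W $ (d::'n))"
  shows "Q T (X + X') Y Z W = Q T X Y Z W + Q T X' Y Z W"
    "Q T (k *\<^sub>R X) Y Z W = k * Q T X Y Z W"
    "Q T X (Y + Y') Z W = Q T X Y Z W + Q T X Y' Z W"
    "Q T X (k *\<^sub>R Y) Z W = k * Q T X Y Z W"
    "Q T X Y (Z + Z') W = Q T X Y Z W + Q T X Y Z' W"
    "Q T X Y (k *\<^sub>R Z) W = k * Q T X Y Z W"
    "Q T X Y Z (W + W') = Q T X Y Z W + Q T X Y Z W'"
    "Q T X Y Z (k *\<^sub>R W) = k * Q T X Y Z W"
  unfolding Q_def by (simp_all add: sum.distrib sum_distrib_left algebra_simps)

lemma sum_axis_mult: "(\<Sum>i\<in>UNIV. axis a (1::real) $ i * f i) = f a"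
proof -
  have "(\<Sum>i\<in>UNIV. axis a (1::real) $ i * f i) = (\<Sum>i\<in>UNIV. if a = i then f i else 0)"
    by (intro sum.cong) (simp_all add: axis_def)
  then show ?thesis by simp
qed

context spin_space
begin

lemma smooth_bil:
  "smooth_in U T \<Longrightarrow> smooth_in U X \<Longrightarrow> smooth_in U Y \<Longrightarrow> smooth_in U (\<lambda>y. bil (T y) (X y) (Y y))"
  unfolding bil_def by (intro smooth_rules)

section \<open>Curvature as a multilinear form on vectors\<close>

definition riemann_form :: "point \<Rightarrow> real^4 \<Rightarrow> real^4 \<Rightarrow> real^4 \<Rightarrow> real^4 \<Rightarrow> real" where
  "riemann_form x X Y Z W = (\<Sum>a\<in>UNIV. \<Sum>b\<in>UNIV. X $ a * Y $ b * bil (g x) (riemann_matrix a b x *v Z) W)"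

definition weyl_form :: "point \<Rightarrow> real^4 \<Rightarrow> real^4 \<Rightarrow> real^4 \<Rightarrow> real^4 \<Rightarrow> real" where
  "weyl_form x X Y Z W = (\<Sum>a\<in>UNIV. \<Sum>b\<in>UNIV. \<Sum>c\<in>UNIV. \<Sum>d\<in>UNIV.
     weyl g x a b c d * X $ a * Y $ b * Z $ c * W $ d)"

lemma weyl_form_linear [simp]:
  "weyl_form x (X + X') Y Z W = weyl_form x X Y Z W + weyl_form x X' Y Z W"
  "weyl_form x (k *\<^sub>R X) Y Z W = k * weyl_form x X Y Z W"
  "weyl_form x X (Y + Y') Z W = weyl_form x X Y Z W + weyl_form x X Y' Z W"
  "weyl_form x X (k *\<^sub>R Y) Z W = k * weyl_form x X Y Z W"
  "weyl_form x X Y (Z + Z') W = weyl_form x X Y Z W + weyl_form x X Y Z' W"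
  "weyl_form x X Y (k *\<^sub>R Z) W = k * weyl_form x X Y Z W"
  "weyl_form x X Y Z (W + W') = weyl_form x X Y Z W + weyl_form x X Y Z W'"
  "weyl_form x X Y Z (k *\<^sub>R W) = k * weyl_form x X Y Z W"
  unfolding weyl_form_def by (rule sum4_linear)+

lemma weyl_form_diff [simp]:
  "weyl_form x (X - X') Y Z W = weyl_form x X Y Z W - weyl_form x X' Y Z W"
  "weyl_form x X (Y - Y') Z W = weyl_form x X Y Z W - weyl_form x X Y' Z W"
  using weyl_form_linear(1) [of x X "-1 *\<^sub>R X'" Y Z W] weyl_form_linear(3) [of x X Y "-1 *\<^sub>R Y'" Z W]
    weyl_form_linear(2) [of x "-1"  X' Y Z W] weyl_form_linear(4) [of x X "-1" Y' Z W]
  by simp_all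

lemma riemann_form_eq_riemann_low:
  "riemann_form x X Y Z W = (\<Sum>a\<in>UNIV. \<Sum>b\<in>UNIV. \<Sum>c\<in>UNIV. \<Sum>d\<in>UNIV.
     riemann_low g x a b c d * X $ a * Y $ b * Z $ c * W $ d)"
proof -
  have "bil (g x) (riemann_matrix a b x *v Z) W = (\<Sum>c\<in>UNIV. \<Sum>d\<in>UNIV. riemann_low g x a b c d * Z $ c * W $ d)" for a b
  proof -
    have "bil (g x) (riemann_matrix a b x *v Z) W
        = (\<Sum>p\<in>UNIV. \<Sum>d\<in>UNIV. \<Sum>c\<in>UNIV. riemann g x a b c p * g x $ p $ d * Z $ c * W $ d)"
      by (simp add: bil_eq_sum matrix_vector_mult_def riemann_matrix_def sum_distrib_left sum_distrib_right mult_ac)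
    also have "\<dots> = (\<Sum>d\<in>UNIV. \<Sum>p\<in>UNIV. \<Sum>c\<in>UNIV. riemann g x a b c p * g x $ p $ d * Z $ c * W $ d)"
      by (rule sum.swap)
    also have "\<dots> = (\<Sum>d\<in>UNIV. \<Sum>c\<in>UNIV. \<Sum>p\<in>UNIV. riemann g x a b c p * g x $ p $ d * Z $ c * W $ d)"
      by (intro sum.cong refl sum.swap)
    also have "\<dots> = (\<Sum>c\<in>UNIV. \<Sum>d\<in>UNIV. \<Sum>p\<in>UNIV. riemann g x a b c p * g x $ p $ d * Z $ c * W $ d)"
      by (rule sum.swap)
    finally show ?thesis by (simp add: riemann_low_def sum_distrib_right)
  qed
  then show ?thesis by (simp add: riemann_form_def sum_distrib_left mult_ac)
qed

lemma weyl_form_eq: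
  "weyl_form x X Y Z W = riemann_form x X Y Z W
     - (1/2) * (bil (g x) X Z * bil (ricci g x) Y W - bil (g x) X W * bil (ricci g x) Y Z
              - bil (ricci g x) X W * bil (g x) Y Z + bil (ricci g x) X Z * bil (g x) Y W)
     + (1/6) * scalar_curv g x * (bil (g x) X Z * bil (g x) Y W - bil (g x) X W * bil (g x) Y Z)"
  unfolding weyl_form_def riemann_form_eq_riemann_low bil_mult_sum [of _ X Z _ Y W] bil_mult_sum' [of _ X W _ Y Z] weyl_def
  by (simp add: sum_distrib_left sum.distrib sum_subtractf algebra_simps)

lemma riemann_antisym: "riemann g x a b c d = - riemann g x b a c d"
  by (simp add: riemann_def sum_subtractf)

lemma riemann_bianchi:
  "riemann g x a b c d + riemann g x b c a d + riemann g x c a b d = 0"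
  unfolding riemann_def
  by (simp add: christoffel_sym [of _ _ b a] christoffel_sym [of _ _ c a] christoffel_sym [of _ _ c b]
      sum_subtractf)

lemma asd_weyl_form_frame:
  assumes "asd_metric U g e" "x \<in> U"
  obtains \<Psi> where "tot_sym \<Psi>"
    "\<And>A A' B B' C C' D D'. weyl_form x (e x $ A $ A') (e x $ B $ B') (e x $ C $ C') (e x $ D $ D')
       = eps A' B' * eps C' D' * \<Psi> A B C D"
  using assms by (force simp: asd_metric_def weyl_spinors_def weyl_form_def)

text \<open>The contraction \<open>e\<^sub>A\<^sub>A\<^sub>' p\<^sup>A\<^sup>'\<close> of the frame
  with a primed spinor whose index is up.\<close>

definition spin_vec :: "(point \<Rightarrow> real^2) \<Rightarrow> 2 \<Rightarrow> point \<Rightarrow> real^4" where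
  "spin_vec p A x = p x $ 0 *\<^sub>R e x $ A $ 0 + p x $ 1 *\<^sub>R e x $ A $ 1"

text \<open>Only the summand with \<open>eps C' D'\<close> survives in the Weyl tensor; contracted
  with \<open>p\<close> and \<open>q\<close> it is their determinant, and \<open>k\<close> inherits
  its symmetry from the unprimed Weyl spinor. The first two slots are arbitrary vectors and are
  absorbed into \<open>k\<close>.\<close>

lemma asd_weyl_form_spin_vec:
  assumes "asd_metric U g e" "x \<in> U"
  obtains k where "\<And>C D. k C D = k D C"
    "\<And>p q C D. weyl_form x X Y (spin_vec p C x) (spin_vec q D x) = k C D * (p x $ 0 * q x $ 1 - p x $ 1 * q x $ 0)"
proof -
  obtain \<Psi> where \<Psi>: "tot_sym \<Psi>"
    "\<And>A A' B B' C C' D D'. weyl_form x (e x $ A $ A') (e x $ B $ B') (e x $ C $ C') (e x $ D $ D')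
       = eps A' B' * eps C' D' * \<Psi> A B C D"
    using asd_weyl_form_frame [OF assms] by blast
  have \<Psi>_sym: "\<Psi> A B C D = \<Psi> A B D C" for A B C D
    using \<Psi>(1) by (simp add: tot_sym_def)
  have "\<exists>k. (\<forall>C D. k C D = k D C) \<and> (\<forall>C C' D D'. weyl_form x X Y (e x $ C $ C') (e x $ D $ D') = k C D * eps C' D')"
  proof -
    note ex = null_frame_expand [OF null_frame_e [OF assms(2)]]
    have 1: "\<exists>k. (\<forall>C D. k C D = k D C) \<and> (\<forall>C C' D D'. weyl_form x (e x $ A $ A') Y (e x $ C $ C') (e x $ D $ D') = k C D * eps C' D')"
      for A A'
      apply (subst ex [of Y])
      apply (simp add: \<Psi>(2))
      \<comment> \<open>The coefficients are those of \<open>Y\<close> in the spin frame, as given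
        by \<open>null_frame_expand\<close>; each carries the factor \<open>eps A' B'\<close> of its
        frame vector.\<close>
      apply (rule exI [where x = "\<lambda>C D. bil (g x) Y (e x $ 1 $ 1) * eps A' 0 * \<Psi> A 0 C D
         - bil (g x) Y (e x $ 0 $ 1) * eps A' 0 * \<Psi> A 1 C D
         - bil (g x) Y (e x $ 1 $ 0) * eps A' 1 * \<Psi> A 0 C D
         + bil (g x) Y (e x $ 0 $ 0) * eps A' 1 * \<Psi> A 1 C D"])
      using \<Psi>_sym by (simp add: algebra_simps)
    then obtain k where k: "\<And>A A' C D. k A A' C D = k A A' D C"
      "\<And>A A' C C' D D'. weyl_form x (e x $ A $ A') Y (e x $ C $ C') (e x $ D $ D') = k A A' C D * eps C' D'"
      by metis
    show ?thesis
      apply (subst ex [of X])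
      apply (simp add: k(2))
      apply (rule exI [where x = "\<lambda>C D. bil (g x) X (e x $ 1 $ 1) * k 0 0 C D
         - bil (g x) X (e x $ 0 $ 1) * k 1 0 C D
         - bil (g x) X (e x $ 1 $ 0) * k 0 1 C D
         + bil (g x) X (e x $ 0 $ 0) * k 1 1 C D"])
      using k(1) by (simp add: algebra_simps)
  qed
  then obtain k where k: "\<And>C D. k C D = k D C"
    "\<And>C C' D D'. weyl_form x X Y (e x $ C $ C') (e x $ D $ D') = k C D * eps C' D'" by blast
  show ?thesis
    by (rule that [of k]) (auto simp: spin_vec_def k(2) algebra_simps intro: k(1))
qed

lemma bil_spin_vec:
  "x \<in> U \<Longrightarrow> bil (g x) (spin_vec p A x) (spin_vec q B x) = eps A B * (p x $ 0 * q x $ 1 - p x $ 1 * q x $ 0)"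
  by (simp add: spin_vec_def bil_frame algebra_simps)

lemma e_spin_vec: "e x $ A $ 0 = spin_vec (\<lambda>_. axis 0 1) A x" "e x $ A $ 1 = spin_vec (\<lambda>_. axis 1 1) A x"
  by (simp_all add: spin_vec_def axis_def)

text \<open>On frame vectors this is a symmetric \<open>k\<close> times a skew determinant; two
  forms that agree on a frame are equal.\<close>

lemma asd_weyl_form_antisym:
  assumes "asd_metric U g e" "x \<in> U"
  shows "weyl_form x X Y Z W = - weyl_form x X Y W Z"
proof -
  have frame: "weyl_form x X Y (spin_vec p C x) (spin_vec q D x) = - weyl_form x X Y (spin_vec q D x) (spin_vec p C x)" for p q C D
  proof (rule asd_weyl_form_spin_vec [OF assms, where X = X and Y = Y])
    fix k
    assume k: "\<And>C D. k C D = k D C"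
      "\<And>p q C D. weyl_form x X Y (spin_vec p C x) (spin_vec q D x) = k C D * (p x $ 0 * q x $ 1 - p x $ 1 * q x $ 0)"
    show ?thesis
      unfolding k(2) k(1) [of D C] by (simp add: algebra_simps)
  qed
  define M where "M = (\<chi> c d. \<Sum>a\<in>UNIV. \<Sum>b\<in>UNIV. weyl g x a b c d * X $ a * Y $ b)"
  have M: "weyl_form x X Y Z W = bil M Z W" for Z W
  proof -
    have "weyl_form x X Y Z W = (\<Sum>a\<in>UNIV. \<Sum>c\<in>UNIV. \<Sum>b\<in>UNIV. \<Sum>d\<in>UNIV. weyl g x a b c d * X $ a * Y $ b * Z $ c * W $ d)"
      unfolding weyl_form_def by (intro sum.cong refl sum.swap)
    also have "\<dots> = (\<Sum>c\<in>UNIV. \<Sum>a\<in>UNIV. \<Sum>b\<in>UNIV. \<Sum>d\<in>UNIV. weyl g x a b c d * X $ a * Y $ b * Z $ c * W $ d)"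
      by (rule sum.swap)
    also have "\<dots> = (\<Sum>c\<in>UNIV. \<Sum>a\<in>UNIV. \<Sum>d\<in>UNIV. \<Sum>b\<in>UNIV. weyl g x a b c d * X $ a * Y $ b * Z $ c * W $ d)"
      by (intro sum.cong refl sum.swap)
    also have "\<dots> = (\<Sum>c\<in>UNIV. \<Sum>d\<in>UNIV. \<Sum>a\<in>UNIV. \<Sum>b\<in>UNIV. weyl g x a b c d * X $ a * Y $ b * Z $ c * W $ d)"
      by (intro sum.cong refl sum.swap)
    finally show ?thesis by (simp add: bil_eq_sum M_def sum_distrib_right)
  qed
  have "M = - transpose M"
  proof (rule matrix_eq_on_null_frame [OF null_frame_e [OF assms(2)]])
    fix Z W
    assume "Z \<in> {e x $ 0 $ 0, e x $ 1 $ 0, e x $ 0 $ 1, e x $ 1 $ 1}"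
      and "W \<in> {e x $ 0 $ 0, e x $ 1 $ 0, e x $ 0 $ 1, e x $ 1 $ 1}"
    then obtain p C q D where "Z = spin_vec p C x" "W = spin_vec q D x" using e_spin_vec by blast
    then show "bil M Z W = bil (- transpose M) Z W"
      using frame [of p C q D] by (simp add: bil_transpose M)
  qed
  then have "bil M Z W = - bil (transpose M) Z W" using bil_linear(14) [of "transpose M" Z W] by simp
  then show ?thesis by (simp add: M bil_transpose)
qed

text \<open>The Ricci correction in \<open>weyl_form_eq\<close> is visibly skew in \<open>Z\<close>
  and \<open>W\<close>, so skewness of the Weyl form passes to the curvature. Its trace over the
  last pair then vanishes, and the first Bianchi identity turns this into symmetry of the Ricci
  tensor.\<close>

lemma asd_ricci_sym:
  assumes "asd_metric U g e" "x \<in> U"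
  shows "transpose (ricci g x) = ricci g x"
proof -
  have tr: "(\<Sum>c\<in>UNIV. riemann g x a b c c) = 0" for a b
  proof -
    have riemann_form: "riemann_form x (axis a 1) (axis b 1) Z W = bil (g x) (riemann_matrix a b x *v Z) W" for Z W
      by (simp add: riemann_form_def mult.assoc sum_distrib_left [symmetric] sum_axis_mult)
    have anti: "bil (g x) (riemann_matrix a b x *v Z) W = - bil (g x) (riemann_matrix a b x *v W) Z" for Z W
      using asd_weyl_form_antisym [OF assms, of "axis a 1" "axis b 1" Z W]
      unfolding weyl_form_eq riemann_form by (simp add: algebra_simps)
    have anti': "bil (g x) Z (riemann_matrix a b x *v W) = - bil (g x) W (riemann_matrix a b x *v Z)" for Z W
      using anti [of W Z] by (simp add: bil_g_sym [of x Z] bil_g_sym [of x W])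
    have "ginv g x ** g x = mat 1"
      using null_frame_matrix_inv(1) [OF null_frame_e [OF assms(2)]] matrix_inv_eqI
      unfolding ginv_def invertible_def by metis
    then have "ginv g x ** (g x ** riemann_matrix a b x) = riemann_matrix a b x"
      by (simp add: matrix_mul_assoc)
    moreover have "(ginv g x ** N) $ c $ c = (\<Sum>d\<in>UNIV. ginv g x $ c $ d * transpose N $ c $ d)" for c and N :: "real^4^4"
      by (simp add: matrix_matrix_mult_def transpose_def)
    ultimately have "(\<Sum>c\<in>UNIV. riemann_matrix a b x $ c $ c) = (\<Sum>c\<in>UNIV. \<Sum>d\<in>UNIV. ginv g x $ c $ d * transpose (g x ** riemann_matrix a b x) $ c $ d)"
      by metis
    also have "\<dots> = 0"
      unfolding ginv_def sum_ginv_null_frame [OF null_frame_e [OF assms(2)]] bil_transpose bil_mult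
      using anti' [of "e x $ 0 $ 0" "e x $ 1 $ 1"] anti' [of "e x $ 1 $ 0" "e x $ 0 $ 1"] by simp
    finally show ?thesis by (simp add: riemann_matrix_def)
  qed
  have "ricci g x $ a $ b = ricci g x $ b $ a" for a b
  proof -
    have "riemann g x a c b c = riemann g x b c a c - riemann g x b a c c" for c
      using riemann_bianchi [of x a c b c] riemann_antisym [of x c b a c] by simp
    then show ?thesis by (simp add: ricci_def sum_subtractf tr)
  qed
  then show ?thesis by (simp add: transpose_def vec_eq_iff)
qed

end

section \<open>The primed spin connection\<close>

text \<open>The index is raised by \<open>\<iota>\<^sup>A\<^sup>' =
  \<epsilon>\<^sup>A\<^sup>'\<^sup>B\<^sup>' \<iota>\<^sub>B\<^sub>'\<close>.\<close>

definition up_spinor :: "spinor \<Rightarrow> spinor" where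
  "up_spinor \<iota> x = (\<chi> A'. if A' = 0 then \<iota> x $ 1 else - \<iota> x $ 0)"

text \<open>The Euclidean product of components is not invariant, but it yields a complement to
  \<iota> that is normalised, canonical and smooth wherever \<iota> is smooth and non-zero.\<close>

definition dual_spinor :: "spinor \<Rightarrow> spinor" where
  "dual_spinor \<iota> x = inverse (\<iota> x \<bullet> \<iota> x) *\<^sub>R \<iota> x"

lemma up_spinor_nth [simp]: "up_spinor \<iota> x $ 0 = \<iota> x $ 1" "up_spinor \<iota> x $ 1 = - \<iota> x $ 0"
  by (simp_all add: up_spinor_def)

lemma up_spinor_linear:
  obtains L where "bounded_linear L" "\<And>\<kappa>. up_spinor \<kappa> = (\<lambda>y. L (\<kappa> y))"
proof
  let ?L = "\<lambda>p :: real^2. \<chi> A' :: 2. if A' = 0 then p $ 1 else - p $ 0"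
  have "linear ?L" by (rule linearI) (simp_all add: vec_eq_iff)
  then show "bounded_linear ?L" by (simp add: linear_conv_bounded_linear)
  show "up_spinor \<kappa> = (\<lambda>y. ?L (\<kappa> y))" for \<kappa> by (simp add: up_spinor_def fun_eq_iff)
qed

lemma differentiable_up: "\<iota> differentiable (at x) \<Longrightarrow> up_spinor \<iota> differentiable (at x)"
  by (rule up_spinor_linear) (simp add: differentiable_linear)

lemma pd_up: "\<iota> differentiable (at x) \<Longrightarrow> pd a (up_spinor \<iota>) x = up_spinor (pd a \<iota>) x"
  by (rule up_spinor_linear) (simp add: pd_linear)

lemma smooth_up: "open U \<Longrightarrow> smooth_in U \<iota> \<Longrightarrow> smooth_in U (up_spinor \<iota>)"
  by (rule up_spinor_linear) (simp add: smooth_in_linear)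

lemma spinor_inner: "(p :: real^2) \<bullet> q = p $ 0 * q $ 0 + p $ 1 * q $ 1"
  by (simp add: inner_vec_def sum_two)

lemma dual_spinor:
  assumes "\<iota> x \<noteq> 0"
  shows "\<iota> x $ 0 * dual_spinor \<iota> x $ 0 + \<iota> x $ 1 * dual_spinor \<iota> x $ 1 = 1"
proof -
  have "\<iota> x \<bullet> dual_spinor \<iota> x = 1" using assms by (simp add: dual_spinor_def)
  then show ?thesis by (simp add: spinor_inner)
qed

context spin_space
begin

text \<open>\<open>V \<iota> A\<close> is \<open>e\<^sub>A\<^sub>A\<^sub>' \<iota>\<^sup>A\<^sup>'\<close> and \<open>W \<iota> A\<close> is \<open>e\<^sub>A\<^sub>A\<^sub>' o\<^sup>A\<^sup>'\<close>, where \<open>o\<close> is one choice of a smooth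
  spinor with \<open>\<iota>\<^sub>A\<^sub>' o\<^sup>A\<^sup>' = 1\<close>.\<close>

abbreviation V :: "spinor \<Rightarrow> 2 \<Rightarrow> point \<Rightarrow> real^4" where "V \<iota> \<equiv> spin_vec (up_spinor \<iota>)"
abbreviation W :: "spinor \<Rightarrow> 2 \<Rightarrow> point \<Rightarrow> real^4" where "W \<iota> \<equiv> spin_vec (dual_spinor \<iota>)"

lemma null_frame_VW:
  assumes "x \<in> U" "\<iota> x \<noteq> 0"
  shows "null_frame (g x) (V \<iota> 0 x) (V \<iota> 1 x) (W \<iota> 0 x) (W \<iota> 1 x)"
  using dual_spinor [of \<iota> x] assms by (simp add: null_frame_def transpose_g bil_spin_vec add.commute)

lemma sum_coframe:
  "(\<Sum>c\<in>UNIV. coframe g e x A A' c * Z $ c)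
    = (\<Sum>B\<in>UNIV. \<Sum>B'\<in>UNIV. eps A B * eps A' B' * bil (g x) (e x $ B $ B') Z)"
proof -
  have "bil (g x) (e x $ B $ B') Z = (\<Sum>c\<in>UNIV. (g x *v (e x $ B $ B')) $ c * Z $ c)" for B B'
    using bil_g_sym [of x Z "e x $ B $ B'"] by (simp add: bil_def inner_vec_def mult.commute)
  then show ?thesis
    by (simp add: coframe_def sum_two sum_distrib_left sum_distrib_right sum.distrib
        sum_subtractf sum_negf algebra_simps)
qed

lemma differentiable_e: "x \<in> U \<Longrightarrow> (\<lambda>y. e y $ A $ A') differentiable (at x)"
  by (intro differentiable_nth differentiable_in smooth_e)

lemma bil_cov_antisym:
  assumes "x \<in> U" "X differentiable (at x)" "Y differentiable (at x)"
    and "\<And>y. y \<in> U \<Longrightarrow> bil (g y) (X y) (Y y) = c"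
  shows "bil (g x) (cov a X x) (Y x) = - bil (g x) (cov a Y x) (X x)"
proof -
  have "pd a (\<lambda>y. bil (g y) (X y) (Y y)) x = pd a (\<lambda>y. c) x"
    by (rule pd_cong [OF U assms(1)]) (use assms(4) in simp)
  then show ?thesis
    by (simp add: pd_g [OF assms(1-3)] bil_g_sym [of x "X x"])
qed

lemma spin_conn_eq:
  assumes "x \<in> U"
  shows "spin_conn g e x a B' C' = (1/2) * (\<Sum>B\<in>UNIV. \<Sum>E\<in>UNIV. \<Sum>E'\<in>UNIV.
      eps B E * eps C' E' * bil (g x) (e x $ E $ E') (cov a (\<lambda>y. e y $ B $ B') x))"
  unfolding spin_conn_def nabla_vector_cov [OF differentiable_e [OF assms]] sum_coframe ..

text \<open>Supplies the smooth coefficients of the linear equation from which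
  \<open>nabla_zero_smooth\<close> bootstraps.\<close>

lemma smooth_spin_conn: "smooth_in U (\<lambda>x. spin_conn g e x a B' C')"
proof -
  have "smooth_in U (\<lambda>x. (1/2) * (\<Sum>B\<in>UNIV. \<Sum>E\<in>UNIV. \<Sum>E'\<in>UNIV.
      eps B E * eps C' E' * bil (g x) (e x $ E $ E') (cov a (\<lambda>y. e y $ B $ B') x)))"
    by (intro smooth_rules smooth_bil smooth_cov smooth_e smooth_g)
  then show ?thesis
    using smooth_in_cong [OF U, where f = "\<lambda>x. spin_conn g e x a B' C'", OF spin_conn_eq] by simp
qed

lemma differentiable_spin_vec:
  assumes "x \<in> U" "p differentiable (at x)"
  shows "spin_vec p A differentiable (at x)"
  unfolding spin_vec_def [abs_def]
  by (intro differentiable_add differentiable_bilinear [OF bounded_bilinear_scaleR]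
      differentiable_nth assms(2) differentiable_in [OF smooth_e assms(1)])

lemma smooth_spin_vec: "smooth_in U p \<Longrightarrow> smooth_in U (spin_vec p A)"
  unfolding spin_vec_def [abs_def] by (intro smooth_rules smooth_e)

lemma cov_spin_vec:
  assumes "x \<in> U" "p differentiable (at x)"
  shows "cov a (spin_vec p A) x = pd a p x $ 0 *\<^sub>R e x $ A $ 0 + pd a p x $ 1 *\<^sub>R e x $ A $ 1
     + p x $ 0 *\<^sub>R cov a (\<lambda>y. e y $ A $ 0) x + p x $ 1 *\<^sub>R cov a (\<lambda>y. e y $ A $ 1) x"
proof -
  note d = differentiable_nth [OF assms(2)] differentiable_e [OF assms(1)]
  show ?thesis
    unfolding spin_vec_def [abs_def]
    by (simp add: cov_add cov_scaleR d pd_nth assms(2) differentiable_bilinear [OF bounded_bilinear_scaleR])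
qed

text \<open>Contracting \<open>\<nabla>\<^sub>a (e\<^sub>A\<^sub>A\<^sub>'
  \<iota>\<^sup>A\<^sup>')\<close> with
  \<open>\<epsilon>\<^sup>A\<^sup>B e\<^sub>B\<^sub>B\<^sub>'\<close> removes the trace-free
  unprimed connection and leaves twice the derivative of \<iota>. From here on, constancy of \<iota>
  is a statement about covariant derivatives of vectors.\<close>

lemma nabla_spinor_eq:
  assumes x: "x \<in> U" and d: "\<iota> differentiable (at x)"
  shows "nabla_spinor g e \<iota> x a B' = (1/2) *
    (bil (g x) (cov a (V \<iota> 0) x) (e x $ 1 $ B') - bil (g x) (cov a (V \<iota> 1) x) (e x $ 0 $ B'))"
proof -
  define c where "c A A' B B' = bil (g x) (cov a (\<lambda>y. e y $ A $ A') x) (e x $ B $ B')" for A A' B B'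
  have anti: "c A A' B B' = - c B B' A A'" for A A' B B'
    unfolding c_def by (rule bil_cov_antisym [OF x]) (auto intro: differentiable_e x simp: bil_frame)
  have sc: "spin_conn g e x a B' C' = (1/2) * (\<Sum>B\<in>UNIV. \<Sum>E\<in>UNIV. \<Sum>E'\<in>UNIV.
      eps B E * eps C' E' * c B B' E E')" for C'
    unfolding spin_conn_eq [OF x] c_def by (simp add: bil_g_sym [of x "e x $ _ $ _"])
  have nab: "nabla_spinor g e \<iota> x a B' = pd a \<iota> x $ B' - (\<Sum>C'\<in>UNIV. spin_conn g e x a B' C' * \<iota> x $ C')"
    by (simp add: nabla_spinor_def pd_nth d)
  have DV: "bil (g x) (cov a (V \<iota> A) x) (e x $ B $ B') = pd a \<iota> x $ 1 * (eps A B * eps 0 B')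
      - pd a \<iota> x $ 0 * (eps A B * eps 1 B') + \<iota> x $ 1 * c A 0 B B' - \<iota> x $ 0 * c A 1 B B'" for A B
    by (simp add: cov_spin_vec [OF x differentiable_up [OF d]] pd_up [OF d] bil_frame x c_def)
  have zero: "c A A' A A' = 0" for A A' using anti [of A A' A A'] by simp
  consider "B' = 0" | "B' = 1" using UNIV_two by blast
  then show ?thesis
    unfolding nab sc DV
    using anti [of 1 0 0 0] anti [of 1 1 0 0] anti [of 1 0 0 1] anti [of 1 1 0 1]
      anti [of 0 1 0 0] anti [of 1 1 1 0]
    by cases (simp_all add: sum_two zero algebra_simps)
qed

text \<open>The vanishing products say that the derivatives of \<open>V \<iota> A\<close> stay in
  the totally null plane spanned by the two, which is its own orthogonal complement. The first claim
  is the symmetry of the unprimed connection with its index lowered.\<close>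

lemma constant_spinor_cov:
  assumes x: "x \<in> U" and d: "\<iota> differentiable (at x)"
    and const: "\<And>B'. nabla_spinor g e \<iota> x a B' = 0"
  shows "bil (g x) (cov a (V \<iota> 0) x) (spin_vec q 1 x) = bil (g x) (cov a (V \<iota> 1) x) (spin_vec q 0 x)"
    and "bil (g x) (cov a (V \<iota> 0) x) (V \<iota> 1 x) = 0"
    and "bil (g x) (cov a (V \<iota> 1) x) (V \<iota> 0 x) = 0"
    and "bil (g x) (cov a (V \<iota> A) x) (V \<iota> A x) = 0"
proof -
  have "bil (g x) (cov a (V \<iota> 0) x) (e x $ 1 $ B') = bil (g x) (cov a (V \<iota> 1) x) (e x $ 0 $ B')" for B'
    using const [of B'] by (simp add: nabla_spinor_eq [OF x d])
  then show 1: "bil (g x) (cov a (V \<iota> 0) x) (spin_vec q 1 x) = bil (g x) (cov a (V \<iota> 1) x) (spin_vec q 0 x)" for q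
    by (simp add: spin_vec_def)
  have anti: "bil (g x) (cov a (V \<iota> A) x) (V \<iota> B x) = - bil (g x) (cov a (V \<iota> B) x) (V \<iota> A x)" for A B
    by (rule bil_cov_antisym [OF x]) (auto intro: differentiable_spin_vec differentiable_up x d simp: bil_spin_vec)
  show "bil (g x) (cov a (V \<iota> 0) x) (V \<iota> 1 x) = 0" "bil (g x) (cov a (V \<iota> 1) x) (V \<iota> 0 x) = 0"
    using 1 [of "up_spinor \<iota>"] anti [of 0 1] by simp_all
  show "bil (g x) (cov a (V \<iota> A) x) (V \<iota> A x) = 0" using anti [of A A] by simp
qed

lemma constant_spinorI:
  assumes x: "x \<in> U" and d: "\<iota> differentiable (at x)" and nz: "\<iota> x \<noteq> 0"
    and "bil (g x) (cov a (V \<iota> 0) x) (V \<iota> 1 x) = bil (g x) (cov a (V \<iota> 1) x) (V \<iota> 0 x)"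
    and "bil (g x) (cov a (V \<iota> 0) x) (W \<iota> 1 x) = bil (g x) (cov a (V \<iota> 1) x) (W \<iota> 0 x)"
  shows "nabla_spinor g e \<iota> x a B' = 0"
proof -
  have n: "bil (g x) (cov a (V \<iota> 0) x) (spin_vec q 1 x) - bil (g x) (cov a (V \<iota> 1) x) (spin_vec q 0 x)
      = 2 * (q x $ 0 * nabla_spinor g e \<iota> x a 0 + q x $ 1 * nabla_spinor g e \<iota> x a 1)" for q
    by (simp add: nabla_spinor_eq [OF x d] spin_vec_def algebra_simps)
  define n0 n1 where "n0 = nabla_spinor g e \<iota> x a 0" and "n1 = nabla_spinor g e \<iota> x a 1"
  have 1: "\<iota> x $ 1 * n0 - \<iota> x $ 0 * n1 = 0"
    using n [of "up_spinor \<iota>"] assms(4) by (simp add: n0_def n1_def)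
  have 2: "dual_spinor \<iota> x $ 0 * n0 + dual_spinor \<iota> x $ 1 * n1 = 0"
    using n [of "dual_spinor \<iota>"] assms(5) by (simp add: n0_def n1_def)
  note 3 = dual_spinor [of \<iota> x, OF nz]
  \<comment> \<open>The two equations test the derivative against a basis of primed spinors;
    \<open>3\<close> says that the determinant of the system is one.\<close>
  have "n0 = 0" "n1 = 0" using 1 2 3 by algebra+
  then show ?thesis using forall_two [of "\<lambda>B'. nabla_spinor g e \<iota> x a B' = 0"]
    by (simp add: n0_def n1_def)
qed

end

section \<open>Curvature of a metric with a constant spinor\<close>

context spin_space
begin

text \<open>Cartan's second structure equation in the form used below: curvature from the connection
  one-forms \<open>bil (g y) (cov b Z y) (Y y)\<close>.\<close>

lemma bil_riemann_matrix:
  assumes x: "x \<in> U" and Z: "smooth_in U Z" and Y: "smooth_in U Y"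
  shows "bil (g x) (riemann_matrix a b x *v Z x) (Y x)
    = pd a (\<lambda>y. bil (g y) (cov b Z y) (Y y)) x - pd b (\<lambda>y. bil (g y) (cov a Z y) (Y y)) x
      - bil (g x) (cov b Z x) (cov a Y x) + bil (g x) (cov a Z x) (cov b Y x)"
proof -
  have "pd i (\<lambda>y. bil (g y) (cov j Z y) (Y y)) x
     = bil (g x) (cov i (cov j Z) x) (Y x) + bil (g x) (cov j Z x) (cov i Y x)" for i j
    using pd_g [OF x differentiable_in [OF smooth_cov [OF Z] x] differentiable_in [OF Y x]] .
  then show ?thesis by (simp add: ricci_identity [OF x Z, symmetric])
qed

end

locale constant_spinor_space = spin_space +
  fixes \<iota> :: spinor
  assumes asd: "asd_metric U g e" and const: "constant_spinor U g e \<iota>"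
begin

abbreviation v :: "2 \<Rightarrow> point \<Rightarrow> real^4" where "v \<equiv> V \<iota>"
abbreviation w :: "2 \<Rightarrow> point \<Rightarrow> real^4" where "w \<equiv> W \<iota>"

lemma smooth_iota: "smooth_in U \<iota>"
  using const by (simp add: constant_spinor_def smooth_field_iff)

lemma iota_nonzero: "x \<in> U \<Longrightarrow> \<iota> x \<noteq> 0"
  using const by (simp add: constant_spinor_def)

lemma nabla_iota: "x \<in> U \<Longrightarrow> nabla_spinor g e \<iota> x a B' = 0"
  using const by (simp add: constant_spinor_def)

lemma smooth_v: "smooth_in U (v A)"
  by (intro smooth_spin_vec smooth_up U smooth_iota)

lemma smooth_w: "smooth_in U (w A)"
  unfolding dual_spinor_def [abs_def]
  by (intro smooth_spin_vec smooth_rules smooth_iota smooth_in_inverse [OF U]) (simp add: iota_nonzero)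

lemma frame_vw: "x \<in> U \<Longrightarrow> null_frame (g x) (v 0 x) (v 1 x) (w 0 x) (w 1 x)"
  by (simp add: null_frame_VW iota_nonzero)

definition potential :: "4 \<Rightarrow> point \<Rightarrow> real" where
  "potential a x = bil (g x) (cov a (w 0) x) (w 1 x)"

definition curv_form :: tensor2 where
  "curv_form x = (\<chi> a b. pd a (potential b) x - pd b (potential a) x)"

lemma smooth_potential: "smooth_in U (potential a)"
  unfolding potential_def [abs_def] by (intro smooth_bil smooth_cov smooth_w smooth_g)

text \<open>Constancy of \<iota> and metricity leave four one-forms: \<open>potential\<close>, and
  the three components of the symmetric unprimed connection given by the products of
  \<open>cov a (v A) x\<close> with \<open>w B x\<close>.\<close>

lemma connection_coefficients:
  assumes x: "x \<in> U"
  shows "bil (g x) (cov a (v 0) x) (v 0 x) = 0" "bil (g x) (cov a (v 0) x) (v 1 x) = 0"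
    "bil (g x) (cov a (v 1) x) (v 0 x) = 0" "bil (g x) (cov a (v 1) x) (v 1 x) = 0"
    "bil (g x) (cov a (w 0) x) (w 0 x) = 0" "bil (g x) (cov a (w 0) x) (w 1 x) = potential a x"
    "bil (g x) (cov a (w 1) x) (w 0 x) = - potential a x" "bil (g x) (cov a (w 1) x) (w 1 x) = 0"
    "bil (g x) (cov a (v 1) x) (w 0 x) = bil (g x) (cov a (v 0) x) (w 1 x)"
    "bil (g x) (cov a (w 0) x) (v 0 x) = - bil (g x) (cov a (v 0) x) (w 0 x)"
    "bil (g x) (cov a (w 0) x) (v 1 x) = - bil (g x) (cov a (v 0) x) (w 1 x)"
    "bil (g x) (cov a (w 1) x) (v 0 x) = - bil (g x) (cov a (v 0) x) (w 1 x)"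
    "bil (g x) (cov a (w 1) x) (v 1 x) = - bil (g x) (cov a (v 1) x) (w 1 x)"
proof -
  note d = differentiable_in [OF smooth_iota x]
  note dv = differentiable_in [OF smooth_v x] and dw = differentiable_in [OF smooth_w x]
  note c = constant_spinor_cov [OF x d nabla_iota [OF x]]
  show "bil (g x) (cov a (v 0) x) (v 0 x) = 0" "bil (g x) (cov a (v 0) x) (v 1 x) = 0"
    "bil (g x) (cov a (v 1) x) (v 0 x) = 0" "bil (g x) (cov a (v 1) x) (v 1 x) = 0"
    "bil (g x) (cov a (v 1) x) (w 0 x) = bil (g x) (cov a (v 0) x) (w 1 x)"
    using c by simp_all
  show "bil (g x) (cov a (w 0) x) (w 1 x) = potential a x" by (simp add: potential_def)
  have ww: "bil (g x) (cov a (w A) x) (w B x) = - bil (g x) (cov a (w B) x) (w A x)" for A B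
    by (rule bil_cov_antisym [OF x dw dw]) (simp add: bil_spin_vec)
  show "bil (g x) (cov a (w 0) x) (w 0 x) = 0" "bil (g x) (cov a (w 1) x) (w 1 x) = 0"
    using ww [of 0 0] ww [of 1 1] by simp_all
  show "bil (g x) (cov a (w 1) x) (w 0 x) = - potential a x" using ww [of 1 0] by (simp add: potential_def)
  have wv: "bil (g x) (cov a (w A) x) (v B x) = - bil (g x) (cov a (v B) x) (w A x)" for A B
  proof (rule bil_cov_antisym [OF x dw dv])
    fix y assume "y \<in> U"
    then show "bil (g y) (w A y) (v B y) = eps B A"
      using dual_spinor [of \<iota> y, OF iota_nonzero] bil_g_sym [of y "w A y"]
      by (simp add: bil_spin_vec add.commute)
  qed
  show "bil (g x) (cov a (w 0) x) (v 0 x) = - bil (g x) (cov a (v 0) x) (w 0 x)"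
    "bil (g x) (cov a (w 1) x) (v 0 x) = - bil (g x) (cov a (v 0) x) (w 1 x)"
    "bil (g x) (cov a (w 1) x) (v 1 x) = - bil (g x) (cov a (v 1) x) (w 1 x)"
    by (rule wv)+
  show "bil (g x) (cov a (w 0) x) (v 1 x) = - bil (g x) (cov a (v 0) x) (w 1 x)"
    using wv [of 0 1] c(1) by simp
qed

lemma bil_cov_cov:
  assumes x: "x \<in> U"
  shows "bil (g x) (cov a X x) (cov b Y x)
    = bil (g x) (cov a X x) (w 1 x) * bil (g x) (cov b Y x) (v 0 x)
    - bil (g x) (cov a X x) (w 0 x) * bil (g x) (cov b Y x) (v 1 x)
    - bil (g x) (cov a X x) (v 1 x) * bil (g x) (cov b Y x) (w 0 x)
    + bil (g x) (cov a X x) (v 0 x) * bil (g x) (cov b Y x) (w 1 x)"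
  unfolding bil_null_frame_expand [OF frame_vw [OF x], of "cov a X x" "cov b Y x"]
  by (simp add: bil_g_sym [of x _ "cov b Y x"])

lemma riemann_matrix_vv:
  assumes x: "x \<in> U"
  shows "bil (g x) (riemann_matrix a b x *v v 0 x) (v 1 x) = 0"
proof -
  have "pd i (\<lambda>y. bil (g y) (cov j (v 0) y) (v 1 y)) x = 0" for i j
    using pd_cong [OF U x, where h = "\<lambda>_. 0", OF connection_coefficients(2)] by simp
  then show ?thesis
    by (simp add: bil_riemann_matrix [OF x smooth_v smooth_v] bil_cov_cov [OF x] connection_coefficients [OF x])
qed

lemma riemann_matrix_vw:
  assumes x: "x \<in> U"
  shows "bil (g x) (riemann_matrix a b x *v v 0 x) (w 1 x) = bil (g x) (riemann_matrix a b x *v v 1 x) (w 0 x)"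
proof -
  have "pd i (\<lambda>y. bil (g y) (cov j (v 1) y) (w 0 y)) x
      = pd i (\<lambda>y. bil (g y) (cov j (v 0) y) (w 1 y)) x" for i j
    using pd_cong [OF U x connection_coefficients(9)] .
  then show ?thesis
    by (simp add: bil_riemann_matrix [OF x smooth_v smooth_w] bil_cov_cov [OF x] connection_coefficients [OF x])
qed

text \<open>The quadratic terms of the structure equation are symmetric in \<open>a\<close> and
  \<open>b\<close> here and cancel: a connection preserving \<iota> is abelian on primed spinors, so
  its curvature is exact.\<close>

lemma riemann_matrix_ww:
  assumes x: "x \<in> U"
  shows "bil (g x) (riemann_matrix a b x *v w 0 x) (w 1 x) = curv_form x $ a $ b"
  by (simp add: bil_riemann_matrix [OF x smooth_w smooth_w] bil_cov_cov [OF x] connection_coefficients [OF x] curv_form_def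
      potential_def [symmetric])

lemma riemann_form_vw:
  assumes x: "x \<in> U"
  shows "riemann_form x X Y (v 0 x) (v 1 x) = 0"
    "riemann_form x X Y (v 0 x) (w 1 x) = riemann_form x X Y (v 1 x) (w 0 x)"
    "riemann_form x X Y (w 0 x) (w 1 x) = bil (curv_form x) X Y"
  unfolding riemann_form_def bil_eq_sum [of "curv_form x"]
  by (simp_all add: riemann_matrix_vv [OF x] riemann_matrix_vw [OF x] riemann_matrix_ww [OF x] mult_ac)

text \<open>\<open>P\<close> is the difference between curvature and Weyl form. The Weyl form
  vanishes on two \<open>v\<close> or two \<open>w\<close> and is symmetric on the mixed pair, so
  \<open>P\<close> has the same primed components as the full curvature computed in
  \<open>riemann_form_vw\<close>.\<close>

lemma ricci_part:
  assumes x: "x \<in> U"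
  defines "P \<equiv> \<lambda>X Y Z W. (1/2) *
     (bil (g x) X Z * bil (ricci g x) Y W - bil (g x) X W * bil (ricci g x) Y Z
      - bil (ricci g x) X W * bil (g x) Y Z + bil (ricci g x) X Z * bil (g x) Y W)
     - (1/6) * scalar_curv g x * (bil (g x) X Z * bil (g x) Y W - bil (g x) X W * bil (g x) Y Z)"
  shows "P X Y (v 0 x) (v 1 x) = 0"
    "P X Y (v 0 x) (w 1 x) = P X Y (v 1 x) (w 0 x)"
    "P X Y (w 0 x) (w 1 x) = bil (curv_form x) X Y"
proof -
  obtain k where k: "\<And>C D. k C D = k D C"
    "\<And>p q C D. weyl_form x X Y (spin_vec p C x) (spin_vec q D x) = k C D * (p x $ 0 * q x $ 1 - p x $ 1 * q x $ 0)"
    using asd_weyl_form_spin_vec [OF asd x] by blast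
  have weyl_form: "weyl_form x X Y (v 0 x) (v 1 x) = 0" "weyl_form x X Y (w 0 x) (w 1 x) = 0"
    "weyl_form x X Y (v 0 x) (w 1 x) = weyl_form x X Y (v 1 x) (w 0 x)"
    using k(1) [of 0 1] by (simp_all add: k(2))
  show "P X Y (v 0 x) (v 1 x) = 0"
    "P X Y (v 0 x) (w 1 x) = P X Y (v 1 x) (w 0 x)"
    "P X Y (w 0 x) (w 1 x) = bil (curv_form x) X Y"
    using weyl_form unfolding weyl_form_eq riemann_form_vw [OF x] P_def by (simp_all add: algebra_simps)
qed

lemma scalar_curv_frame:
  assumes x: "x \<in> U"
  shows "scalar_curv g x = 2 * (bil (ricci g x) (v 0 x) (w 1 x) - bil (ricci g x) (v 1 x) (w 0 x))"
  using bil_sym [OF asd_ricci_sym [OF asd x], of "w _ x" "v _ x"]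
  unfolding scalar_curv_def ginv_def sum_ginv_null_frame [OF frame_vw [OF x]]
  by simp

lemma ricci_frame:
  assumes x: "x \<in> U"
  shows "scalar_curv g x = 0"
    "bil (ricci g x) (v A x) (v B x) = 0"
    "bil (ricci g x) (v A x) (w B x) = 0"
proof -
  note fr = null_frame_bil [OF frame_vw [OF x]]
  note sym = bil_sym [OF asd_ricci_sym [OF asd x]]
  note P1 = ricci_part(1) [OF x] and P2 = ricci_part(2) [OF x]
  have vv: "bil (ricci g x) (v 0 x) (v 1 x) = 0" "bil (ricci g x) (v 1 x) (v 1 x) = 0"
    "bil (ricci g x) (v 0 x) (v 0 x) = 0"
    using P1 [of "w 1 x" "v 0 x"] P1 [of "w 1 x" "v 1 x"] P1 [of "w 0 x" "v 0 x"]
      P1 [of "w 0 x" "v 1 x"] sym [of "v 1 x" "v 0 x"]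
    by (simp_all add: fr)
  \<comment> \<open>With \<open>scalar_curv_frame\<close> inserted, this component of
    \<open>ricci_part\<close> says that R/6 equals R/4.\<close>
  have 1: "scalar_curv g x = 0" "bil (ricci g x) (v 0 x) (w 1 x) = bil (ricci g x) (v 1 x) (w 0 x)"
    using P1 [of "w 1 x" "w 0 x"] scalar_curv_frame [OF x] sym [of "w 0 x" "v 1 x"] sym [of "w 1 x" "v 0 x"]
    by (simp_all add: fr field_simps)
  have 2: "bil (ricci g x) (v 0 x) (w 1 x) = 0" "bil (ricci g x) (v 0 x) (w 0 x) = 0"
    "bil (ricci g x) (v 1 x) (w 1 x) = 0"
    using P2 [of "w 1 x" "v 0 x"] P2 [of "w 1 x" "v 1 x"] P2 [of "w 0 x" "v 0 x"]
      P2 [of "w 0 x" "v 1 x"] P2 [of "w 0 x" "w 1 x"]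
      P1 [of "w 1 x" "w 0 x"] sym [of "w _ x" "v _ x"] 1
    by (simp_all add: fr)
  show "scalar_curv g x = 0" by (fact 1)
  have A: "\<forall>A B. bil (ricci g x) (v A x) (v B x) = 0 \<and> bil (ricci g x) (v A x) (w B x) = 0"
    using vv 1 2 sym [of "v 1 x" "v 0 x"] by (simp add: forall_two)
  then show "bil (ricci g x) (v A x) (v B x) = 0" "bil (ricci g x) (v A x) (w B x) = 0" by auto
qed

text \<open>If \<Phi> is an unprimed spinor times the square of \<iota>, two contractions with the
  dual spinor recover that unprimed spinor.\<close>

definition ricci_spinor :: "point \<Rightarrow> real^2^2" where
  "ricci_spinor x = (\<chi> A B. bil (Phi g x) (w A x) (w B x))"

lemma Phi_ricci: "x \<in> U \<Longrightarrow> Phi g x = (-1/2) *\<^sub>R ricci g x"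
  by (simp add: Phi_def ricci_frame vec_eq_iff)

lemma ricci_spinor_sym: "x \<in> U \<Longrightarrow> ricci_spinor x $ A $ B = ricci_spinor x $ B $ A"
  by (simp add: ricci_spinor_def Phi_ricci bil_sym [OF asd_ricci_sym [OF asd]])

text \<open>The factor 1/2 of the Ricci terms in \<open>weyl\<close> matches the -1/2 in
  \<open>Phi\<close>, so the curvature reproduces the Ricci spinor without a further
  constant.\<close>

lemma curv_form_frame:
  assumes x: "x \<in> U"
  shows "bil (curv_form x) (v A x) (v B x) = 0" "bil (curv_form x) (w A x) (w B x) = 0"
    "bil (curv_form x) (v A x) (w B x) = ricci_spinor x $ A $ B" "bil (curv_form x) (w B x) (v A x) = - ricci_spinor x $ A $ B"
proof -
  note fr = null_frame_bil [OF frame_vw [OF x]]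
  note sym = bil_sym [OF asd_ricci_sym [OF asd x]]
  have wv: "bil (ricci g x) (w A x) (v B x) = 0" for A B
    using ricci_frame(3) [OF x] sym [of "w A x" "v B x"] by simp
  have "\<forall>A B. bil (curv_form x) (v A x) (v B x) = 0 \<and> bil (curv_form x) (w A x) (w B x) = 0 \<and>
    bil (curv_form x) (v A x) (w B x) = ricci_spinor x $ A $ B \<and> bil (curv_form x) (w B x) (v A x) = - ricci_spinor x $ A $ B"
    unfolding ricci_part(3) [OF x, symmetric]
    using sym [of "w 1 x" "w 0 x"]
    by (simp add: forall_two fr ricci_frame [OF x] wv ricci_spinor_def Phi_ricci [OF x])
  then show "bil (curv_form x) (v A x) (v B x) = 0" "bil (curv_form x) (w A x) (w B x) = 0"
    "bil (curv_form x) (v A x) (w B x) = ricci_spinor x $ A $ B" "bil (curv_form x) (w B x) (v A x) = - ricci_spinor x $ A $ B"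
    by auto
qed

end

section \<open>Two-forms and spinors\<close>

definition outer :: "real^4 \<Rightarrow> real^4 \<Rightarrow> real^4^4" where
  "outer p q = (\<chi> a b. p $ a * q $ b)"

lemma bounded_bilinear_outer: "bounded_bilinear outer"
  unfolding bilinear_conv_bounded_bilinear [symmetric]
  by (intro bilinear_def [THEN iffD2])
    (auto intro!: linearI simp: outer_def vec_eq_iff algebra_simps)

lemma bil_outer: "bil (outer p q) X Y = (p \<bullet> X) * (q \<bullet> Y)"
  by (simp add: bil_eq_sum outer_def inner_vec_def sum_product mult_ac)

lemma bil_sum: "bil (\<Sum>i\<in>I. T i) X Y = (\<Sum>i\<in>I. bil (T i) X Y)"
  by (induction I rule: infinite_finite_induct) auto

lemma spin_comp2_bil: "spin_comp2 e T x A A' B B' = bil (T x) (e x $ A $ A') (e x $ B $ B')"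
  by (simp add: spin_comp2_def bil_def)

lemma transpose_eq_minus_iff: "transpose T = - T \<longleftrightarrow> (\<forall>a b. T $ a $ b = - T $ b $ a)"
  by (auto simp: transpose_def vec_eq_iff)

lemma bil_antisym: "transpose T = - T \<Longrightarrow> bil T X Y = - bil T Y X"
  using bil_transpose [of T X Y] by simp

lemma two_sym_iff: "transpose (\<phi> :: real^2^2) = \<phi> \<longleftrightarrow> \<phi> $ 0 $ 1 = \<phi> $ 1 $ 0"
  by (auto simp: transpose_def vec_eq_iff forall_two)

definition asd_spinor :: "spin_frame \<Rightarrow> tensor2 \<Rightarrow> point \<Rightarrow> real^2^2" where
  "asd_spinor e F x =
     (\<chi> A B. (1/2) * (\<Sum>A'\<in>UNIV. \<Sum>B'\<in>UNIV. eps A' B' * spin_comp2 e F x A A' B B'))"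

context spin_space
begin

lemma coframe_frame:
  "x \<in> U \<Longrightarrow> (\<chi> c. coframe g e x A A' c) \<bullet> e x $ B $ B' = (if A = B \<and> A' = B' then 1 else 0)"
proof -
  assume x: "x \<in> U"
  have "\<forall>A A' B B'. (\<chi> c. coframe g e x A A' c) \<bullet> e x $ B $ B' = (if A = B \<and> A' = B' then 1 else 0)"
    by (simp add: inner_vec_def sum_coframe forall_two sum_two bil_frame [OF x])
  then show ?thesis by blast
qed

lemma form_frame:
  assumes x: "x \<in> U"
  shows "bil (form_of_spinors g e x \<phi> \<psi>) (e x $ A $ A') (e x $ B $ B')
    = \<phi> $ A $ B * eps A' B' + \<psi> $ A' $ B' * eps A B"
proof -
  have "form_of_spinors g e x \<phi> \<psi> = (\<Sum>A\<in>UNIV. \<Sum>A'\<in>UNIV. \<Sum>B\<in>UNIV. \<Sum>B'\<in>UNIV.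
       (\<phi> $ A $ B * eps A' B' + \<psi> $ A' $ B' * eps A B) *\<^sub>R
       outer (\<chi> c. coframe g e x A A' c) (\<chi> c. coframe g e x B B' c))"
    by (simp add: form_of_spinors_def vec_eq_iff outer_def mult.assoc)
  then have "\<forall>A A' B B'. bil (form_of_spinors g e x \<phi> \<psi>) (e x $ A $ A') (e x $ B $ B')
    = \<phi> $ A $ B * eps A' B' + \<psi> $ A' $ B' * eps A B"
    by (simp add: bil_sum bil_outer coframe_frame [OF x] sum_two forall_two)
  then show ?thesis by blast
qed

lemma matrix_eq_frameI:
  assumes x: "x \<in> U" and "\<And>A A' B B'. bil T (e x $ A $ A') (e x $ B $ B') = bil S (e x $ A $ A') (e x $ B $ B')"
  shows "T = S"
  by (rule matrix_eq_on_null_frame [OF null_frame_e [OF x]]) (use assms(2) in auto)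

lemma form_of_spinors_antisym:
  assumes x: "x \<in> U" and "transpose \<phi> = \<phi>" "transpose \<psi> = \<psi>"
  shows "transpose (form_of_spinors g e x \<phi> \<psi>) = - form_of_spinors g e x \<phi> \<psi>"
proof (rule matrix_eq_frameI [OF x])
  fix A A' B B'
  have "\<phi> $ A $ B = \<phi> $ B $ A" "\<psi> $ A' $ B' = \<psi> $ B' $ A'"
    using arg_cong [OF assms(2), of "\<lambda>M. M $ A $ B"] arg_cong [OF assms(3), of "\<lambda>M. M $ A' $ B'"]
    by (simp_all add: transpose_def)
  then show "bil (transpose (form_of_spinors g e x \<phi> \<psi>)) (e x $ A $ A') (e x $ B $ B')
     = bil (- form_of_spinors g e x \<phi> \<psi>) (e x $ A $ A') (e x $ B $ B')"
    by (simp add: bil_transpose form_frame [OF x] eps_def)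
qed

lemma sd_spinor_nth:
  "sd_spinor e T x $ A' $ B' = (1/2) * (bil (T x) (e x $ 0 $ A') (e x $ 1 $ B') - bil (T x) (e x $ 1 $ A') (e x $ 0 $ B'))"
  by (simp add: sd_spinor_def spin_comp2_bil sum_two)

lemma asd_spinor_nth:
  "asd_spinor e T x $ A $ B = (1/2) * (bil (T x) (e x $ A $ 0) (e x $ B $ 1) - bil (T x) (e x $ A $ 1) (e x $ B $ 0))"
  by (simp add: asd_spinor_def spin_comp2_bil sum_two)

lemma sd_spinor_sym: "transpose (T x) = - T x \<Longrightarrow> transpose (sd_spinor e T x) = sd_spinor e T x"
  using bil_antisym [of "T x" "e x $ 0 $ 1" "e x $ 1 $ 0"] bil_antisym [of "T x" "e x $ 1 $ 1" "e x $ 0 $ 0"]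
  by (simp add: two_sym_iff sd_spinor_nth)

lemma asd_spinor_sym: "transpose (T x) = - T x \<Longrightarrow> transpose (asd_spinor e T x) = asd_spinor e T x"
  using bil_antisym [of "T x" "e x $ 1 $ 0" "e x $ 0 $ 1"] bil_antisym [of "T x" "e x $ 1 $ 1" "e x $ 0 $ 0"]
  by (simp add: two_sym_iff asd_spinor_nth)

lemma sd_spinor_form:
  assumes "x \<in> U" "T x = form_of_spinors g e x \<phi> \<psi>" "transpose \<phi> = \<phi>"
  shows "sd_spinor e T x = \<psi>"
  using assms(3) unfolding two_sym_iff
  by (simp add: vec_eq_iff forall_two sd_spinor_nth assms(2) form_frame [OF assms(1)])

text \<open>The six independent components of a two-form are the three of each symmetric
  spinor.\<close>

lemma two_form_decomp:
  assumes x: "x \<in> U" and anti: "transpose (T x) = - T x"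
  shows "T x = form_of_spinors g e x (asd_spinor e T x) (sd_spinor e T x)"
proof (rule matrix_eq_frameI [OF x])
  fix A A' B B'
  note a = bil_antisym [OF anti]
  have z: "bil (T x) X X = 0" for X using a [of X X] by simp
  have "\<forall>A A' B B'. bil (T x) (e x $ A $ A') (e x $ B $ B')
    = asd_spinor e T x $ A $ B * eps A' B' + sd_spinor e T x $ A' $ B' * eps A B"
    using a [of "e x $ 1 $ 0" "e x $ 0 $ 0"] a [of "e x $ 0 $ 1" "e x $ 0 $ 0"]
      a [of "e x $ 1 $ 1" "e x $ 0 $ 0"] a [of "e x $ 0 $ 1" "e x $ 1 $ 0"]
      a [of "e x $ 1 $ 1" "e x $ 1 $ 0"] a [of "e x $ 1 $ 1" "e x $ 0 $ 1"]
    by (simp add: forall_two asd_spinor_nth sd_spinor_nth z add_divide_distrib diff_divide_distrib)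
  then show "bil (T x) (e x $ A $ A') (e x $ B $ B')
    = bil (form_of_spinors g e x (asd_spinor e T x) (sd_spinor e T x)) (e x $ A $ A') (e x $ B $ B')"
    by (simp add: form_frame [OF x])
qed

text \<open>The contributions to \<open>F\<^sub>a\<^sub>c F\<^sub>b\<^sup>c\<close> quadratic in
  \<phi> alone or in \<psi> alone are multiples of the metric and are cancelled by the trace term;
  the cross terms give the product.\<close>

lemma stress_energy_frame:
  assumes x: "x \<in> U" and T: "T x = form_of_spinors g e x \<phi> \<psi>"
    and "transpose \<phi> = \<phi>" "transpose \<psi> = \<psi>"
  shows "bil (stress_energy g T x) (e x $ A $ A') (e x $ B $ B') = \<phi> $ A $ B * \<psi> $ A' $ B'"
proof -
  define H where "H = (\<chi> a b. \<Sum>c\<in>UNIV. \<Sum>d\<in>UNIV. T x $ a $ c * T x $ b $ d * ginv g x $ c $ d)"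
  define N where "N = (\<Sum>a\<in>UNIV. \<Sum>b\<in>UNIV. ginv g x $ a $ b * H $ a $ b)"
  have "(\<Sum>c\<in>UNIV. \<Sum>d\<in>UNIV. \<Sum>p\<in>UNIV. \<Sum>q\<in>UNIV.
           ginv g x $ c $ p * ginv g x $ d $ q * T x $ c $ d * T x $ p $ q) = N"
  proof -
    have "(\<Sum>c\<in>UNIV. \<Sum>d\<in>UNIV. \<Sum>p\<in>UNIV. \<Sum>q\<in>UNIV.
           ginv g x $ c $ p * ginv g x $ d $ q * T x $ c $ d * T x $ p $ q)
       = (\<Sum>c\<in>UNIV. \<Sum>p\<in>UNIV. \<Sum>d\<in>UNIV. \<Sum>q\<in>UNIV.
           ginv g x $ c $ p * ginv g x $ d $ q * T x $ c $ d * T x $ p $ q)"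
      by (intro sum.cong refl sum.swap)
    then show ?thesis by (simp add: N_def H_def sum_distrib_left mult_ac)
  qed
  then have stress: "stress_energy g T x = (1/2) *\<^sub>R ((1/4 * N) *\<^sub>R g x - H)"
    by (simp add: stress_energy_def H_def vec_eq_iff mult_ac)
  have H: "bil H X Y = bil (T x) X (e x $ 0 $ 0) * bil (T x) Y (e x $ 1 $ 1)
     + bil (T x) X (e x $ 1 $ 1) * bil (T x) Y (e x $ 0 $ 0)
     - bil (T x) X (e x $ 1 $ 0) * bil (T x) Y (e x $ 0 $ 1)
     - bil (T x) X (e x $ 0 $ 1) * bil (T x) Y (e x $ 1 $ 0)" for X Y
  proof -
    \<comment> \<open>The outer product of the one-forms obtained by inserting \<open>X\<close>,
      respectively \<open>Y\<close>, into \<open>T x\<close>; it turns \<open>bil H X Y\<close> into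
      a metric trace.\<close>
    define K where "K = outer (X v* T x) (Y v* T x)"
    have K: "K $ c $ d = (\<Sum>a\<in>UNIV. \<Sum>b\<in>UNIV. (T x $ a $ c * X $ a) * (T x $ b $ d * Y $ b))" for c d
    proof -
      have "(Z v* T x) $ i = (\<Sum>a\<in>UNIV. T x $ a $ i * Z $ a)" for Z i
        by (simp add: vector_matrix_mult_def mult.commute)
      then show ?thesis unfolding K_def outer_def by (simp only: vec_lambda_beta sum_product)
    qed
    have "bil H X Y = (\<Sum>a\<in>UNIV. \<Sum>b\<in>UNIV. \<Sum>c\<in>UNIV. \<Sum>d\<in>UNIV.
        ginv g x $ c $ d * (T x $ a $ c * X $ a) * (T x $ b $ d * Y $ b))"
      by (simp add: bil_eq_sum H_def sum_distrib_left sum_distrib_right mult_ac)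
    also have "\<dots> = (\<Sum>a\<in>UNIV. \<Sum>c\<in>UNIV. \<Sum>b\<in>UNIV. \<Sum>d\<in>UNIV.
        ginv g x $ c $ d * (T x $ a $ c * X $ a) * (T x $ b $ d * Y $ b))"
      by (intro sum.cong refl sum.swap)
    also have "\<dots> = (\<Sum>c\<in>UNIV. \<Sum>a\<in>UNIV. \<Sum>b\<in>UNIV. \<Sum>d\<in>UNIV.
        ginv g x $ c $ d * (T x $ a $ c * X $ a) * (T x $ b $ d * Y $ b))"
      by (rule sum.swap)
    also have "\<dots> = (\<Sum>c\<in>UNIV. \<Sum>a\<in>UNIV. \<Sum>d\<in>UNIV. \<Sum>b\<in>UNIV.
        ginv g x $ c $ d * (T x $ a $ c * X $ a) * (T x $ b $ d * Y $ b))"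
      by (intro sum.cong refl sum.swap)
    also have "\<dots> = (\<Sum>c\<in>UNIV. \<Sum>d\<in>UNIV. \<Sum>a\<in>UNIV. \<Sum>b\<in>UNIV.
        ginv g x $ c $ d * (T x $ a $ c * X $ a) * (T x $ b $ d * Y $ b))"
      by (intro sum.cong refl sum.swap)
    also have "\<dots> = (\<Sum>c\<in>UNIV. \<Sum>d\<in>UNIV. ginv g x $ c $ d * K $ c $ d)"
      unfolding K sum_distrib_left by (simp add: mult.assoc)
    also have "\<dots> = bil K (e x $ 0 $ 0) (e x $ 1 $ 1) + bil K (e x $ 1 $ 1) (e x $ 0 $ 0)
        - bil K (e x $ 1 $ 0) (e x $ 0 $ 1) - bil K (e x $ 0 $ 1) (e x $ 1 $ 0)"
      unfolding ginv_def by (rule sum_ginv_null_frame [OF null_frame_e [OF x]])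
    finally show ?thesis
      by (simp only: K_def bil_outer dot_lmul_matrix bil_def [of "T x"])
  qed
  have N: "N = bil H (e x $ 0 $ 0) (e x $ 1 $ 1) + bil H (e x $ 1 $ 1) (e x $ 0 $ 0)
        - bil H (e x $ 1 $ 0) (e x $ 0 $ 1) - bil H (e x $ 0 $ 1) (e x $ 1 $ 0)"
    unfolding N_def ginv_def by (rule sum_ginv_null_frame [OF null_frame_e [OF x]])
  have "\<forall>A A' B B'. bil (stress_energy g T x) (e x $ A $ A') (e x $ B $ B') = \<phi> $ A $ B * \<psi> $ A' $ B'"
    using assms(3,4) unfolding two_sym_iff
    by (simp add: stress N H T form_frame [OF x] bil_frame [OF x] forall_two algebra_simps)
  then show ?thesis by blast
qed

text \<open>The form \<open>\<iota>\<^sub>A\<^sub>' \<iota>\<^sub>B\<^sub>'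
  \<epsilon>\<^sub>A\<^sub>B\<close> written as the wedge product of the one-forms dual to
  \<open>V \<iota> 0\<close> and \<open>V \<iota> 1\<close>. Its nullity is then evident, and its
  derivative follows from the Leibniz rule.\<close>

definition null_kahler :: "spinor \<Rightarrow> tensor2" where
  "null_kahler \<iota> x = outer (g x *v V \<iota> 0 x) (g x *v V \<iota> 1 x) - outer (g x *v V \<iota> 1 x) (g x *v V \<iota> 0 x)"

lemma bil_null_kahler:
  "bil (null_kahler \<iota> x) X Y = bil (g x) (V \<iota> 0 x) X * bil (g x) (V \<iota> 1 x) Y
     - bil (g x) (V \<iota> 1 x) X * bil (g x) (V \<iota> 0 x) Y"
  by (simp add: null_kahler_def bil_outer) (simp add: bil_g_sym [of x "V \<iota> _ x"], simp add: bil_def inner_commute)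

lemma null_kahler_eq_form:
  assumes x: "x \<in> U"
  shows "null_kahler \<iota> x = form_of_spinors g e x 0 (\<chi> A' B'. \<iota> x $ A' * \<iota> x $ B')"
proof (rule matrix_eq_frameI [OF x])
  have "\<forall>A A' B B'. bil (null_kahler \<iota> x) (e x $ A $ A') (e x $ B $ B')
    = bil (form_of_spinors g e x 0 (\<chi> A' B'. \<iota> x $ A' * \<iota> x $ B')) (e x $ A $ A') (e x $ B $ B')"
    by (simp add: form_frame [OF x] bil_null_kahler spin_vec_def bil_frame [OF x] forall_two)
  then show "bil (null_kahler \<iota> x) (e x $ A $ A') (e x $ B $ B')
    = bil (form_of_spinors g e x 0 (\<chi> A' B'. \<iota> x $ A' * \<iota> x $ B')) (e x $ A $ A') (e x $ B $ B')" for A A' B B'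
    by blast
qed

lemma differentiable_null_kahler:
  assumes "x \<in> U" "\<iota> differentiable (at x)"
  shows "null_kahler \<iota> differentiable (at x)"
proof -
  have "(\<lambda>y. g y *v V \<iota> A y) differentiable (at x)" for A
    using assms by (intro differentiable_bilinear [OF bounded_bilinear_matrix_vector]
      differentiable_spin_vec differentiable_up differentiable_in [OF smooth_g])
  then show ?thesis
    unfolding null_kahler_def [abs_def]
    by (intro differentiable_diff differentiable_bilinear [OF bounded_bilinear_outer])
qed

lemma smooth_null_kahler: "smooth_in U \<iota> \<Longrightarrow> smooth_in U (null_kahler \<iota>)"
  unfolding null_kahler_def [abs_def]
  by (intro smooth_rules smooth_in_bilinear [OF U bounded_bilinear_outer] smooth_g smooth_spin_vec smooth_up U)

lemma nabla_matrix_null_kahler: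
  assumes x: "x \<in> U" and d: "\<iota> differentiable (at x)"
  shows "bil (nabla_matrix a (null_kahler \<iota>) x) X Y
    = bil (g x) (cov a (V \<iota> 0) x) X * bil (g x) (V \<iota> 1 x) Y + bil (g x) (V \<iota> 0 x) X * bil (g x) (cov a (V \<iota> 1) x) Y
    - bil (g x) (cov a (V \<iota> 1) x) X * bil (g x) (V \<iota> 0 x) Y - bil (g x) (V \<iota> 1 x) X * bil (g x) (cov a (V \<iota> 0) x) Y"
proof -
  have dV: "V \<iota> A differentiable (at x)" for A
    by (intro differentiable_spin_vec differentiable_up x d)
  have dg: "(\<lambda>y. bil (g y) (V \<iota> A y) Z) differentiable (at x)" for A Z
    unfolding bil_def
    by (intro differentiable_bilinear [OF bounded_bilinear_inner] dV
        differentiable_bilinear [OF bounded_bilinear_matrix_vector] differentiable_in [OF smooth_g x]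
        differentiable_const)
  have dgg: "(\<lambda>y. bil (g y) (V \<iota> A y) Z * bil (g y) (V \<iota> B y) Z') differentiable (at x)" for A B Z Z'
    by (intro differentiable_mult dg)
  \<comment> \<open>\<open>X\<close> and \<open>Y\<close> are extended with constant components; the
    terms with their covariant derivatives arise on both sides and cancel.\<close>
  have "pd a (\<lambda>y. bil (null_kahler \<iota> y) X Y) x = bil (nabla_matrix a (null_kahler \<iota>) x) X Y
      + bil (null_kahler \<iota> x) (cov a (\<lambda>y. X) x) Y + bil (null_kahler \<iota> x) X (cov a (\<lambda>y. Y) x)"
    by (rule pd_bil [OF differentiable_null_kahler [OF x d]]) auto
  moreover have "pd a (\<lambda>y. bil (g y) (V \<iota> A y) Z) x
      = bil (g x) (cov a (V \<iota> A) x) Z + bil (g x) (V \<iota> A x) (cov a (\<lambda>y. Z) x)" for A Z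
    by (rule pd_g [OF x dV]) auto
  ultimately show ?thesis
    unfolding bil_null_kahler by (simp add: pd_diff [OF dgg dgg] pd_mult [OF dg dg] algebra_simps)
qed

lemma nabla_matrix_cong:
  assumes "x \<in> U" "\<And>y. y \<in> U \<Longrightarrow> T y = S y"
  shows "nabla_matrix a T x = nabla_matrix a S x"
proof -
  have "pd a (\<lambda>y. T y $ b $ c) x = pd a (\<lambda>y. S y $ b $ c) x" for b c
    by (rule pd_cong [OF U assms(1)]) (simp add: assms(2))
  then show ?thesis by (simp add: nabla_matrix_def nabla_tensor2_def assms)
qed

lemma covariantly_constant_iff: "covariantly_constant U g T \<longleftrightarrow> (\<forall>x\<in>U. \<forall>a. nabla_matrix a T x = 0)"
  by (simp add: covariantly_constant_def nabla_matrix_def vec_eq_iff)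

text \<open>Torsion-freeness: in the cyclic sum the Christoffel terms cancel in pairs. A parallel
  two-form is therefore closed.\<close>

lemma nabla_matrix_closed:
  assumes "T differentiable (at x)" "\<And>y b c. T y $ b $ c = - T y $ c $ b"
  shows "pd a (\<lambda>y. T y $ b $ c) x + pd b (\<lambda>y. T y $ c $ a) x + pd c (\<lambda>y. T y $ a $ b) x
    = nabla_matrix a T x $ b $ c + nabla_matrix b T x $ c $ a + nabla_matrix c T x $ a $ b"
proof -
  have "(\<Sum>d\<in>UNIV. christoffel g x d i j * T x $ k $ d) = - (\<Sum>d\<in>UNIV. christoffel g x d j i * T x $ d $ k)" for i j k
    using assms(2) [of x k] by (simp add: christoffel_sym [of x _ i j] sum_negf [symmetric])
  then show ?thesis
    by (simp add: nabla_matrix_def nabla_tensor2_def)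
qed

end

section \<open>From constant spinors to Einstein--Maxwell spaces\<close>

context spin_space
begin

definition nabla_form :: "tensor2 \<Rightarrow> point \<Rightarrow> real^4 \<Rightarrow> real^4 \<Rightarrow> real^4 \<Rightarrow> real" where
  "nabla_form T x X Y Z = (\<Sum>a\<in>UNIV. X $ a * bil (nabla_matrix a T x) Y Z)"

lemma nabla_form_eq_sum: "nabla_form T x X Y Z = (\<Sum>a\<in>UNIV. \<Sum>b\<in>UNIV. \<Sum>c\<in>UNIV. nabla_matrix a T x $ b $ c * X $ a * Y $ b * Z $ c)"
  by (simp add: nabla_form_def bil_eq_sum sum_distrib_left mult_ac)

lemma nabla_form_linear: "nabla_form T x X Y (Z + Z') = nabla_form T x X Y Z + nabla_form T x X Y Z'"
  "nabla_form T x X Y (Z - Z') = nabla_form T x X Y Z - nabla_form T x X Y Z'"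
  "nabla_form T x X Y (k *\<^sub>R Z) = k * nabla_form T x X Y Z"
  by (simp_all add: nabla_form_def sum.distrib sum_subtractf sum_distrib_left algebra_simps)

lemma nabla_form_cyclic:
  assumes "\<And>a b c. nabla_matrix a T x $ b $ c + nabla_matrix b T x $ c $ a + nabla_matrix c T x $ a $ b = 0"
  shows "nabla_form T x X Y Z + nabla_form T x Y Z X + nabla_form T x Z X Y = 0"
proof -
  have 1: "nabla_form T x Y Z X = (\<Sum>a\<in>UNIV. \<Sum>b\<in>UNIV. \<Sum>c\<in>UNIV. nabla_matrix b T x $ c $ a * X $ a * Y $ b * Z $ c)"
  proof -
    have "nabla_form T x Y Z X = (\<Sum>b\<in>UNIV. \<Sum>c\<in>UNIV. \<Sum>a\<in>UNIV. nabla_matrix b T x $ c $ a * X $ a * Y $ b * Z $ c)"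
      by (simp add: nabla_form_eq_sum mult_ac)
    also have "\<dots> = (\<Sum>b\<in>UNIV. \<Sum>a\<in>UNIV. \<Sum>c\<in>UNIV. nabla_matrix b T x $ c $ a * X $ a * Y $ b * Z $ c)"
      by (intro sum.cong refl sum.swap)
    finally show ?thesis by (subst sum.swap)
  qed
  have 2: "nabla_form T x Z X Y = (\<Sum>a\<in>UNIV. \<Sum>b\<in>UNIV. \<Sum>c\<in>UNIV. nabla_matrix c T x $ a $ b * X $ a * Y $ b * Z $ c)"
  proof -
    have "nabla_form T x Z X Y = (\<Sum>c\<in>UNIV. \<Sum>a\<in>UNIV. \<Sum>b\<in>UNIV. nabla_matrix c T x $ a $ b * X $ a * Y $ b * Z $ c)"
      by (simp add: nabla_form_eq_sum mult_ac)
    also have "\<dots> = (\<Sum>a\<in>UNIV. \<Sum>c\<in>UNIV. \<Sum>b\<in>UNIV. nabla_matrix c T x $ a $ b * X $ a * Y $ b * Z $ c)"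
      by (rule sum.swap)
    also have "\<dots> = (\<Sum>a\<in>UNIV. \<Sum>b\<in>UNIV. \<Sum>c\<in>UNIV. nabla_matrix c T x $ a $ b * X $ a * Y $ b * Z $ c)"
      by (intro sum.cong refl sum.swap)
    finally show ?thesis .
  qed
  have "nabla_form T x X Y Z + nabla_form T x Y Z X + nabla_form T x Z X Y = (\<Sum>a\<in>UNIV. \<Sum>b\<in>UNIV. \<Sum>c\<in>UNIV.
     (nabla_matrix a T x $ b $ c + nabla_matrix b T x $ c $ a + nabla_matrix c T x $ a $ b) * X $ a * Y $ b * Z $ c)"
    unfolding 1 2 nabla_form_eq_sum [of T x X Y Z] by (simp add: sum.distrib algebra_simps)
  then show ?thesis by (simp add: assms)
qed

lemma divergence_nabla_form:
  assumes "null_frame (g x) v0 v1 w0 w1"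
  shows "(\<Sum>a\<in>UNIV. \<Sum>b\<in>UNIV. ginv g x $ a $ b * nabla_tensor2 g T x a b c)
    = nabla_form T x v0 w1 (axis c 1) + nabla_form T x w1 v0 (axis c 1) - nabla_form T x v1 w0 (axis c 1) - nabla_form T x w0 v1 (axis c 1)"
proof -
  define K where "K = (\<chi> a b. nabla_tensor2 g T x a b c)"
  have K: "bil K X Y = nabla_form T x X Y (axis c 1)" for X Y
  proof -
    have "(\<Sum>d\<in>UNIV. nabla_tensor2 g T x a b d * X $ a * Y $ b * axis c 1 $ d) = nabla_tensor2 g T x a b c * X $ a * Y $ b" for a b
      using sum_axis_mult [of c "\<lambda>d. nabla_tensor2 g T x a b d * X $ a * Y $ b"] by (simp add: mult_ac)
    then show ?thesis by (simp add: nabla_form_eq_sum bil_eq_sum K_def nabla_matrix_def)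
  qed
  have "(\<Sum>a\<in>UNIV. \<Sum>b\<in>UNIV. ginv g x $ a $ b * K $ a $ b)
    = bil K v0 w1 + bil K w1 v0 - bil K v1 w0 - bil K w0 v1"
    unfolding ginv_def by (rule sum_ginv_null_frame [OF assms])
  then show ?thesis unfolding K by (simp add: K_def)
qed

text \<open>Contract both primed indices with the dual spinor, whose pairing with \<iota> is one.
  Hence there is at most one solution, and \<open>THE\<close> is harmless once existence is
  known.\<close>

lemma is_ricci_spinor_nth:
  assumes "is_ricci_spinor g e \<iota> x \<phi>" "\<iota> x \<noteq> 0"
  shows "\<phi> $ A $ B = bil (Phi g x) (W \<iota> A x) (W \<iota> B x)"
proof -
  have "bil (Phi g x) (e x $ A $ A') (e x $ B $ B') = \<phi> $ A $ B * \<iota> x $ A' * \<iota> x $ B'" for A' B'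
    using assms(1) by (simp add: is_ricci_spinor_def spin_comp2_bil)
  then have "bil (Phi g x) (W \<iota> A x) (W \<iota> B x) = \<phi> $ A $ B *
      (\<iota> x $ 0 * dual_spinor \<iota> x $ 0 + \<iota> x $ 1 * dual_spinor \<iota> x $ 1) *
      (\<iota> x $ 0 * dual_spinor \<iota> x $ 0 + \<iota> x $ 1 * dual_spinor \<iota> x $ 1)"
    by (simp add: spin_vec_def algebra_simps)
  then show ?thesis by (simp add: dual_spinor [of \<iota> x, OF assms(2)])
qed

lemma is_ricci_spinor_unique:
  assumes "is_ricci_spinor g e \<iota> x \<phi>" "is_ricci_spinor g e \<iota> x \<phi>'" "\<iota> x \<noteq> 0"
  shows "\<phi> = \<phi>'"
  using is_ricci_spinor_nth [OF assms(1,3)] is_ricci_spinor_nth [OF assms(2,3)] by (simp add: vec_eq_iff)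

lemma e_VW:
  assumes "\<iota> x \<noteq> 0"
  shows "e x $ A $ 0 = dual_spinor \<iota> x $ 1 *\<^sub>R V \<iota> A x + \<iota> x $ 0 *\<^sub>R W \<iota> A x"
    "e x $ A $ 1 = \<iota> x $ 1 *\<^sub>R W \<iota> A x - dual_spinor \<iota> x $ 0 *\<^sub>R V \<iota> A x"
proof -
  note o = dual_spinor [of \<iota> x, OF assms]
  have "dual_spinor \<iota> x $ 1 *\<^sub>R V \<iota> A x + \<iota> x $ 0 *\<^sub>R W \<iota> A x
      = (\<iota> x $ 0 * dual_spinor \<iota> x $ 0 + \<iota> x $ 1 * dual_spinor \<iota> x $ 1) *\<^sub>R e x $ A $ 0"
    "\<iota> x $ 1 *\<^sub>R W \<iota> A x - dual_spinor \<iota> x $ 0 *\<^sub>R V \<iota> A x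
      = (\<iota> x $ 0 * dual_spinor \<iota> x $ 0 + \<iota> x $ 1 * dual_spinor \<iota> x $ 1) *\<^sub>R e x $ A $ 1"
    by (simp_all add: spin_vec_def algebra_simps)
  then show "e x $ A $ 0 = dual_spinor \<iota> x $ 1 *\<^sub>R V \<iota> A x + \<iota> x $ 0 *\<^sub>R W \<iota> A x"
    "e x $ A $ 1 = \<iota> x $ 1 *\<^sub>R W \<iota> A x - dual_spinor \<iota> x $ 0 *\<^sub>R V \<iota> A x"
    unfolding o by simp_all
qed

end

context constant_spinor_space
begin

lemma is_ricci_spinor_ricci_spinor:
  assumes x: "x \<in> U"
  shows "is_ricci_spinor g e \<iota> x (ricci_spinor x)"
proof -
  have Phi: "bil (Phi g x) (v A x) (v B x) = 0" "bil (Phi g x) (v A x) (w B x) = 0"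
    "bil (Phi g x) (w A x) (v B x) = 0" "bil (Phi g x) (w A x) (w B x) = ricci_spinor x $ A $ B" for A B
    using bil_sym [OF asd_ricci_sym [OF asd x], of "w A x" "v B x"]
    by (simp_all add: Phi_ricci [OF x] ricci_frame [OF x]) (simp add: ricci_spinor_def Phi_ricci [OF x])
  have "bil (Phi g x) (e x $ A $ A') (e x $ B $ B') = ricci_spinor x $ A $ B * \<iota> x $ A' * \<iota> x $ B'" for A A' B B'
  proof -
    have "\<forall>A' B'. bil (Phi g x) (e x $ A $ A') (e x $ B $ B') = ricci_spinor x $ A $ B * \<iota> x $ A' * \<iota> x $ B'"
      by (simp add: forall_two e_VW [of \<iota> x, OF iota_nonzero [OF x]] Phi)
    then show ?thesis by blast
  qed
  then show ?thesis
    using ricci_spinor_sym [OF x] by (simp add: is_ricci_spinor_def spin_comp2_bil two_sym_iff)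
qed

lemma ex1_ricci_spinor: "x \<in> U \<Longrightarrow> \<exists>!\<phi>. is_ricci_spinor g e \<iota> x \<phi>"
  using is_ricci_spinor_ricci_spinor is_ricci_spinor_unique iota_nonzero by blast

lemma the_ricci_spinor: "x \<in> U \<Longrightarrow> (THE \<phi>. is_ricci_spinor g e \<iota> x \<phi>) = ricci_spinor x"
  using is_ricci_spinor_ricci_spinor is_ricci_spinor_unique iota_nonzero by blast

lemma transpose_ricci_spinor: "x \<in> U \<Longrightarrow> transpose (ricci_spinor x) = ricci_spinor x"
  using ricci_spinor_sym by (simp add: two_sym_iff)

lemma maxwell_form:
  "x \<in> U \<Longrightarrow> maxwell_of_spinor U g e \<iota> x = form_of_spinors g e x (ricci_spinor x) (\<chi> A' B'. \<iota> x $ A' * \<iota> x $ B')"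
  by (simp add: maxwell_of_spinor_def the_ricci_spinor)

text \<open>Vanishing on the planes of \<open>v\<close> and of \<open>w\<close>, together with
  symmetry of the mixed components, is exactly anti-self-duality.\<close>

lemma curv_form_eq_form:
  assumes x: "x \<in> U"
  shows "curv_form x = form_of_spinors g e x (ricci_spinor x) 0"
proof (rule matrix_eq_frameI [OF x])
  fix A A' B B'
  note e = e_VW [of \<iota> x, OF iota_nonzero [OF x]]
  note o = dual_spinor [of \<iota> x, OF iota_nonzero [OF x]]
  have 1: "bil (curv_form x) (e x $ A $ 0) (e x $ B $ 1) = (\<iota> x $ 0 * dual_spinor \<iota> x $ 0 + \<iota> x $ 1 * dual_spinor \<iota> x $ 1) * ricci_spinor x $ A $ B" for A B
    unfolding e using ricci_spinor_sym [OF x, of A B] by (simp add: curv_form_frame [OF x] algebra_simps)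
  have 2: "bil (curv_form x) (e x $ A $ 1) (e x $ B $ 0) = - (\<iota> x $ 0 * dual_spinor \<iota> x $ 0 + \<iota> x $ 1 * dual_spinor \<iota> x $ 1) * ricci_spinor x $ A $ B" for A B
    unfolding e using ricci_spinor_sym [OF x, of A B] by (simp add: curv_form_frame [OF x] algebra_simps)
  have 3: "bil (curv_form x) (e x $ A $ 0) (e x $ B $ 0) = 0" "bil (curv_form x) (e x $ A $ 1) (e x $ B $ 1) = 0" for A B
    unfolding e using ricci_spinor_sym [OF x, of A B] by (simp_all add: curv_form_frame [OF x] algebra_simps)
  have "\<forall>A' B'. bil (curv_form x) (e x $ A $ A') (e x $ B $ B') = ricci_spinor x $ A $ B * eps A' B'"
    using 1 [of A B] 2 [of A B] 3 [of A B] by (simp add: forall_two o)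
  then show "bil (curv_form x) (e x $ A $ A') (e x $ B $ B')
      = bil (form_of_spinors g e x (ricci_spinor x) 0) (e x $ A $ A') (e x $ B $ B')"
    by (simp add: form_frame [OF x])
qed

text \<open>An exact form plus a parallel one. Smoothness and both Maxwell equations are proved for
  these two summands.\<close>

lemma maxwell_eq:
  assumes x: "x \<in> U"
  shows "maxwell_of_spinor U g e \<iota> x = curv_form x + null_kahler \<iota> x"
  unfolding maxwell_form [OF x] curv_form_eq_form [OF x] null_kahler_eq_form [OF x]
  by (rule matrix_eq_frameI [OF x]) (simp add: form_frame [OF x])

text \<open>Derivatives of \<open>v\<close> stay in its plane, so the wedge product is multiplied by
  the trace of the connection there; the trace vanishes since the products of
  \<open>cov a (v 0) x\<close> with \<open>w 1 x\<close> and of \<open>cov a (v 1) x\<close> with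
  \<open>w 0 x\<close> agree.\<close>

lemma nabla_matrix_null_kahler_zero:
  assumes x: "x \<in> U"
  shows "nabla_matrix a (null_kahler \<iota>) x = 0"
proof (rule matrix_eq_on_null_frame [OF frame_vw [OF x]])
  fix X Y
  assume "X \<in> {v 0 x, v 1 x, w 0 x, w 1 x}" "Y \<in> {v 0 x, v 1 x, w 0 x, w 1 x}"
  then show "bil (nabla_matrix a (null_kahler \<iota>) x) X Y = bil 0 X Y"
    by (auto simp: nabla_matrix_null_kahler [OF x differentiable_in [OF smooth_iota x]] connection_coefficients [OF x]
        null_frame_bil [OF frame_vw [OF x]])
qed

lemma smooth_curv_form: "smooth_in U curv_form"
  unfolding curv_form_def [abs_def] by (intro smooth_rules smooth_potential)

lemma curv_form_antisym: "curv_form x $ a $ b = - curv_form x $ b $ a"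
  by (simp add: curv_form_def)

lemma curv_form_transpose: "transpose (curv_form x) = - curv_form x"
  unfolding transpose_eq_minus_iff using curv_form_antisym by blast

lemma null_kahler_antisym: "null_kahler \<iota> x $ a $ b = - null_kahler \<iota> x $ b $ a"
  by (simp add: null_kahler_def outer_def mult.commute)

lemma curv_form_closed:
  assumes x: "x \<in> U"
  shows "pd a (\<lambda>y. curv_form y $ b $ c) x + pd b (\<lambda>y. curv_form y $ c $ a) x + pd c (\<lambda>y. curv_form y $ a $ b) x = 0"
proof -
  have d: "pd i (potential j) differentiable (at x)" for i j
    by (rule differentiable_in [OF smooth_in_pd [OF smooth_potential] x])
  show ?thesis
    using pd_commute_real [OF U smooth_potential x]
    by (simp add: curv_form_def pd_diff d)
qed

text \<open>The three conditions expressing anti-self-duality hold for \<open>curv_form\<close>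
  throughout \<open>U\<close> and survive covariant differentiation.\<close>

lemma nabla_matrix_curv_form_frame:
  assumes x: "x \<in> U"
  shows "bil (nabla_matrix a curv_form x) (v 0 x) (v 1 x) = 0" "bil (nabla_matrix a curv_form x) (w 0 x) (w 1 x) = 0"
    "bil (nabla_matrix a curv_form x) (v 0 x) (w 1 x) = bil (nabla_matrix a curv_form x) (v 1 x) (w 0 x)"
proof -
  have pd: "bil (nabla_matrix a curv_form x) (spin_vec p A x) (spin_vec q B x) = pd a (\<lambda>y. bil (curv_form y) (spin_vec p A y) (spin_vec q B y)) x
      - bil (curv_form x) (cov a (spin_vec p A) x) (spin_vec q B x) + bil (curv_form x) (cov a (spin_vec q B) x) (spin_vec p A x)"
    if "spin_vec p A differentiable (at x)" "spin_vec q B differentiable (at x)" for p q A B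
    using pd_bil [OF differentiable_in [OF smooth_curv_form x] that]
      bil_antisym [OF curv_form_transpose, of x "spin_vec p A x" "cov a (spin_vec q B) x"]
    by simp
  note dv = differentiable_in [OF smooth_v x] and dw = differentiable_in [OF smooth_w x]
  have FD: "bil (curv_form x) (cov a X x) Y = bil (g x) (cov a X x) (w 1 x) * bil (curv_form x) (v 0 x) Y
     - bil (g x) (cov a X x) (w 0 x) * bil (curv_form x) (v 1 x) Y
     - bil (g x) (cov a X x) (v 1 x) * bil (curv_form x) (w 0 x) Y
     + bil (g x) (cov a X x) (v 0 x) * bil (curv_form x) (w 1 x) Y" for X Y
    by (subst null_frame_expand [OF frame_vw [OF x], of "cov a X x"]) simp
  have z: "pd a (\<lambda>y. bil (curv_form y) (v 0 y) (v 1 y)) x = 0" "pd a (\<lambda>y. bil (curv_form y) (w 0 y) (w 1 y)) x = 0"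
    using pd_cong [OF U x, where h = "\<lambda>_. 0", OF curv_form_frame(1)]
      pd_cong [OF U x, where h = "\<lambda>_. 0", OF curv_form_frame(2)] by simp_all
  have "bil (curv_form y) (v 0 y) (w 1 y) = bil (curv_form y) (v 1 y) (w 0 y)" if "y \<in> U" for y
    using ricci_spinor_sym [OF that, of 0 1] by (simp add: curv_form_frame [OF that])
  then have z': "pd a (\<lambda>y. bil (curv_form y) (v 0 y) (w 1 y)) x = pd a (\<lambda>y. bil (curv_form y) (v 1 y) (w 0 y)) x"
    by (rule pd_cong [OF U x])
  show "bil (nabla_matrix a curv_form x) (v 0 x) (v 1 x) = 0" "bil (nabla_matrix a curv_form x) (w 0 x) (w 1 x) = 0"
    "bil (nabla_matrix a curv_form x) (v 0 x) (w 1 x) = bil (nabla_matrix a curv_form x) (v 1 x) (w 0 x)"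
    unfolding pd [OF dv dv] pd [OF dw dw] pd [OF dv dw] z z' FD
    using ricci_spinor_sym [OF x, of 1 0]
    by (simp_all add: connection_coefficients [OF x] curv_form_frame [OF x])
qed

lemma nabla_matrix_curv_form_antisym:
  assumes x: "x \<in> U"
  shows "bil (nabla_matrix a curv_form x) X Y = - bil (nabla_matrix a curv_form x) Y X"
proof (rule bil_antisym)
  have "nabla_tensor2 g curv_form x a b c = - nabla_tensor2 g curv_form x a c b" for b c
  proof -
    have "(\<lambda>y. curv_form y $ b $ c) = (\<lambda>y. - curv_form y $ c $ b)" using curv_form_antisym by blast
    then have "pd a (\<lambda>y. curv_form y $ b $ c) x = - pd a (\<lambda>y. curv_form y $ c $ b) x"
      using differentiable_nth [OF differentiable_nth [OF differentiable_in [OF smooth_curv_form x]]]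
      by (simp add: pd_minus)
    moreover have "(\<Sum>d\<in>UNIV. christoffel g x d i j * curv_form x $ d $ k) = - (\<Sum>d\<in>UNIV. christoffel g x d i j * curv_form x $ k $ d)" for i j k
      by (subst curv_form_antisym) (simp add: sum_negf)
    ultimately show ?thesis by (simp add: nabla_tensor2_def)
  qed
  then show "transpose (nabla_matrix a curv_form x) = - nabla_matrix a curv_form x"
    unfolding transpose_eq_minus_iff nabla_matrix_def vec_lambda_beta by blast
qed

text \<open>An anti-self-dual closed two-form is co-closed; here this is linear algebra in the
  null frame, as \<open>\<nabla>F\<close> is anti-self-dual in its form indices.\<close>

lemma curv_form_coclosed:
  assumes x: "x \<in> U"
  shows "(\<Sum>a\<in>UNIV. \<Sum>b\<in>UNIV. ginv g x $ a $ b * nabla_tensor2 g curv_form x a b c) = 0"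
proof -
  let ?T = "nabla_form curv_form x"
  have cyc: "?T X Y Z + ?T Y Z X + ?T Z X Y = 0" for X Y Z
  proof (rule nabla_form_cyclic)
    fix a b c
    show "nabla_matrix a curv_form x $ b $ c + nabla_matrix b curv_form x $ c $ a + nabla_matrix c curv_form x $ a $ b = 0"
      using nabla_matrix_closed [OF differentiable_in [OF smooth_curv_form x] curv_form_antisym, of a b c] curv_form_closed [OF x, of a b c]
      by simp
  qed
  have anti: "?T X Y Z = - ?T X Z Y" for X Y Z
    unfolding nabla_form_def sum_negf [symmetric]
    by (intro sum.cong refl) (simp add: nabla_matrix_curv_form_antisym [OF x, of _ Y Z])
  have asd: "?T X (v 0 x) (v 1 x) = 0" "?T X (w 0 x) (w 1 x) = 0"
    "?T X (v 0 x) (w 1 x) = ?T X (v 1 x) (w 0 x)" for X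
    by (simp_all add: nabla_form_def nabla_matrix_curv_form_frame [OF x])
  have asd': "?T X (v 1 x) (v 0 x) = 0" "?T X (w 1 x) (w 0 x) = 0"
    "?T X (w 1 x) (v 0 x) = - ?T X (v 0 x) (w 1 x)" "?T X (w 0 x) (v 1 x) = - ?T X (v 0 x) (w 1 x)"
    "?T X (v 1 x) (w 0 x) = ?T X (v 0 x) (w 1 x)"
    "?T X Y Y = 0" for X Y
    using anti [of X "v 1 x" "v 0 x"] anti [of X "w 1 x" "w 0 x"] anti [of X "w 1 x" "v 0 x"]
      anti [of X "w 0 x" "v 1 x"] anti [of X Y Y] by (simp_all add: asd(1,2)) (simp_all add: asd)
  \<comment> \<open>The divergence paired with \<open>Z\<close>. At a frame vector,
    \<open>asd'\<close> reduces it to a cyclic sum in which two arguments lie in the same null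
    plane.\<close>
  define dv where "dv Z = ?T (v 0 x) (w 1 x) Z + ?T (w 1 x) (v 0 x) Z - ?T (v 1 x) (w 0 x) Z - ?T (w 0 x) (v 1 x) Z" for Z
  have fr: "dv Z = 0" if "Z \<in> {v 0 x, v 1 x, w 0 x, w 1 x}" for Z
    using that cyc [of "v 0 x" "v 1 x" "w 0 x"] cyc [of "v 0 x" "v 1 x" "w 1 x"]
      cyc [of "w 0 x" "w 1 x" "v 0 x"] cyc [of "w 0 x" "w 1 x" "v 1 x"]
      anti [of _ "w 0 x" "v 0 x"] anti [of _ "w 1 x" "v 1 x"]
    by (auto simp: dv_def asd' asd(1,2))
  have "dv (Z + Z') = dv Z + dv Z'" "dv (Z - Z') = dv Z - dv Z'" "dv (k *\<^sub>R Z) = k * dv Z" for k Z Z'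
    by (simp_all add: dv_def nabla_form_linear algebra_simps)
  then have "dv Z = 0" for Z
    by (subst null_frame_expand [OF frame_vw [OF x], of Z]) (simp add: fr)
  then show ?thesis
    unfolding divergence_nabla_form [OF frame_vw [OF x]] dv_def .
qed

lemma smooth_field_maxwell: "smooth_field U (maxwell_of_spinor U g e \<iota>)"
proof -
  have "smooth_in U (\<lambda>y. curv_form y + null_kahler \<iota> y)"
    by (intro smooth_rules smooth_curv_form smooth_null_kahler smooth_iota)
  then show ?thesis
    using smooth_in_cong [OF U, where f = "maxwell_of_spinor U g e \<iota>", OF maxwell_eq]
    by (simp add: smooth_field_iff maxwell_of_spinor_def)
qed

lemma einstein_maxwell: "asd_einstein_maxwell U g e (maxwell_of_spinor U g e \<iota>)"
proof -
  let ?F = "maxwell_of_spinor U g e \<iota>" and ?\<psi> = "\<lambda>x. \<chi> A' B'. \<iota> x $ A' * \<iota> x $ B'"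
  have sym: "transpose (?\<psi> x) = ?\<psi> x" for x by (simp add: two_sym_iff)
  have F: "?F y $ b $ c = curv_form y $ b $ c + null_kahler \<iota> y $ b $ c" if "y \<in> U" for y b c
    by (simp add: maxwell_eq [OF that])
  have "maxwell_field U g ?F"
    unfolding maxwell_field_def two_form_def
  proof (intro conjI ballI allI smooth_field_maxwell)
    fix x assume x: "x \<in> U"
    show "transpose (?F x) = - ?F x"
      unfolding maxwell_form [OF x] by (rule form_of_spinors_antisym [OF x transpose_ricci_spinor [OF x] sym])
    have dF: "curv_form differentiable (at x)" and dS: "null_kahler \<iota> differentiable (at x)"
      using differentiable_in [OF smooth_curv_form x] differentiable_in [OF smooth_null_kahler [OF smooth_iota] x] .
    have pdF: "pd a (\<lambda>y. ?F y $ b $ c) x = pd a (\<lambda>y. curv_form y $ b $ c) x + pd a (\<lambda>y. null_kahler \<iota> y $ b $ c) x" for a b c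
      using pd_cong [OF U x, where f = "\<lambda>y. ?F y $ b $ c", OF F]
      by (simp add: pd_add differentiable_nth dF dS)
    have cS: "pd a (\<lambda>y. null_kahler \<iota> y $ b $ c) x + pd b (\<lambda>y. null_kahler \<iota> y $ c $ a) x + pd c (\<lambda>y. null_kahler \<iota> y $ a $ b) x = 0" for a b c
      unfolding nabla_matrix_closed [OF dS null_kahler_antisym] by (simp add: nabla_matrix_null_kahler_zero [OF x])
    show "pd a (\<lambda>y. ?F y $ b $ c) x + pd b (\<lambda>y. ?F y $ c $ a) x + pd c (\<lambda>y. ?F y $ a $ b) x = 0" for a b c
      using cS [of a b c] curv_form_closed [OF x, of a b c] by (simp add: pdF)
    have "nabla_tensor2 g (null_kahler \<iota>) x a b c = 0" for a b c
      using arg_cong [OF nabla_matrix_null_kahler_zero [OF x, of a], of "\<lambda>M. M $ b $ c"] by (simp add: nabla_matrix_def)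
    then have "nabla_tensor2 g ?F x a b c = nabla_tensor2 g curv_form x a b c" for a b c
      using pdF [of a b c] unfolding nabla_tensor2_def
      by (simp add: F [OF x] sum.distrib algebra_simps)
    then show "(\<Sum>a\<in>UNIV. \<Sum>b\<in>UNIV. ginv g x $ a $ b * nabla_tensor2 g ?F x a b c) = 0" for c
      using curv_form_coclosed [OF x] by simp
  qed
  moreover have "Phi g x = stress_energy g ?F x" if x: "x \<in> U" for x
  proof (rule matrix_eq_frameI [OF x])
    fix A A' B B'
    show "bil (Phi g x) (e x $ A $ A') (e x $ B $ B')
       = bil (stress_energy g ?F x) (e x $ A $ A') (e x $ B $ B')"
      using is_ricci_spinor_ricci_spinor [OF x]
      unfolding stress_energy_frame [where T = ?F, OF x maxwell_form [OF x] transpose_ricci_spinor [OF x] sym]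
      by (simp add: is_ricci_spinor_def spin_comp2_bil)
  qed
  ultimately show ?thesis
    using asd ricci_frame(1) by (simp add: asd_einstein_maxwell_def)
qed

section \<open>The self-dual part of the constructed field\<close>

lemma sd_spinor_maxwell:
  assumes x: "x \<in> U"
  shows "sd_spinor e (maxwell_of_spinor U g e \<iota>) x = (\<chi> A' B'. \<iota> x $ A' * \<iota> x $ B')"
  by (rule sd_spinor_form [where T = "maxwell_of_spinor U g e \<iota>", OF x maxwell_form [OF x] transpose_ricci_spinor [OF x]])

lemma sd_part_maxwell:
  assumes x: "x \<in> U"
  shows "sd_part g e (maxwell_of_spinor U g e \<iota>) x = null_kahler \<iota> x"
  by (simp add: sd_part_def sd_spinor_maxwell [OF x] null_kahler_eq_form [OF x])

lemma sd_part_parallel: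
  "covariantly_constant U g (sd_part g e (maxwell_of_spinor U g e \<iota>))"
  using nabla_matrix_cong [OF _ sd_part_maxwell] nabla_matrix_null_kahler_zero by (simp add: covariantly_constant_iff)

lemma sd_part_null: "null_form U (sd_part g e (maxwell_of_spinor U g e \<iota>))"
  unfolding null_form_def
proof (intro ballI conjI allI)
  fix x assume x: "x \<in> U"
  have "bil (null_kahler \<iota> x) (w 0 x) (w 1 x) = 1"
    by (simp add: bil_null_kahler null_frame_bil [OF frame_vw [OF x]])
  then have "null_kahler \<iota> x \<noteq> 0" by auto
  then show "sd_part g e (maxwell_of_spinor U g e \<iota>) x \<noteq> 0"
    by (simp add: sd_part_maxwell [OF x])
  show "sd_part g e (maxwell_of_spinor U g e \<iota>) x $ a $ b * sd_part g e (maxwell_of_spinor U g e \<iota>) x $ c $ d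
     + sd_part g e (maxwell_of_spinor U g e \<iota>) x $ a $ c * sd_part g e (maxwell_of_spinor U g e \<iota>) x $ d $ b
     + sd_part g e (maxwell_of_spinor U g e \<iota>) x $ a $ d * sd_part g e (maxwell_of_spinor U g e \<iota>) x $ b $ c = 0"
    for a b c d
    by (simp add: sd_part_maxwell [OF x] null_kahler_def outer_def algebra_simps)
qed

end

section \<open>From Einstein--Maxwell spaces to constant spinors\<close>

text \<open>Fixes two signs: that of the trace of a rank-one symmetric spinor, and the relative sign
  of two roots of the same square.\<close>

lemma connected_nonzero_sign:
  fixes f :: "'a::topological_space \<Rightarrow> real"
  assumes "connected U" "continuous_on U f" "\<And>x. x \<in> U \<Longrightarrow> f x \<noteq> 0"
  shows "(\<forall>x\<in>U. f x > 0) \<or> (\<forall>x\<in>U. f x < 0)"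
proof (rule ccontr)
  assume "\<not> ?thesis"
  then obtain x y where xy: "x \<in> U" "f x \<le> 0" "y \<in> U" "f y \<ge> 0" by force
  have "is_interval (f ` U)"
    using connected_continuous_image [OF assms(2,1)] by (simp add: is_interval_connected_1)
  then have "0 \<in> f ` U" using xy unfolding is_interval_1 by (metis imageI)
  then show False using assms(3) by force
qed

text \<open>A rank-one symmetric spinor \<open>P\<close> is, up to sign, the square of a spinor: under
  \<open>\<real>\<^sup>2 \<cong> \<complex>\<close> this amounts to a square root of its trace-free part, which exists globally
  because \<open>U\<close> is simply connected.\<close>

lemma rank_one_spinor_root:
  fixes P :: "point \<Rightarrow> real^2^2"
  assumes U: "open U" "simply_connected U" and P: "continuous_on U P"
    and sym: "\<And>x. x \<in> U \<Longrightarrow> P x $ 0 $ 1 = P x $ 1 $ 0"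
    and det: "\<And>x. x \<in> U \<Longrightarrow> P x $ 0 $ 0 * P x $ 1 $ 1 = P x $ 0 $ 1 * P x $ 0 $ 1"
    and nz: "\<And>x. x \<in> U \<Longrightarrow> P x \<noteq> 0"
  obtains \<sigma> :: real and \<iota> :: spinor where "\<sigma> = 1 \<or> \<sigma> = -1" "continuous_on U \<iota>"
    "\<And>x A B. x \<in> U \<Longrightarrow> \<iota> x $ A * \<iota> x $ B = \<sigma> * P x $ A $ B" "\<And>x. x \<notin> U \<Longrightarrow> \<iota> x = 0"
proof -
  define \<tau> where "\<tau> x = P x $ 0 $ 0 + P x $ 1 $ 1" for x
  have c: "continuous_on U (\<lambda>x. P x $ A $ B)" for A B
    by (intro continuous_on_component P)
  have sq: "(P x $ 0 $ 0 - P x $ 1 $ 1)\<^sup>2 + (2 * P x $ 0 $ 1)\<^sup>2 = (\<tau> x)\<^sup>2" if "x \<in> U" for x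
    using det [OF that] by (simp add: \<tau>_def power2_eq_square algebra_simps)
  have \<tau>nz: "\<tau> x \<noteq> 0" if x: "x \<in> U" for x
  proof
    assume "\<tau> x = 0"
    then have "(P x $ 0 $ 0 - P x $ 1 $ 1)\<^sup>2 + (2 * P x $ 0 $ 1)\<^sup>2 = 0" using sq [OF x] by simp
    then have "P x $ 0 $ 0 = P x $ 1 $ 1" "P x $ 0 $ 1 = 0"
      unfolding sum_power2_eq_zero_iff by auto
    with \<open>\<tau> x = 0\<close> sym [OF x] have "P x = 0"
      by (simp add: vec_eq_iff forall_two \<tau>_def)
    with nz [OF x] show False ..
  qed
  have "continuous_on U \<tau>" unfolding \<tau>_def by (intro continuous_intros c)
  then have "(\<forall>x\<in>U. \<tau> x > 0) \<or> (\<forall>x\<in>U. \<tau> x < 0)"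
    by (rule connected_nonzero_sign [OF simply_connected_imp_connected [OF U(2)]]) (rule \<tau>nz)
  \<comment> \<open>The square of a non-zero real spinor has positive trace, so the factor must be
    the sign of the trace, which is constant on \<open>U\<close>.\<close>
  then obtain \<sigma> :: real where \<sigma>: "\<sigma> = 1 \<or> \<sigma> = -1" "\<And>x. x \<in> U \<Longrightarrow> \<bar>\<tau> x\<bar> = \<sigma> * \<tau> x"
  proof (elim disjE)
    assume "\<forall>x\<in>U. 0 < \<tau> x" then show ?thesis by (intro that [of 1]) auto
  next
    assume "\<forall>x\<in>U. \<tau> x < 0" then show ?thesis by (intro that [of "-1"]) auto
  qed
  \<comment> \<open>If \<iota> is read as a complex number, the real and imaginary parts of its
    square are the difference of the diagonal entries and twice the off-diagonal entry of its tensor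
    square. The determinant condition makes the modulus of \<open>z\<close> the absolute
    trace.\<close>
  define z where "z x = Complex (\<sigma> * (P x $ 0 $ 0 - P x $ 1 $ 1)) (\<sigma> * (2 * P x $ 0 $ 1))" for x
  have \<sigma>2: "\<sigma>\<^sup>2 = 1" using \<sigma>(1) by auto
  have nz': "norm (z x) = \<bar>\<tau> x\<bar>" if "x \<in> U" for x
    using sq [OF that] by (simp add: z_def complex_norm power_mult_distrib \<sigma>2)
  have "continuous_on U z"
    unfolding z_def by (intro continuous_on_Complex continuous_intros c)
  moreover have "z x \<noteq> 0" if "x \<in> U" for x
    using nz' [OF that] \<tau>nz [OF that] by auto
  ultimately obtain h where h: "continuous_on U h" "\<And>x. x \<in> U \<Longrightarrow> z x = exp (h x)"
    using continuous_logarithm_on_simply_connected U open_imp_locally_path_connected by metis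
  \<comment> \<open>Half of a continuous logarithm gives a continuous square root without branch
    points.\<close>
  define s where "s x = exp (h x / 2)" for x
  have s: "(s x)\<^sup>2 = z x" if "x \<in> U" for x
    using h(2) [OF that] by (simp add: s_def exp_double [symmetric])
  define \<iota> :: spinor where
    "\<iota> x = (if x \<in> U then (Re (s x)) *\<^sub>R axis 0 1 + (Im (s x)) *\<^sub>R axis 1 1 else 0)" for x
  have \<iota>: "\<iota> x $ 0 = Re (s x)" "\<iota> x $ 1 = Im (s x)" if "x \<in> U" for x
    using that by (simp_all add: \<iota>_def axis_def)
  have "continuous_on U s" unfolding s_def by (intro continuous_intros h) auto
  then have "continuous_on U (\<lambda>x. (Re (s x)) *\<^sub>R axis 0 1 + (Im (s x)) *\<^sub>R axis 1 1 :: real^2)"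
    by (intro continuous_intros)
  then have cont: "continuous_on U \<iota>"
    by (rule continuous_on_eq) (simp add: \<iota>_def)
  have "\<forall>A B. \<iota> x $ A * \<iota> x $ B = \<sigma> * P x $ A $ B" if x: "x \<in> U" for x
  proof -
    have "(Re (s x))\<^sup>2 - (Im (s x))\<^sup>2 = \<sigma> * (P x $ 0 $ 0 - P x $ 1 $ 1)"
      "2 * Re (s x) * Im (s x) = \<sigma> * (2 * P x $ 0 $ 1)"
      using arg_cong [OF s [OF x], of Re] arg_cong [OF s [OF x], of Im]
      by (simp_all add: z_def power2_eq_square mult_ac)
    moreover have "(Re (s x))\<^sup>2 + (Im (s x))\<^sup>2 = \<sigma> * \<tau> x"
      using arg_cong [OF s [OF x], of norm] nz' [OF x] \<sigma>(2) [OF x]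
      by (simp add: norm_power cmod_power2 [symmetric])
    ultimately show ?thesis
      using sym [OF x] by (simp add: forall_two \<iota> [OF x] \<tau>_def power2_eq_square algebra_simps)
  qed
  then show ?thesis
    by (intro that [OF \<sigma>(1) cont]) (auto simp: \<iota>_def)
qed

text \<open>With the value \<open>?c\<close> of \<iota> at \<open>x\<close> frozen, applying
  \<open>P y\<close> to \<open>?c\<close> gives a multiple of \<open>\<iota> y\<close>, and the
  squared multiplier is \<open>q y\<close>. By continuity the multiplier is positive near
  \<open>x\<close>, so there \<iota> is a differentiable expression in \<open>P\<close>.\<close>

lemma spinor_root_differentiable:
  fixes P :: "point \<Rightarrow> real^2^2" and \<iota> :: spinor
  assumes U: "open U" "x \<in> U" and cont: "continuous_on U \<iota>" and nz: "\<iota> x \<noteq> 0"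
    and P: "P differentiable (at x)" and root: "\<And>y A B. y \<in> U \<Longrightarrow> \<iota> y $ A * \<iota> y $ B = P y $ A $ B"
  shows "\<iota> differentiable (at x)"
proof -
  let ?c = "\<iota> x"
  define q where "q y = ?c \<bullet> (P y *v ?c)" for y
  have Pc: "P y *v ?c = (\<iota> y \<bullet> ?c) *\<^sub>R \<iota> y" if "y \<in> U" for y
    using root [OF that, symmetric]
    by (simp add: vec_eq_iff matrix_vector_mult_def inner_vec_def sum_distrib_left mult_ac)
  have q: "q y = (\<iota> y \<bullet> ?c)\<^sup>2" if "y \<in> U" for y
    by (simp add: q_def Pc [OF that] power2_eq_square inner_commute)
  have dPc: "(\<lambda>y. P y *v ?c) differentiable (at x)"
    by (rule differentiable_bilinear [OF bounded_bilinear_matrix_vector P differentiable_const])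
  then have "q differentiable (at x)"
    unfolding q_def [abs_def] by (intro differentiable_bilinear [OF bounded_bilinear_inner differentiable_const])
  moreover have "q x > 0" using q [OF U(2)] nz by simp
  ultimately have "(\<lambda>y. sqrt (q y)) differentiable (at x)"
    unfolding differentiable_def using has_derivative_real_sqrt by blast
  then have "(\<lambda>y. inverse (sqrt (q y))) differentiable (at x)"
    using \<open>q x > 0\<close> by (intro differentiable_inverse) auto
  then have d: "(\<lambda>y. inverse (sqrt (q y)) *\<^sub>R (P y *v ?c)) differentiable (at x)"
    by (intro differentiable_bilinear [OF bounded_bilinear_scaleR] dPc)
  let ?O = "U \<inter> (\<lambda>y. \<iota> y \<bullet> ?c) -` {0<..}"
  have "open ?O"
    by (rule continuous_open_preimage [OF continuous_on_inner [OF cont continuous_on_const] U(1)]) simp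
  moreover have "x \<in> ?O" using U nz by simp
  moreover have "inverse (sqrt (q y)) *\<^sub>R (P y *v ?c) = \<iota> y" if "y \<in> ?O" for y
    using that by (simp add: q Pc)
  ultimately show ?thesis
    using d has_derivative_transform_within_open unfolding differentiable_def by blast
qed

context spin_space
begin

lemma nabla_matrix_scaleR:
  assumes "T differentiable (at x)"
  shows "nabla_matrix a (\<lambda>y. k *\<^sub>R T y) x = k *\<^sub>R nabla_matrix a T x"
proof -
  have "pd a (\<lambda>y. k * T y $ b $ c) x = k * pd a (\<lambda>y. T y $ b $ c) x" for b c
    by (simp add: pd_mult differentiable_nth assms)
  then show ?thesis
    by (simp add: nabla_matrix_def nabla_tensor2_def vec_eq_iff sum_distrib_left algebra_simps)
qed

text \<open>A pointwise converse of \<open>nabla_matrix_null_kahler_zero\<close>. It asks only for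
  differentiability of \<iota>, because smoothness of the root is deduced afterwards from the
  equation proved here.\<close>

lemma parallel_null_kahler_constant:
  assumes x: "x \<in> U" and d: "\<iota> differentiable (at x)" and nz: "\<iota> x \<noteq> 0"
    and par: "nabla_matrix a (null_kahler \<iota>) x = 0"
  shows "nabla_spinor g e \<iota> x a B' = 0"
proof -
  note fr = null_frame_bil [OF null_frame_VW [of x \<iota>, OF x nz]]
  have anti: "bil (g x) (cov a (V \<iota> A) x) (V \<iota> B x) = - bil (g x) (cov a (V \<iota> B) x) (V \<iota> A x)" for A B
    by (rule bil_cov_antisym [OF x]) (auto intro: differentiable_spin_vec differentiable_up x d simp: bil_spin_vec)
  \<comment> \<open>The first component yields the vanishing of the product of the derivative of
    \<open>V \<iota> 0\<close> with \<open>V \<iota> 1\<close>, the second the mixed symmetry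
    required by \<open>constant_spinorI\<close>.\<close>
  have "bil (nabla_matrix a (null_kahler \<iota>) x) (V \<iota> 1 x) (W \<iota> 0 x) = 0" "bil (nabla_matrix a (null_kahler \<iota>) x) (W \<iota> 1 x) (W \<iota> 0 x) = 0"
    by (simp_all add: par)
  then show ?thesis
    using anti [of 1 0] unfolding nabla_matrix_null_kahler [OF x d]
    by (intro constant_spinorI [OF x d nz]) (simp_all add: fr)
qed

text \<open>Bootstrapping: the partial derivatives of \<iota> are smooth matrices applied to
  \<iota>, so each order of differentiability implies the next.\<close>

lemma nabla_zero_smooth:
  assumes cont: "continuous_on U \<iota>" and d: "\<And>x. x \<in> U \<Longrightarrow> \<iota> differentiable (at x)"
    and nab: "\<And>x a B'. x \<in> U \<Longrightarrow> nabla_spinor g e \<iota> x a B' = 0"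
  shows "smooth_in U \<iota>"
  unfolding smooth_in_def
proof
  define M :: "4 \<Rightarrow> point \<Rightarrow> real^2^2" where "M a x = (\<chi> B' C'. spin_conn g e x a B' C')" for a x
  have M: "smooth_in U (M a)" for a
    unfolding M_def by (intro smooth_rules smooth_spin_conn)
  have pd: "pd a \<iota> x = M a x *v \<iota> x" if x: "x \<in> U" for a x
    using nab [OF x, of a] by (simp add: nabla_spinor_def vec_eq_iff pd_nth d [OF x] matrix_vector_mult_def M_def)
  fix k
  show "Ck_on k \<iota> U"
  proof (induction k)
    case (Suc k)
    have "Ck_on k (\<lambda>x. M a x *v \<iota> x) U" for a
      using M Suc by (intro Ck_on_bilinear [OF U bounded_bilinear_matrix_vector]) (auto simp: smooth_in_def)
    then have "Ck_on k (pd a \<iota>) U" for a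
      using Ck_on_cong [OF U, where f = "pd a \<iota>", OF pd] by blast
    then show ?case using d by (simp add: differentiable_at_imp_differentiable_on)
  qed (use cont in simp)
qed

lemma sd_part_frame:
  "x \<in> U \<Longrightarrow> bil (sd_part g e F x) (e x $ A $ A') (e x $ B $ B') = sd_spinor e F x $ A' $ B' * eps A B"
  by (simp add: sd_part_def form_frame)

lemma null_form_det:
  assumes null: "null_form U (sd_part g e F)" and x: "x \<in> U" and anti: "transpose (F x) = - F x"
  shows "sd_spinor e F x $ 0 $ 0 * sd_spinor e F x $ 1 $ 1 = sd_spinor e F x $ 0 $ 1 * sd_spinor e F x $ 0 $ 1"
    and "sd_spinor e F x \<noteq> 0"
proof -
  let ?S = "sd_part g e F x"
  have S: "transpose ?S = - ?S"
    unfolding sd_part_def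
    by (rule form_of_spinors_antisym [OF x _ sd_spinor_sym [of F x, OF anti]]) (simp add: two_sym_iff)
  have plucker: "bil ?S X Y * bil ?S Z Z' - bil ?S X Z * bil ?S Y Z' + bil ?S X Z' * bil ?S Y Z = 0" for X Y Z Z'
  proof -
    have "bil ?S X Y * bil ?S Z Z' = (\<Sum>a\<in>UNIV. \<Sum>c\<in>UNIV. \<Sum>b\<in>UNIV. \<Sum>d\<in>UNIV.
       (?S $ a $ b * ?S $ c $ d) * X $ a * Y $ b * Z $ c * Z' $ d)"
      unfolding bil_eq_sum sum_product by (simp add: mult_ac)
    also have "\<dots> = (\<Sum>a\<in>UNIV. \<Sum>b\<in>UNIV. \<Sum>c\<in>UNIV. \<Sum>d\<in>UNIV.
       (?S $ a $ b * ?S $ c $ d) * X $ a * Y $ b * Z $ c * Z' $ d)"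
      by (intro sum.cong refl sum.swap)
    finally have "bil ?S X Y * bil ?S Z Z' - bil ?S X Z * bil ?S Y Z' + bil ?S X Z' * bil ?S Y Z
      = (\<Sum>a\<in>UNIV. \<Sum>b\<in>UNIV. \<Sum>c\<in>UNIV. \<Sum>d\<in>UNIV.
       (?S $ a $ b * ?S $ c $ d - ?S $ a $ c * ?S $ b $ d + ?S $ a $ d * ?S $ b $ c) * X $ a * Y $ b * Z $ c * Z' $ d)"
      unfolding bil_mult_sum [of ?S X Z ?S Y Z'] bil_mult_sum' [of ?S X Z' ?S Y Z]
      by (simp add: sum.distrib sum_subtractf algebra_simps)
    moreover have "?S $ a $ b * ?S $ c $ d - ?S $ a $ c * ?S $ b $ d + ?S $ a $ d * ?S $ b $ c = 0" for a b c d
    proof -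
      have "?S $ b $ d = - ?S $ d $ b" using S unfolding transpose_eq_minus_iff by blast
      moreover have "?S $ a $ b * ?S $ c $ d + ?S $ a $ c * ?S $ d $ b + ?S $ a $ d * ?S $ b $ c = 0"
        using null x by (simp add: null_form_def)
      ultimately show ?thesis by simp
    qed
    ultimately show ?thesis by simp
  qed
  have "sd_spinor e F x $ 0 $ 1 = sd_spinor e F x $ 1 $ 0"
    using sd_spinor_sym [of F x, OF anti] by (simp add: two_sym_iff)
  \<comment> \<open>On the four frame vectors, grouped by primed index, the Pluecker relation is
    precisely the vanishing of the determinant.\<close>
  then show "sd_spinor e F x $ 0 $ 0 * sd_spinor e F x $ 1 $ 1 = sd_spinor e F x $ 0 $ 1 * sd_spinor e F x $ 0 $ 1"
    using plucker [of "e x $ 0 $ 0" "e x $ 1 $ 0" "e x $ 0 $ 1" "e x $ 1 $ 1"]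
    by (simp add: sd_part_frame [OF x])
  show "sd_spinor e F x \<noteq> 0"
  proof
    assume "sd_spinor e F x = 0"
    then have "?S = 0" by (intro matrix_eq_frameI [OF x]) (simp add: sd_part_frame [OF x])
    then show False using null x by (simp add: null_form_def)
  qed
qed

text \<open>The root of the self-dual part supplies \<iota>. The Einstein equation then forces the
  anti-self-dual part, up to the same \<sigma>, to be the Ricci spinor, so the field built from
  \<iota> reproduces all of \<open>F\<close> and not only its self-dual half.\<close>

lemma constant_spinor_of_maxwell:
  assumes sc: "simply_connected U" and em: "asd_einstein_maxwell U g e F"
    and null: "null_form U (sd_part g e F)" and par: "covariantly_constant U g (sd_part g e F)"
  obtains \<iota> \<sigma> where "\<sigma> = 1 \<or> \<sigma> = -1" "constant_spinor U g e \<iota>"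
    "maxwell_of_spinor U g e \<iota> = (\<lambda>x. \<sigma> *\<^sub>R F x)"
proof -
  let ?P = "sd_spinor e F"
  have F: "smooth_in U F" "\<And>x. x \<notin> U \<Longrightarrow> F x = 0" "\<And>x. x \<in> U \<Longrightarrow> transpose (F x) = - F x"
    using em by (auto simp: asd_einstein_maxwell_def maxwell_field_def two_form_def smooth_field_iff)
  have asd: "asd_metric U g e" and Phi: "\<And>x. x \<in> U \<Longrightarrow> Phi g x = stress_energy g F x"
    using em by (auto simp: asd_einstein_maxwell_def)
  have P: "smooth_in U ?P"
  proof -
    have "smooth_in U (\<lambda>x. \<chi> A' B'. (1/2) * (bil (F x) (e x $ 0 $ A') (e x $ 1 $ B') - bil (F x) (e x $ 1 $ A') (e x $ 0 $ B')))"
      by (intro smooth_rules smooth_bil F(1) smooth_e)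
    moreover have "?P = (\<lambda>x. \<chi> A' B'. (1/2) * (bil (F x) (e x $ 0 $ A') (e x $ 1 $ B') - bil (F x) (e x $ 1 $ A') (e x $ 0 $ B')))"
      by (simp add: fun_eq_iff vec_eq_iff sd_spinor_nth)
    ultimately show ?thesis by simp
  qed
  have Psym: "?P x $ 0 $ 1 = ?P x $ 1 $ 0" if "x \<in> U" for x
    using sd_spinor_sym [of F, OF F(3) [OF that]] by (simp add: two_sym_iff)
  obtain \<sigma> :: real and \<iota> :: spinor where \<sigma>: "\<sigma> = 1 \<or> \<sigma> = -1" and cont: "continuous_on U \<iota>"
    and root: "\<And>x A B. x \<in> U \<Longrightarrow> \<iota> x $ A * \<iota> x $ B = \<sigma> * ?P x $ A $ B"
    and off: "\<And>x. x \<notin> U \<Longrightarrow> \<iota> x = 0"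
    using rank_one_spinor_root [OF U sc smooth_in_continuous_on [OF P] Psym
        null_form_det(1) [OF null _ F(3)] null_form_det(2) [OF null _ F(3)]] by metis
  have \<sigma>\<sigma>: "\<sigma> * (\<sigma> * t) = t" for t using \<sigma> by auto
  have nz: "\<iota> x \<noteq> 0" if x: "x \<in> U" for x
  proof
    assume "\<iota> x = 0"
    then have "?P x = 0" using root [OF x] \<sigma> by (auto simp: vec_eq_iff)
    then show False using null_form_det(2) [OF null x F(3) [OF x]] by simp
  qed
  have d: "\<iota> differentiable (at x)" if x: "x \<in> U" for x
  proof (rule spinor_root_differentiable [OF U x cont nz [OF x]])
    show "(\<lambda>y. \<sigma> *\<^sub>R ?P y) differentiable (at x)"
      using differentiable_in [OF P x] by simp
    show "\<iota> y $ A * \<iota> y $ B = (\<sigma> *\<^sub>R ?P y) $ A $ B" if "y \<in> U" for y A B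
      using root [OF that] by simp
  qed
  have nab: "nabla_spinor g e \<iota> x a B' = 0" if x: "x \<in> U" for x a B'
  proof (rule parallel_null_kahler_constant [OF x d [OF x] nz [OF x]])
    have "sd_part g e F y = \<sigma> *\<^sub>R null_kahler \<iota> y" if y: "y \<in> U" for y
      by (rule matrix_eq_frameI [OF y])
        (simp add: sd_part_frame [OF y] null_kahler_eq_form [OF y] form_frame [OF y] root [OF y] \<sigma>\<sigma>)
    from nabla_matrix_cong [OF x this] have "nabla_matrix a (sd_part g e F) x = \<sigma> *\<^sub>R nabla_matrix a (null_kahler \<iota>) x"
      using nabla_matrix_scaleR [OF differentiable_null_kahler [OF x d [OF x]]] by simp
    then show "nabla_matrix a (null_kahler \<iota>) x = 0"
      using par x \<sigma> by (auto simp: covariantly_constant_iff)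
  qed
  have const: "constant_spinor U g e \<iota>"
    using nabla_zero_smooth [OF cont d nab] nz nab off
    by (simp add: constant_spinor_def smooth_field_iff)
  interpret constant_spinor_space U g e \<iota>
    by unfold_locales (use asd const in auto)
  have "maxwell_of_spinor U g e \<iota> x = \<sigma> *\<^sub>R F x" for x
  proof (cases "x \<in> U")
    case x: True
    let ?\<phi> = "asd_spinor e F x"
    note dec = two_form_decomp [where T = F, OF x F(3) [OF x]]
    \<comment> \<open>Since \<sigma> squares to one, it may be inserted on both factors of the
      stress-energy tensor; on the self-dual factor it produces the square of \<iota>.\<close>
    have "is_ricci_spinor g e \<iota> x (\<sigma> *\<^sub>R ?\<phi>)"
    proof -
      have "bil (Phi g x) (e x $ A $ A') (e x $ B $ B') = (\<sigma> *\<^sub>R ?\<phi>) $ A $ B * \<iota> x $ A' * \<iota> x $ B'" for A A' B B'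
      proof -
        have "bil (Phi g x) (e x $ A $ A') (e x $ B $ B') = ?\<phi> $ A $ B * ?P x $ A' $ B'"
          unfolding Phi [OF x]
          by (rule stress_energy_frame [where T = F, OF x dec asd_spinor_sym [of F, OF F(3) [OF x]] sd_spinor_sym [of F, OF F(3) [OF x]]])
        also have "\<dots> = \<sigma> * ?\<phi> $ A $ B * (\<sigma> * ?P x $ A' $ B')" using \<sigma> by auto
        finally show ?thesis by (simp add: root [OF x, symmetric])
      qed
      then show ?thesis
        using asd_spinor_sym [of F, OF F(3) [OF x]]
        by (simp add: is_ricci_spinor_def spin_comp2_bil two_sym_iff)
    qed
    then have ricci_spinor: "ricci_spinor x = \<sigma> *\<^sub>R ?\<phi>"
      using is_ricci_spinor_unique is_ricci_spinor_ricci_spinor [OF x] iota_nonzero [OF x] by blast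
    show ?thesis
      unfolding maxwell_form [OF x] ricci_spinor
      by (rule matrix_eq_frameI [OF x], subst dec)
        (simp add: form_frame [OF x] root [OF x] algebra_simps)
  next
    case False
    then show ?thesis by (simp add: maxwell_of_spinor_def F(2))
  qed
  then show ?thesis by (intro that [OF \<sigma> const]) auto
qed

end

section \<open>Passage to classes up to sign, and bijectivity\<close>

lemma maxwell_of_spinor_minus:
  "maxwell_of_spinor U g e (\<lambda>x. - \<iota> x) = maxwell_of_spinor U g e \<iota>"
proof -
  have "is_ricci_spinor g e (\<lambda>x. - \<iota> x) x = is_ricci_spinor g e \<iota> x" for x
    by (intro ext) (simp add: is_ricci_spinor_def)
  then show ?thesis by (intro ext) (simp add: maxwell_of_spinor_def)
qed

text \<open>The field is quadratic in the spinor, so both representatives contribute the same class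
  to the union: the map is well defined.\<close>

lemma em_space_of_up_to_sign:
  "em_space_of U (g, e, up_to_sign \<iota>) = (g, e, up_to_sign (maxwell_of_spinor U g e \<iota>))"
  by (simp add: em_space_of_def up_to_sign_def maxwell_of_spinor_minus)

lemma up_to_sign_uminus: "up_to_sign (\<lambda>x. - f x) = up_to_sign f"
  by (auto simp: up_to_sign_def)

lemma constant_spinor_spaceI:
  "open U \<Longrightarrow> asd_metric U g e \<Longrightarrow> constant_spinor U g e \<iota> \<Longrightarrow> constant_spinor_space U g e \<iota>"
  by (simp add: constant_spinor_space_def constant_spinor_space_axioms_def spin_space_def asd_metric_def)

text \<open>The equality case of Cauchy-Schwarz: equal squares give equal norms and
  \<open>p \<bullet> q\<close> of maximal size, and positivity selects the sign.\<close>

lemma spinor_eq_of_squares: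
  fixes p q :: "real^2"
  assumes "\<And>A B. p $ A * p $ B = q $ A * q $ B" "p \<bullet> q > 0"
  shows "p = q"
proof -
  have pp: "p \<bullet> p = q \<bullet> q" using assms(1) by (simp add: spinor_inner)
  have "(p \<bullet> q)\<^sup>2 = (p $ 0 * p $ 0) * (q $ 0 * q $ 0) + 2 * ((p $ 0 * p $ 1) * (q $ 0 * q $ 1))
      + (p $ 1 * p $ 1) * (q $ 1 * q $ 1)"
    by (simp add: spinor_inner power2_eq_square algebra_simps)
  also have "\<dots> = (q \<bullet> q)\<^sup>2"
    unfolding assms(1) by (simp add: spinor_inner power2_eq_square algebra_simps)
  finally have "p \<bullet> q = q \<bullet> q" using assms(2) by (simp add: power2_eq_iff_nonneg)
  then have "(p - q) \<bullet> (p - q) = 0"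
    using pp by (simp add: inner_diff_left inner_diff_right inner_commute)
  then show ?thesis by simp
qed

text \<open>The self-dual part recovers the square of the spinor, hence the spinor up to a sign at
  each point. The product of the two spinors never vanishes, so on a connected set the sign is the
  same everywhere.\<close>

lemma up_to_sign_spinor_eqI:
  assumes "open U" "connected U" "asd_metric U g e" "constant_spinor U g e \<iota>" "constant_spinor U g e \<kappa>"
    and eq: "maxwell_of_spinor U g e \<kappa> \<in> up_to_sign (maxwell_of_spinor U g e \<iota>)"
  shows "up_to_sign \<kappa> = up_to_sign \<iota>"
proof -
  interpret I: constant_spinor_space U g e \<iota> using assms constant_spinor_spaceI by blast
  interpret K: constant_spinor_space U g e \<kappa> using assms constant_spinor_spaceI by blast
  have off: "\<iota> x = 0" "\<kappa> x = 0" if "x \<notin> U" for x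
    using assms that by (auto simp: constant_spinor_def smooth_field_iff)
  have sq: "\<kappa> x $ A * \<kappa> x $ B = \<iota> x $ A * \<iota> x $ B" if x: "x \<in> U" for x A B
  proof -
    note sd = I.sd_spinor_maxwell [OF x] K.sd_spinor_maxwell [OF x]
    from eq consider "maxwell_of_spinor U g e \<kappa> = maxwell_of_spinor U g e \<iota>"
      | "maxwell_of_spinor U g e \<kappa> = (\<lambda>x. - maxwell_of_spinor U g e \<iota> x)"
      by (auto simp: up_to_sign_def)
    then show ?thesis
    proof cases
      case 1
      then show ?thesis using sd by (simp add: vec_eq_iff)
    next
      case 2
      have "sd_spinor e (maxwell_of_spinor U g e \<kappa>) x = - sd_spinor e (maxwell_of_spinor U g e \<iota>) x"
        unfolding 2 by (simp add: vec_eq_iff I.sd_spinor_nth field_simps)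
      then have "\<kappa> x $ A * \<kappa> x $ B = - (\<iota> x $ A * \<iota> x $ B)" for A B
        unfolding sd by (simp add: vec_eq_iff)
      \<comment> \<open>Taking traces excludes opposite fields: both norms are positive.\<close>
      then have "\<kappa> x \<bullet> \<kappa> x = - (\<iota> x \<bullet> \<iota> x)" by (simp add: spinor_inner)
      then show ?thesis using K.iota_nonzero [OF x] I.iota_nonzero [OF x]
        inner_gt_zero_iff [of "\<kappa> x"] inner_gt_zero_iff [of "\<iota> x"] by linarith
    qed
  qed
  have "\<kappa> x \<bullet> \<iota> x \<noteq> 0" if x: "x \<in> U" for x
  proof
    assume 0: "\<kappa> x \<bullet> \<iota> x = 0"
    have "\<kappa> x $ A * (\<kappa> x \<bullet> \<iota> x) = \<iota> x $ A * (\<iota> x \<bullet> \<iota> x)" for A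
    proof -
      have "\<kappa> x $ A * (\<kappa> x \<bullet> \<iota> x) = (\<kappa> x $ A * \<kappa> x $ 0) * \<iota> x $ 0 + (\<kappa> x $ A * \<kappa> x $ 1) * \<iota> x $ 1"
        by (simp add: spinor_inner algebra_simps)
      also have "\<dots> = \<iota> x $ A * (\<iota> x \<bullet> \<iota> x)"
        unfolding sq [OF x] by (simp add: spinor_inner algebra_simps)
      finally show ?thesis .
    qed
    then have "\<iota> x $ A = 0" for A using 0 I.iota_nonzero [OF x] by simp
    then have "\<iota> x = 0" by (simp add: vec_eq_iff)
    with I.iota_nonzero [OF x] show False ..
  qed
  moreover have "continuous_on U (\<lambda>x. \<kappa> x \<bullet> \<iota> x)"
    by (intro continuous_on_inner smooth_in_continuous_on I.smooth_iota K.smooth_iota)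
  ultimately consider "\<forall>x\<in>U. \<kappa> x \<bullet> \<iota> x > 0" | "\<forall>x\<in>U. \<kappa> x \<bullet> \<iota> x < 0"
    using connected_nonzero_sign [OF assms(2)] by blast
  then show ?thesis
  proof cases
    case 1
    have "\<kappa> x = \<iota> x" for x
      using 1 off [of x] spinor_eq_of_squares [of "\<kappa> x" "\<iota> x"] sq [of x] by (cases "x \<in> U") auto
    then have "\<kappa> = \<iota>" ..
    then show ?thesis by simp
  next
    case 2
    have "\<kappa> x = - \<iota> x" for x
      using 2 off [of x] spinor_eq_of_squares [of "\<kappa> x" "- \<iota> x"] sq [of x] by (cases "x \<in> U") auto
    then have "\<kappa> = (\<lambda>x. - \<iota> x)" ..
    then show ?thesis by (simp add: up_to_sign_uminus)
  qed
qed

theorem proposition2p2: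
  fixes U :: "point set"
  assumes "open U" and "simply_connected U"
  shows "(\<forall>g e \<iota>. asd_metric U g e \<and> constant_spinor U g e \<iota> \<longrightarrow>
            (\<forall>x\<in>U. \<exists>!\<phi>. is_ricci_spinor g e \<iota> x \<phi>))
         \<and> bij_betw (em_space_of U) (asd_spinor_spaces U) (asd_em_spaces U)"
proof (intro conjI allI impI ballI)
  fix g e \<iota> x
  assume "asd_metric U g e \<and> constant_spinor U g e \<iota>" "x \<in> U"
  then show "\<exists>!\<phi>. is_ricci_spinor g e \<iota> x \<phi>"
    using constant_spinor_space.ex1_ricci_spinor constant_spinor_spaceI [OF assms(1)] by blast
next
  show "bij_betw (em_space_of U) (asd_spinor_spaces U) (asd_em_spaces U)"
    unfolding bij_betw_def
  proof
    show "inj_on (em_space_of U) (asd_spinor_spaces U)"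
    proof (rule inj_onI)
      fix S S'
      assume "S \<in> asd_spinor_spaces U" "S' \<in> asd_spinor_spaces U" and eq: "em_space_of U S = em_space_of U S'"
      then obtain g e \<iota> g' e' \<kappa> where S: "S = (g, e, up_to_sign \<iota>)" "asd_metric U g e" "constant_spinor U g e \<iota>"
        and S': "S' = (g', e', up_to_sign \<kappa>)" "constant_spinor U g' e' \<kappa>"
        unfolding asd_spinor_spaces_def by blast
      from eq have "g' = g" "e' = e"
        and up: "up_to_sign (maxwell_of_spinor U g e \<iota>) = up_to_sign (maxwell_of_spinor U g e \<kappa>)"
        unfolding S(1) S'(1) em_space_of_up_to_sign by auto
      moreover have "maxwell_of_spinor U g e \<kappa> \<in> up_to_sign (maxwell_of_spinor U g e \<iota>)"
        unfolding up by (simp add: up_to_sign_def)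
      ultimately have "up_to_sign \<kappa> = up_to_sign \<iota>"
        using up_to_sign_spinor_eqI [OF assms(1) simply_connected_imp_connected [OF assms(2)] S(2,3)] S'(2) by blast
      then show "S = S'" using S(1) S'(1) \<open>g' = g\<close> \<open>e' = e\<close> by simp
    qed
    show "em_space_of U ` asd_spinor_spaces U = asd_em_spaces U"
    proof (intro equalityI subsetI)
      fix S assume "S \<in> em_space_of U ` asd_spinor_spaces U"
      then obtain g e \<iota> where S: "S = (g, e, up_to_sign (maxwell_of_spinor U g e \<iota>))"
        "asd_metric U g e" "constant_spinor U g e \<iota>"
        unfolding asd_spinor_spaces_def by (auto simp: em_space_of_up_to_sign)
      interpret constant_spinor_space U g e \<iota> using S assms(1) constant_spinor_spaceI by blast
      show "S \<in> asd_em_spaces U"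
        unfolding S(1) asd_em_spaces_def using einstein_maxwell sd_part_null sd_part_parallel by blast
    next
      fix S assume "S \<in> asd_em_spaces U"
      then obtain g e F where S: "S = (g, e, up_to_sign F)" and em: "asd_einstein_maxwell U g e F"
        and sd: "null_form U (sd_part g e F)" "covariantly_constant U g (sd_part g e F)"
        unfolding asd_em_spaces_def by blast
      have asd: "asd_metric U g e" using em by (simp add: asd_einstein_maxwell_def)
      interpret spin_space U g e
        by unfold_locales (use asd assms(1) in \<open>auto simp: asd_metric_def\<close>)
      obtain \<iota> \<sigma> where \<sigma>: "\<sigma> = 1 \<or> \<sigma> = (-1::real)" and \<iota>: "constant_spinor U g e \<iota>"
        and F: "maxwell_of_spinor U g e \<iota> = (\<lambda>x. \<sigma> *\<^sub>R F x)"
        using constant_spinor_of_maxwell [OF assms(2) em sd] by blast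
      have "up_to_sign (maxwell_of_spinor U g e \<iota>) = up_to_sign F"
        unfolding F by (rule disjE [OF \<sigma>]) (simp_all add: up_to_sign_uminus)
      then have "S = em_space_of U (g, e, up_to_sign \<iota>)" by (simp add: S em_space_of_up_to_sign)
      then show "S \<in> em_space_of U ` asd_spinor_spaces U"
        using asd \<iota> unfolding asd_spinor_spaces_def by blast
    qed
  qed
qed

end
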